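(* Let $N\ge2$ be an integer, $0\le b<2<q<2^*_b$ and $0\le\eta\le b$. Then $E^q_{b,\mathrm{rad}}\hookrightarrow L^r_\eta(\mathbb{R}^N)$ continuously for $$r\in[2^{\mathrm{rad}}_{b,q,\eta},\infty)\ \text{ if }N=2,\qquad r\in[2^{\mathrm{rad}}_{b,q,\eta},2^*_\eta]\ \text{ if }N\ge3,$$ and, for $\theta\in[0,1]$ such that $\frac1r=\theta\frac{N-2}{2(N-\eta)}+(1-\theta)\frac{N-b}{q(N-\eta)}$, there is a constant $C>0$ such that $$\left(\int_{\mathbb{R}^N}\frac{|u|^r}{|x|^\eta}dx\right)^{1/r}\le C\,\|\nabla u\|_2^{\theta}\,\big\||\cdot|^{-b/q}u\big\|_q^{1-\theta}\qquad\text{for all }u\in E^q_{b,\mathrm{rad}}(\mathbb{R}^N).$$ Moreover, all these embeddings are compact except for the endpoints of these intervals.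
   Context: For $0\le\eta<N$: $2^*_\eta=+\infty$ if $N=2$ and $2^*_\eta=\frac{2(N-\eta)}{N-2}$ if $N\ge3$. $2^{\mathrm{rad}}_{b,q,\eta}=\frac{q(N-\eta)}{N-b}$ if $b\le\eta$, and $2^{\mathrm{rad}}_{b,q,\eta}=\frac{q(2N-2-\eta)+2(b-\eta)}{2N-2-b}$ if $0\le\eta<b$. For $r\ge1$, $L^r_\eta(\mathbb{R}^N)=L^r(\mathbb{R}^N;|x|^{-\eta}dx)$; $\|\cdot\|_s$ is the norm of $L^s(\mathbb{R}^N)$. The space $E^q_b=\{u\in L^q_b(\mathbb{R}^N):\nabla u\in (L^2(\mathbb{R}^N))^N\}$ (weak gradient) carries the norm $\|u\|=\big[\int_{\mathbb{R}^N}|\nabla u|^2dx+\big(\int_{\mathbb{R}^N}\frac{|u|^q}{|x|^b}dx\big)^{2/q}\big]^{1/2}$, and $E^q_{b,\mathrm{rad}}$ is its subspace of radial functions. *)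

theory Defs
  imports "HOL-Analysis.Analysis"
begin

definition crit_exp :: "nat \<Rightarrow> real \<Rightarrow> ereal" where
  "crit_exp N \<eta> = (if N = 2 then \<infinity> else ereal (2 * (real N - \<eta>) / (real N - 2)))"

definition rad_exp :: "nat \<Rightarrow> real \<Rightarrow> real \<Rightarrow> real \<Rightarrow> real" where
  "rad_exp N b q \<eta> =
     (if b \<le> \<eta> then q * (real N - \<eta>) / (real N - b)
      else (q * (2 * real N - 2 - \<eta>) + 2 * (b - \<eta>)) / (2 * real N - 2 - b))"


text \<open>Elements of Lebesgue spaces are represented by functions, not by classes of functions that
  agree almost everywhere; everything below depends on these functions only up to null sets.\<close>

definition Lp_space :: "'a measure \<Rightarrow> real \<Rightarrow> ('a \<Rightarrow> real) set" where
  "Lp_space M s = {f \<in> borel_measurable M. integrable M (\<lambda>x. \<bar>f x\<bar> powr s)}"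

definition Lp_norm :: "'a measure \<Rightarrow> real \<Rightarrow> ('a \<Rightarrow> real) \<Rightarrow> real" where
  "Lp_norm M s f = (LINT x|M. \<bar>f x\<bar> powr s) powr (1 / s)"

definition weighted_lebesgue :: "real \<Rightarrow> (real ^ 'n) measure" where
  "weighted_lebesgue \<eta> = density lebesgue (\<lambda>x. ennreal (norm x powr (- \<eta>)))"


definition partial_deriv :: "'n \<Rightarrow> (real ^ 'n \<Rightarrow> real) \<Rightarrow> real ^ 'n \<Rightarrow> real" where
  "partial_deriv i f x = frechet_derivative f (at x) (axis i 1)"

primrec C_k :: "nat \<Rightarrow> (real ^ 'n \<Rightarrow> real) \<Rightarrow> bool" where
  "C_k 0 f \<longleftrightarrow> continuous_on UNIV f"
| "C_k (Suc k) f \<longleftrightarrow> f differentiable_on UNIV \<and> (\<forall>i. C_k k (partial_deriv i f))"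

definition test_functions :: "(real ^ 'n \<Rightarrow> real) set" where
  "test_functions = {\<phi>. (\<forall>k. C_k k \<phi>) \<and> compact (closure {x. \<phi> x \<noteq> 0})}"

definition locally_integrable :: "(real ^ 'n \<Rightarrow> real) \<Rightarrow> bool" where
  "locally_integrable f \<longleftrightarrow> (\<forall>K. compact K \<longrightarrow> f absolutely_integrable_on K)"

definition has_weak_gradient :: "(real ^ 'n \<Rightarrow> real) \<Rightarrow> (real ^ 'n \<Rightarrow> real ^ 'n) \<Rightarrow> bool" where
  "has_weak_gradient u G \<longleftrightarrow>
     locally_integrable u \<and> (\<forall>i. locally_integrable (\<lambda>x. G x $ i)) \<and>
     (\<forall>\<phi>\<in>test_functions. \<forall>i.
        (LINT x|lebesgue. u x * partial_deriv i \<phi> x) = - (LINT x|lebesgue. G x $ i * \<phi> x))"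

text \<open>A weak gradient is unique up to null sets, so the choice made here does not matter.\<close>

definition weak_gradient :: "(real ^ 'n \<Rightarrow> real) \<Rightarrow> real ^ 'n \<Rightarrow> real ^ 'n" where
  "weak_gradient u = (SOME G. has_weak_gradient u G)"


definition E_space :: "real \<Rightarrow> real \<Rightarrow> (real ^ 'n \<Rightarrow> real) set" where
  "E_space b q = {u \<in> Lp_space (weighted_lebesgue b) q.
     (\<exists>G. has_weak_gradient u G) \<and> (\<forall>i. (\<lambda>x. weak_gradient u x $ i) \<in> Lp_space lebesgue 2)}"

definition E_norm :: "real \<Rightarrow> real \<Rightarrow> (real ^ 'n \<Rightarrow> real) \<Rightarrow> real" where
  "E_norm b q u =
     ((LINT x|lebesgue. (norm (weak_gradient u x))\<^sup>2)
        + (LINT x|lebesgue. \<bar>u x\<bar> powr q / norm x powr b) powr (2 / q)) powr (1 / 2)"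

definition radial :: "(real ^ 'n \<Rightarrow> real) \<Rightarrow> bool" where
  "radial u \<longleftrightarrow> (\<exists>f. AE x in lebesgue. u x = f (norm x))"

definition E_rad :: "real \<Rightarrow> real \<Rightarrow> (real ^ 'n \<Rightarrow> real) set" where
  "E_rad b q = {u \<in> E_space b q. radial u}"


definition continuous_embedding ::
  "('a \<Rightarrow> real) set \<Rightarrow> (('a \<Rightarrow> real) \<Rightarrow> real) \<Rightarrow>
   ('a \<Rightarrow> real) set \<Rightarrow> (('a \<Rightarrow> real) \<Rightarrow> real) \<Rightarrow> bool" where
  "continuous_embedding X normX Y normY \<longleftrightarrow>
     X \<subseteq> Y \<and> (\<exists>C. \<forall>u\<in>X. normY u \<le> C * normX u)"

definition compact_embedding ::
  "('a \<Rightarrow> real) set \<Rightarrow> (('a \<Rightarrow> real) \<Rightarrow> real) \<Rightarrow>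
   ('a \<Rightarrow> real) set \<Rightarrow> (('a \<Rightarrow> real) \<Rightarrow> real) \<Rightarrow> bool" where
  "compact_embedding X normX Y normY \<longleftrightarrow>
     continuous_embedding X normX Y normY \<and>
     (\<forall>u :: nat \<Rightarrow> 'a \<Rightarrow> real. (\<forall>n. u n \<in> X) \<and> bdd_above (range (\<lambda>n. normX (u n))) \<longrightarrow>
        (\<exists>v\<in>Y. \<exists>\<sigma>. strict_mono \<sigma> \<and> (\<lambda>n. normY (\<lambda>x. u (\<sigma> n) x - v x)) \<longlonglongrightarrow> 0))"

text \<open>The set of real \<open>r\<close> with \<open>rad_exp \<le> r \<le> crit_exp\<close>; for \<open>N = 2\<close> the upper end is infinite
  and thereby excluded.\<close>

definition embedding_range :: "nat \<Rightarrow> real \<Rightarrow> real \<Rightarrow> real \<Rightarrow> real set" where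
  "embedding_range N b q \<eta> = {r. rad_exp N b q \<eta> \<le> r \<and> ereal r \<le> crit_exp N \<eta>}"

end

theory Submission
  imports Defs "HOL-Complex_Analysis.Great_Picard" "HOL-Real_Asymp.Real_Asymp"
begin

text \<open>
  Write \<open>N\<close> for the dimension, \<open>\<sigma>\<close> for the area of the unit sphere, \<open>D\<close> for the \<open>L\<^sup>2\<close> norm of the gradient
  and \<open>Q\<close> for the weighted \<open>L\<^sup>q\<close> norm.  Everything rests on a fundamental theorem of calculus for radial
  functions: a radial function with weak gradient \<open>G\<close> agrees almost everywhere with \<open>H (norm x)\<close>, where
  \<open>H\<close> is continuous on the positive half-line and \<open>H t - H s\<close> is the integral of
  \<open>(G x \<bullet> x) * norm x powr (- N) / \<sigma>\<close> over the annulus between the radii \<open>s\<close> and \<open>t\<close>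
  (\<open>weak_gradient_radial_profile\<close>).  It comes from testing the weak gradient with the fields
  \<open>x * norm x powr (- N) * Z ((norm x)\<^sup>2)\<close> and from the lemma of du Bois-Reymond in the radial variable.
  The integrals stay on \<open>N\<close>-dimensional space, so that \<open>G\<close> need not be radial.

  The weighted \<open>q\<close>-th moment is finite and forces \<open>H\<close> to come arbitrarily close to \<open>0\<close> at infinity.  Hence
  \<open>\<bar>H s\<bar> powr m\<close> is at most the integral of \<open>m * \<bar>u\<bar> powr (m - 1) * \<bar>G\<bar> * norm x powr (1 - N) / \<sigma>\<close> over the
  exterior of the ball of radius \<open>s\<close> (\<open>H_powr_tail\<close>).  With \<open>m = (q + 2) / 2\<close> and the Cauchy-Schwarz
  inequality this is a pointwise decay estimate, \<open>radial_bound\<close>, and the lower end of the range of \<open>r\<close> is exactly the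
  exponent at which this estimate bounds the \<open>r\<close>-th moment by the \<open>q\<close>-th one (\<open>lower_endpoint\<close>).  For
  \<open>N \<ge> 3\<close> the critical exponent follows from Hardy's inequality together with the decay
  \<open>D * s powr (- (N - 2) / 2)\<close> (\<open>upper_endpoint\<close>); for \<open>N = 2\<close>, where there is no critical exponent, the
  exponent can be raised by \<open>2\<close> at the price of a factor \<open>D\<^sup>2\<close> (\<open>planar_step\<close>).  Interpolation fills the
  range, and since the powers of \<open>D\<close> and \<open>Q\<close> are dictated by scaling they are affine in \<open>r\<close>
  (\<open>gn_inequality_radial\<close>).

  For the compactness, bounded sequences have equicontinuous profiles, so a subsequence converges
  pointwise.  At an exponent strictly inside the range, the uniform decay rules out a loss of mass at infinity and
  the boundedness of a higher moment rules out concentration (\<open>moment_tendsto_zero\<close>).  At the ends of the range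
  suitable bumps on annuli, with radii tending to infinity or to \<open>0\<close>, are bounded in the energy norm, have disjoint
  supports, and have \<open>r\<close>-th moments bounded from below (\<open>not_compact_embedding_if_bumps\<close>).
\<close>

section \<open>Integration of radial functions\<close>

abbreviation sphere_area :: "nat \<Rightarrow> real" where
  "sphere_area n \<equiv> real n * unit_ball_vol (real n)"

text \<open>Both measures assign to \<open>{..a}\<close> the volume of the ball of radius \<open>a\<close>, and these half-lines generate the Borel sets.\<close>
lemma distr_norm_lborel:
  "distr (lborel :: 'a::euclidean_space measure) borel norm =
   density lborel (\<lambda>s. ennreal (sphere_area DIM('a) * s ^ (DIM('a) - 1)) * indicator {0..} s)"
  (is "?M = ?D")
proof (rule measure_eqI_generator_eq[where E = "range (\<lambda>a::real. {..a})" and \<Omega> = UNIV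
      and A = "\<lambda>i::nat. {..real i}"])
  have ball: "emeasure ?M {..a} = ennreal (unit_ball_vol DIM('a) * a ^ DIM('a)) * indicator {0..} a" for a
  proof -
    have "emeasure ?M {..a} = emeasure (lborel :: 'a measure) {x. norm x \<le> a}"
      by (subst emeasure_distr) (auto simp: vimage_def)
    also have "{x::'a. norm x \<le> a} = cball 0 a" by auto
    also have "emeasure lborel (cball (0::'a) a) =
        ennreal (unit_ball_vol DIM('a) * a ^ DIM('a)) * indicator {0..} a"
      by (cases "0 \<le> a") (auto simp: emeasure_cball)
    finally show ?thesis .
  qed
  have dens: "emeasure ?D {..a} = ennreal (unit_ball_vol DIM('a) * a ^ DIM('a)) * indicator {0..} a" for a
  proof (cases "0 \<le> a")
    case True
    have "emeasure ?D {..a} =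
        (\<integral>\<^sup>+s. ennreal (sphere_area DIM('a) * s ^ (DIM('a) - 1)) * indicator {0..a} s \<partial>lborel)"
      by (subst emeasure_density) (auto intro!: nn_integral_cong split: split_indicator)
    also have "\<dots> = ennreal (unit_ball_vol DIM('a) * a ^ DIM('a) - unit_ball_vol DIM('a) * 0 ^ DIM('a))"
      using True by (intro nn_integral_FTC_Icc) (auto intro!: derivative_eq_intros)
    finally show ?thesis using True by (simp add: power_0_left)
  next
    case False
    have "emeasure ?D {..a} = (\<integral>\<^sup>+s. ennreal (sphere_area DIM('a) * s ^ (DIM('a) - 1)) * indicator {0..} s * indicator {..a} s \<partial>lborel)"
      by (subst emeasure_density) auto
    also have "\<dots> = (\<integral>\<^sup>+s. 0 \<partial>(lborel::real measure))"
      using False by (intro nn_integral_cong) (auto split: split_indicator)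
    finally show ?thesis using False by simp
  qed
  show "\<And>X. X \<in> range (\<lambda>a::real. {..a}) \<Longrightarrow> emeasure ?M X = emeasure ?D X"
    using ball dens by auto
  show "Int_stable (range (\<lambda>a::real. {..a}))" by (auto simp: Int_stable_def)
  show "sets ?M = sigma_sets UNIV (range (\<lambda>a::real. {..a}))"
       "sets ?D = sigma_sets UNIV (range (\<lambda>a::real. {..a}))"
    by (simp_all add: borel_eq_atMost)
  show "(\<Union>i::nat. {..real i}) = UNIV" using real_arch_simple by auto
  show "emeasure ?M {..real i} \<noteq> \<infinity>" for i by (auto simp: ball ennreal_mult_eq_top_iff)
qed auto

lemma nn_integral_norm_polar:
  assumes [measurable]: "F \<in> borel_measurable borel"
  shows "(\<integral>\<^sup>+x. F (norm (x::'a::euclidean_space)) \<partial>lborel) =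
    (\<integral>\<^sup>+s. F s * (ennreal (sphere_area DIM('a) * s ^ (DIM('a) - 1)) * indicator {0..} s) \<partial>lborel)"
proof -
  have "(\<integral>\<^sup>+x. F (norm (x::'a)) \<partial>lborel) = (\<integral>\<^sup>+s. F s \<partial>distr (lborel::'a measure) borel norm)"
    by (subst nn_integral_distr) auto
  then show ?thesis
    by (simp add: distr_norm_lborel nn_integral_density mult.commute)
qed

text \<open>The distribution of the norm has a density, so preimages of null sets of radii are null; the radius \<open>0\<close> is attained at a single point.\<close>
lemma AE_norm_lborel:
  assumes "AE s in lborel. 0 < s \<longrightarrow> P s"
  shows "AE x::'a::euclidean_space in lborel. P (norm x)"
proof -
  have "AE s in distr (lborel::'a measure) borel norm. 0 < s \<longrightarrow> P s"
    unfolding distr_norm_lborel using assms by (subst AE_density) auto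
  then have "AE x::'a in lborel. 0 < norm x \<longrightarrow> P (norm x)"
    by (rule AE_distrD[rotated]) simp
  moreover have "AE x::'a in lborel. x \<noteq> 0"
    by (rule AE_lborel_singleton)
  ultimately show ?thesis by eventually_elim auto
qed

lemma power_mult_powr_minus:
  fixes s :: real
  assumes "0 < n"
  shows "s ^ (n - 1) * (s powr (- a) * indicator {0..} s) = s powr (real n - 1 - a) * indicator {0..} s"
proof (cases "s > 0")
  case True
  with assms have "s ^ (n - 1) = s powr (real n - 1)"
    by (simp add: powr_realpow[symmetric] of_nat_diff)
  then show ?thesis using True by (simp add: powr_add[symmetric] algebra_simps)
qed (auto simp: indicator_def)

lemma nn_integral_norm_powr:
  fixes A :: "real set"
  assumes [measurable]: "A \<in> sets borel"
  shows "(\<integral>\<^sup>+x. ennreal (norm (x::'a::euclidean_space) powr (- a)) * indicator A (norm x) \<partial>lborel) =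
    ennreal (sphere_area DIM('a)) *
      (\<integral>\<^sup>+s. ennreal (s powr (real DIM('a) - 1 - a)) * indicator ({0..} \<inter> A) s \<partial>lborel)"
proof -
  have "(\<integral>\<^sup>+x. ennreal (norm (x::'a) powr (- a)) * indicator A (norm x) \<partial>lborel) =
    (\<integral>\<^sup>+s. ennreal (s powr (-a)) * indicator A s * (ennreal (sphere_area DIM('a) * s ^ (DIM('a) - 1)) * indicator {0..} s) \<partial>lborel)"
    by (subst nn_integral_norm_polar[where F = "\<lambda>s. ennreal (s powr (-a)) * indicator A s"]) auto
  also have "\<dots> = (\<integral>\<^sup>+s. ennreal (sphere_area DIM('a)) *
       (ennreal (s powr (real DIM('a) - 1 - a)) * indicator ({0..} \<inter> A) s) \<partial>lborel)"
  proof (rule nn_integral_cong)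
    fix s :: real
    have "s powr (-a) * (sphere_area DIM('a) * s ^ (DIM('a) - 1))
        = sphere_area DIM('a) * s powr (real DIM('a) - 1 - a)" if "0 \<le> s"
      using power_mult_powr_minus[of "DIM('a)" s a] that by (simp add: algebra_simps)
    then show "ennreal (s powr (-a)) * indicator A s * (ennreal (sphere_area DIM('a) * s ^ (DIM('a) - 1)) * indicator {0..} s)
      = ennreal (sphere_area DIM('a)) * (ennreal (s powr (real DIM('a) - 1 - a)) * indicator ({0..} \<inter> A) s)"
      by (auto simp: ennreal_mult'[symmetric] split: split_indicator)
  qed
  finally show ?thesis by (simp add: nn_integral_cmult)
qed

lemma nn_integral_norm_powr_outside:
  assumes "0 < s" "real DIM('a) < a"
  shows "(\<integral>\<^sup>+x. ennreal (norm (x::'a::euclidean_space) powr (- a)) * indicator {s<..} (norm x) \<partial>lborel)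
    \<le> ennreal (sphere_area DIM('a) / (a - real DIM('a)) * s powr (real DIM('a) - a))"
proof -
  let ?n = "real DIM('a)"
  have "(\<integral>\<^sup>+t. ennreal (t powr (?n - 1 - a)) * indicator ({0..} \<inter> {s<..}) t \<partial>lborel)
      \<le> (\<integral>\<^sup>+t. ennreal (t powr (?n - 1 - a)) * indicator {s..} t \<partial>lborel)"
    by (intro nn_integral_mono) (auto split: split_indicator)
  also have "\<dots> = ennreal (0 - s powr (?n - a) / (?n - a))"
  proof (rule nn_integral_FTC_atLeast)
    show "((\<lambda>t. t powr (?n - a) / (?n - a)) \<longlongrightarrow> 0) at_top"
      by (intro tendsto_divide_zero tendsto_neg_powr filterlim_ident) (use assms in simp)
    show "DERIV (\<lambda>t. t powr (?n - a) / (?n - a)) t :> t powr (?n - 1 - a)" if "s \<le> t" for t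
      using DERIV_cdivide[OF has_real_derivative_powr[of t "?n - a"], of "?n - a"] that assms
      by (simp add: diff_diff_eq add.commute)
  qed (use assms in auto)
  also have "0 - s powr (?n - a) / (?n - a) = 1 / (a - ?n) * s powr (?n - a)"
    using assms by (simp add: field_simps)
  finally have le: "(\<integral>\<^sup>+t. ennreal (t powr (?n - 1 - a)) * indicator ({0..} \<inter> {s<..}) t \<partial>lborel)
      \<le> ennreal (1 / (a - ?n) * s powr (?n - a))" .
  have "(\<integral>\<^sup>+x. ennreal (norm (x::'a) powr (- a)) * indicator {s<..} (norm x) \<partial>lborel)
      \<le> ennreal (sphere_area DIM('a)) * ennreal (1 / (a - ?n) * s powr (?n - a))"
    by (subst nn_integral_norm_powr, simp) (intro mult_left_mono le, simp)
  also have "\<dots> = ennreal (sphere_area DIM('a) / (a - ?n) * s powr (?n - a))"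
    using assms by (subst ennreal_mult[symmetric]) auto
  finally show ?thesis .
qed

lemma nn_integral_norm_powr_inside:
  assumes "0 \<le> t" "a < real DIM('a)"
  shows "(\<integral>\<^sup>+x. ennreal (norm (x::'a::euclidean_space) powr (- a)) * indicator {..t} (norm x) \<partial>lborel)
    = ennreal (sphere_area DIM('a) / (real DIM('a) - a) * t powr (real DIM('a) - a))"
proof -
  let ?n = "real DIM('a)"
  have "((\<lambda>s. s powr (?n - 1 - a)) has_integral (t powr (?n - 1 - a + 1) / (?n - 1 - a + 1))) {0..t}"
    using assms by (intro has_integral_powr_from_0) auto
  then have "(\<integral>\<^sup>+s\<in>{0..t}. ennreal (s powr (?n - 1 - a)) \<partial>lborel)
      = ennreal (t powr (?n - 1 - a + 1) / (?n - 1 - a + 1))"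
    using nn_integral_has_integral_lebesgue'[of "{0..t}" "\<lambda>s. s powr (?n - 1 - a)"]
    by simp
  moreover have "{0..} \<inter> {..t} = {0..t}" by auto
  ultimately show ?thesis using assms
    by (subst nn_integral_norm_powr) (auto simp: ennreal_mult'[symmetric])
qed

section \<open>Detecting null functions and measurable profiles\<close>

text \<open>After an exchange of the integrations the inner integral is that of \<open>norm x powr (- a)\<close> over a ball,
  which is finite because \<open>a\<close> is below the dimension.  This turns pointwise bounds by integrals over exterior
  domains into bounds for weighted integrals, as in Hardy's inequality.\<close>
lemma nn_integral_norm_powr_tail:
  fixes k :: "'a::euclidean_space \<Rightarrow> ennreal"
  assumes [measurable]: "k \<in> borel_measurable borel" and a: "a < real DIM('a)"
  shows "(\<integral>\<^sup>+x. ennreal (norm (x::'a) powr (- a)) * (\<integral>\<^sup>+y. k y * indicator {norm x<..} (norm y) \<partial>lborel) \<partial>lborel)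
    \<le> ennreal (sphere_area DIM('a) / (real DIM('a) - a)) * (\<integral>\<^sup>+y. k y * ennreal (norm y powr (real DIM('a) - a)) \<partial>lborel)"
proof -
  let ?c = "ennreal (sphere_area DIM('a) / (real DIM('a) - a))"
  have "(\<integral>\<^sup>+x. ennreal (norm (x::'a) powr (- a)) * (\<integral>\<^sup>+y. k y * indicator {norm x<..} (norm y) \<partial>lborel) \<partial>lborel)
    = (\<integral>\<^sup>+x. (\<integral>\<^sup>+y. ennreal (norm (x::'a) powr (- a)) * (k y * indicator {norm x<..} (norm y)) \<partial>lborel) \<partial>lborel)"
    by (intro nn_integral_cong nn_integral_cmult[symmetric]) simp
  also have "\<dots> = (\<integral>\<^sup>+y. (\<integral>\<^sup>+x. ennreal (norm (x::'a) powr (- a)) * (k y * indicator {norm x<..} (norm y)) \<partial>lborel) \<partial>lborel)"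
    by (rule lborel_pair.Fubini'[symmetric]) (simp add: indicator_def split_beta')
  also have "\<dots> \<le> (\<integral>\<^sup>+y. k y * (\<integral>\<^sup>+x. ennreal (norm (x::'a) powr (- a)) * indicator {..norm y} (norm x) \<partial>lborel) \<partial>lborel)"
    by (intro nn_integral_mono, subst nn_integral_cmult[symmetric], simp, intro nn_integral_mono)
       (auto split: split_indicator simp: mult_ac)
  also have "\<dots> = (\<integral>\<^sup>+y. ?c * (k y * ennreal (norm y powr (real DIM('a) - a))) \<partial>lborel)"
    using a by (intro nn_integral_cong) (simp add: nn_integral_norm_powr_inside ennreal_mult'[symmetric] mult_ac)
  finally show ?thesis by (simp add: nn_integral_cmult)
qed

text \<open>The Borel sets over which \<open>h\<close> integrates to \<open>0\<close> form a Dynkin system, and boxes are an intersection-stable generator.\<close>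
lemma AE_zero_if_box_integrals_zero:
  fixes h :: "'a::euclidean_space \<Rightarrow> real"
  assumes int: "integrable lborel h"
    and zero: "\<And>a b. (LINT x|lborel. indicator (box a b) x * h x) = 0"
  shows "AE x in lborel. h x = 0"
proof (rule density_unique_real[OF int, of "\<lambda>_. 0"])
  have meas[measurable]: "h \<in> borel_measurable borel" using int by auto
  have intA: "integrable lborel (\<lambda>x. indicator A x * h x)" if "A \<in> sets borel" for A
    using integrable_mult_indicator[OF _ int, of A] that by simp
  have tot: "(LINT x|lborel. h x) = 0"
  proof -
    have "(\<lambda>i. LINT x|lborel. indicator (box (- (real i *\<^sub>R One)) (real i *\<^sub>R One)) x * h x) \<longlonglongrightarrow> (LINT x|lborel. h x)"
    proof (rule integral_dominated_convergence[where w = "\<lambda>x. norm (h x)"])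
      show "AE x in lborel. (\<lambda>i. indicator (box (- (real i *\<^sub>R One)) (real i *\<^sub>R One)) x * h x) \<longlonglongrightarrow> h x"
      proof (rule AE_I2)
        fix x :: 'a
        obtain n where n: "norm x < real n" using reals_Archimedean2 by blast
        have "x \<in> box (- (real i *\<^sub>R One)) (real i *\<^sub>R One)" if "n \<le> i" for i
          unfolding mem_box
        proof safe
          fix b :: 'a assume b: "b \<in> Basis"
          have "\<bar>x \<bullet> b\<bar> < real i" using Basis_le_norm[OF b, of x] n that by linarith
          then show "- (real i *\<^sub>R One) \<bullet> b < x \<bullet> b" "x \<bullet> b < real i *\<^sub>R One \<bullet> b"
            using b by (auto simp: inner_sum_left_Basis)
        qed
        then have "eventually (\<lambda>i. indicator (box (- (real i *\<^sub>R One)) (real i *\<^sub>R One)) x * h x = h x) sequentially"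
          by (auto simp: eventually_sequentially intro!: exI[of _ n])
        then show "(\<lambda>i. indicator (box (- (real i *\<^sub>R One)) (real i *\<^sub>R One)) x * h x) \<longlonglongrightarrow> h x"
          by (rule tendsto_eventually)
      qed
    qed (use int in \<open>auto split: split_indicator\<close>)
    then show ?thesis using zero by (simp add: LIMSEQ_const_iff)
  qed
  have stable: "Int_stable (range (\<lambda>(a, b). box a b :: 'a set))"
    by (auto simp: Int_stable_def Int_interval box_Int_box)
  have subset_Pow: "range (\<lambda>(a, b). box a b :: 'a set) \<subseteq> Pow UNIV" by simp
  fix A :: "'a set" assume "A \<in> sets lborel"
  then have "A \<in> sigma_sets UNIV (range (\<lambda>(a, b). box a b :: 'a set))"
    by (simp add: borel_eq_box)
  then have "A \<in> sets borel \<and> (LINT x|lborel. indicator A x * h x) = 0"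
  proof (induction rule: sigma_sets_induct_disjoint[OF stable subset_Pow, consumes 1, case_names basic empty compl union])
    case (compl A)
    then have "(LINT x|lborel. h x - indicator A x * h x) = 0"
      using int intA[of A] tot by (subst Bochner_Integration.integral_diff) auto
    moreover have "indicator (UNIV - A) x * h x = h x - indicator A x * h x" for x
      by (auto split: split_indicator)
    ultimately show ?case using compl by auto
  next
    case (union A)
    have [measurable]: "A i \<in> sets borel" for i using union by auto
    have "(LINT x|lborel. indicator (\<Union>i. A i) x * h x) = (\<Sum>i. LINT x|lborel. indicator (A i) x * h x)"
      using lebesgue_integral_countable_add[of A lborel h] union intA[of "\<Union>i. A i"]
      by (auto simp: set_lebesgue_integral_def set_integrable_def disjoint_family_on_def)
    then show ?case using union by auto
  qed (use zero in auto)
  then show "set_lebesgue_integral lborel A h = set_lebesgue_integral lborel A (\<lambda>_. 0)"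
    by (simp add: set_lebesgue_integral_def)
qed simp

lemma AE_scaleR_lborel:
  fixes P :: "'a::euclidean_space \<Rightarrow> bool"
  assumes "AE x in lborel. P x" "c \<noteq> 0"
  shows "AE x in lborel. P (c *\<^sub>R x)"
proof -
  have "AE x in density (distr lborel borel (\<lambda>x::'a. 0 + c *\<^sub>R x)) (\<lambda>_. ennreal (\<bar>c\<bar>^DIM('a))). P x"
    using assms(1) by (subst (asm) lborel_affine[OF assms(2), of 0])
  then have "AE x in distr lborel borel (\<lambda>x::'a. 0 + c *\<^sub>R x). 0 < ennreal (\<bar>c\<bar>^DIM('a)) \<longrightarrow> P x"
    by (subst (asm) AE_density) auto
  then have "AE x in lborel. 0 < ennreal (\<bar>c\<bar>^DIM('a)) \<longrightarrow> P (0 + c *\<^sub>R x)"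
    by (rule AE_distrD[rotated]) simp
  then show ?thesis using assms(2) by simp
qed

text \<open>As \<open>f\<close> is arbitrary, its measurability has to be extracted from that of \<open>u\<close>.  By Fubini's theorem for
  \<open>(s, x) \<mapsto> s *\<^sub>R x\<close>, almost every direction \<open>x0\<close> is such that \<open>u (s *\<^sub>R x0)\<close> agrees with the profile for almost
  every \<open>s\<close>.  Freezing one such direction yields a Borel function of the radius.\<close>
lemma radial_borel_profile:
  fixes u :: "'a::euclidean_space \<Rightarrow> real"
  assumes [measurable]: "u \<in> borel_measurable borel" and rad: "AE x in lborel. u x = f (norm x)"
  obtains f' where "f' \<in> borel_measurable borel" "AE x in lborel. u x = f' (norm x)"
proof -
  from rad obtain M where M: "M \<in> null_sets lborel" "\<And>x. x \<notin> M \<Longrightarrow> u x = f (norm x)"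
    by (elim AE_E) (auto simp: null_sets_def subset_eq)
  have [measurable]: "M \<in> sets borel" using M(1) by auto
  have "(\<integral>\<^sup>+x. (\<integral>\<^sup>+s. indicator {0<..} s * indicator M (s *\<^sub>R (x::'a)) \<partial>lborel) \<partial>lborel)
      = (\<integral>\<^sup>+s. (\<integral>\<^sup>+x. indicator {0<..} s * indicator M (s *\<^sub>R (x::'a)) \<partial>lborel) \<partial>lborel)"
    by (rule lborel_pair.Fubini'[symmetric]) simp
  also have "\<dots> = (\<integral>\<^sup>+s. 0 \<partial>(lborel :: real measure))"
  proof (rule nn_integral_cong)
    fix s :: real
    show "(\<integral>\<^sup>+x. indicator {0<..} s * indicator M (s *\<^sub>R (x::'a)) \<partial>lborel) = 0"
    proof (cases "0 < s")
      case True
      have "AE x in lborel. s *\<^sub>R x \<notin> M"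
        by (rule AE_scaleR_lborel[of "\<lambda>x. x \<notin> M"]) (use True M(1) AE_not_in in auto)
      then have "AE x::'a in lborel. indicator {0<..} s * indicator M (s *\<^sub>R x) = (0::ennreal)"
        by eventually_elim auto
      then show ?thesis by (subst nn_integral_0_iff_AE) auto
    qed simp
  qed
  finally have "(\<integral>\<^sup>+x. (\<integral>\<^sup>+s. indicator {0<..} s * indicator M (s *\<^sub>R (x::'a)) \<partial>lborel) \<partial>lborel) = 0"
    by simp
  then have "AE x::'a in lborel. (\<integral>\<^sup>+s. indicator {0<..} s * indicator M (s *\<^sub>R x) \<partial>lborel) = 0"
    by (subst (asm) nn_integral_0_iff_AE) auto
  moreover have "AE x::'a in lborel. x \<noteq> 0"
    by (rule AE_lborel_singleton)
  ultimately have "AE x::'a in lborel. x \<noteq> 0 \<and> (\<integral>\<^sup>+s. indicator {0<..} s * indicator M (s *\<^sub>R x) \<partial>lborel) = 0"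
    by eventually_elim auto
  moreover have "ae_filter (lborel :: 'a measure) \<noteq> bot"
    by (simp add: ae_filter_eq_bot_iff)
  ultimately obtain x0 :: 'a where x0: "x0 \<noteq> 0"
      "(\<integral>\<^sup>+s. indicator {0<..} s * indicator M (s *\<^sub>R x0) \<partial>lborel) = 0"
    using eventually_happens' by (metis (mono_tags, lifting))
  (* The profile along the frozen direction, parametrised by arc length. *)
  define f' where "f' s = u ((s / norm x0) *\<^sub>R x0)" for s
  have f'[measurable]: "f' \<in> borel_measurable borel" unfolding f'_def by measurable
  have "AE s in lborel. indicator {0<..} s * indicator M (s *\<^sub>R x0) = (0::ennreal)"
    using x0(2) by (subst (asm) nn_integral_0_iff_AE) auto
  then have "AE s in lborel. 0 < s \<longrightarrow> s *\<^sub>R x0 \<notin> M"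
    by eventually_elim (auto split: split_indicator_asm)
  then have "AE s in lborel. 0 < (1 / norm x0) *\<^sub>R s \<longrightarrow> ((1 / norm x0) *\<^sub>R s) *\<^sub>R x0 \<notin> M"
    by (rule AE_scaleR_lborel[of "\<lambda>s. 0 < s \<longrightarrow> s *\<^sub>R x0 \<notin> M"]) (use x0 in auto)
  then have "AE s in lborel. 0 < s \<longrightarrow> f' s = f s"
  proof eventually_elim
    case (elim s)
    then show ?case using x0(1) M(2)[of "(s / norm x0) *\<^sub>R x0"] by (auto simp: f'_def)
  qed
  then have "AE x::'a in lborel. f' (norm x) = f (norm x)"
    by (rule AE_norm_lborel)
  with rad have "AE x in lborel. u x = f' (norm x)"
    by eventually_elim auto
  with f' show thesis by (rule that)
qed

section \<open>Smooth functions of compact support\<close>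

text \<open>For \<open>m = 0\<close> the classical flat function; the powers of \<open>1 / t\<close> make the family closed under differentiation.\<close>
definition flat :: "nat \<Rightarrow> real \<Rightarrow> real" where
  "flat m t = (if 0 < t then inverse t ^ m * exp (- inverse t) else 0)"

lemma flat_nonpos [simp]: "t \<le> 0 \<Longrightarrow> flat m t = 0"
  by (simp add: flat_def)

lemma flat_tendsto_0: "(flat m \<longlongrightarrow> 0) (at 0)"
proof -
  have "((\<lambda>t::real. inverse t ^ m / exp (inverse t)) \<longlongrightarrow> 0) (at_right 0)"
    using filterlim_compose[OF tendsto_power_div_exp_0 filterlim_inverse_at_top_right] .
  then have "(flat m \<longlongrightarrow> 0) (at_right 0)"
  proof (rule Lim_transform_eventually)
    show "\<forall>\<^sub>F t::real in at_right 0. inverse t ^ m / exp (inverse t) = flat m t"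
      by (auto simp: eventually_at_filter flat_def exp_minus divide_inverse)
  qed
  moreover have "(flat m \<longlongrightarrow> 0) (at_left 0)"
    by (rule tendsto_eventually) (auto simp: eventually_at_filter)
  ultimately show ?thesis by (simp add: filterlim_split_at)
qed

lemma flat_has_derivative:
  "(flat m has_real_derivative flat (m + 2) t - real m * flat (m + 1) t) (at t)"
proof -
  consider "t > 0" | "t < 0" | "t = 0" by linarith
  then show ?thesis
  proof cases
    case 1
    have "((\<lambda>t. inverse t ^ m * exp (- inverse t)) has_real_derivative
        flat (m + 2) t - real m * flat (m + 1) t) (at t)"
    proof -
      have "((\<lambda>t. inverse t ^ m * exp (- inverse t)) has_real_derivative
          real m * inverse t ^ (m - 1) * (- (inverse t * inverse t)) * exp (- inverse t)
          + exp (- inverse t) * (inverse t * inverse t) * inverse t ^ m) (at t)"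
        using 1 by (auto intro!: derivative_eq_intros)
      also have "real m * inverse t ^ (m - 1) * (- (inverse t * inverse t)) * exp (- inverse t)
          + exp (- inverse t) * (inverse t * inverse t) * inverse t ^ m
          = flat (m + 2) t - real m * flat (m + 1) t"
        using 1 by (cases m) (simp_all add: flat_def)
      finally show ?thesis .
    qed
    then show ?thesis
    proof (rule DERIV_cong_ev[OF refl _ refl, THEN iffD1, rotated])
      show "\<forall>\<^sub>F t in nhds t. inverse t ^ m * exp (- inverse t) = flat m t"
        using eventually_nhds_in_open[of "{0<..}" t] 1 by (auto elim!: eventually_mono simp: flat_def)
    qed
  next
    case 2
    have "((\<lambda>t. 0) has_real_derivative 0) (at t)" by simp
    then have "(flat m has_real_derivative 0) (at t)"
    proof (rule DERIV_cong_ev[OF refl _ refl, THEN iffD1, rotated])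
      show "\<forall>\<^sub>F t in nhds t. 0 = flat m t"
        using eventually_nhds_in_open[of "{..<0}" t] 2 by (auto elim!: eventually_mono simp: flat_def)
    qed
    then show ?thesis using 2 by simp
  next
    case 3
    have "((\<lambda>h. (flat m (0 + h) - flat m 0) / h) \<longlongrightarrow> 0) (at 0)"
      using flat_tendsto_0[of "Suc m"]
    proof (rule Lim_transform_eventually)
      show "\<forall>\<^sub>F h in at 0. flat (Suc m) h = (flat m (0 + h) - flat m 0) / h"
        by (auto simp: eventually_at_filter flat_def divide_inverse)
    qed
    then show ?thesis using 3 by (simp add: DERIV_def)
  qed
qed

text \<open>A class that is closed under partial differentiation by its very rules, so that all its members are infinitely
  differentiable and no higher derivative has to be computed.  The rule \<open>primitive\<close> admits antiderivatives of
  functions that are already known to be in the class, and the rule \<open>powr\<close> admits fractional powers of \<open>p\<close>, cut off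
  where \<open>p\<close> may vanish.\<close>
inductive smooth_gen :: "(real ^ 'n \<Rightarrow> real) \<Rightarrow> bool" where
  const: "smooth_gen (\<lambda>x. c)"
| coord: "smooth_gen (\<lambda>x. x $ i)"
| add: "smooth_gen f \<Longrightarrow> smooth_gen g \<Longrightarrow> smooth_gen (\<lambda>x. f x + g x)"
| mult: "smooth_gen f \<Longrightarrow> smooth_gen g \<Longrightarrow> smooth_gen (\<lambda>x. f x * g x)"
| flat: "smooth_gen p \<Longrightarrow> smooth_gen (\<lambda>x. flat m (p x))"
| primitive: "smooth_gen p \<Longrightarrow> (\<And>t. (h has_real_derivative h' t) (at t)) \<Longrightarrow>
    smooth_gen (\<lambda>x. h' (p x)) \<Longrightarrow> smooth_gen (\<lambda>x. h (p x))"
| powr: "smooth_gen p \<Longrightarrow> smooth_gen f \<Longrightarrow> 0 < \<epsilon> \<Longrightarrow> (\<And>x. p x \<le> \<epsilon> \<Longrightarrow> f x = 0) \<Longrightarrow>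
    smooth_gen (\<lambda>x. p x powr a * f x)"

definition has_partials :: "(real ^ 'n \<Rightarrow> real) \<Rightarrow> ('n \<Rightarrow> real ^ 'n \<Rightarrow> real) \<Rightarrow> bool" where
  "has_partials f D \<longleftrightarrow> (\<forall>x. (f has_derivative (\<lambda>v. \<Sum>i\<in>UNIV. D i x * v $ i)) (at x))"

lemma has_partials_unique:
  assumes "(f has_derivative (\<lambda>v. \<Sum>i\<in>UNIV. d i * v $ i)) (at (x::real^'n))"
    "(f has_derivative (\<lambda>v. \<Sum>i\<in>UNIV. d' i * v $ i)) (at x)"
  shows "d i = d' i"
proof -
  have "(\<lambda>v. \<Sum>i\<in>UNIV. d i * v $ i) = (\<lambda>v. \<Sum>i\<in>UNIV. d' i * v $ i)"
    using has_derivative_unique assms by blast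
  from fun_cong[OF this, of "axis i 1"] show ?thesis
    by (simp add: axis_def if_distrib[of "\<lambda>x. _ * x"] cong: if_cong)
qed

lemma has_partials_partial_deriv:
  assumes "has_partials f D"
  shows "partial_deriv i f = D i"
proof
  fix x
  have "frechet_derivative f (at x) = (\<lambda>v. \<Sum>i\<in>UNIV. D i x * v $ i)"
    using assms frechet_derivative_at unfolding has_partials_def by metis
  then show "partial_deriv i f x = D i x"
    by (simp add: partial_deriv_def axis_def if_distrib[of "\<lambda>x. _ * x"] cong: if_cong)
qed

lemma has_partials_const: "has_partials (\<lambda>x. c) (\<lambda>i x. 0)"
  by (auto simp: has_partials_def)

lemma has_partials_coord: "has_partials (\<lambda>x. x $ j) (\<lambda>i x. if i = j then 1 else 0)"
  unfolding has_partials_def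
  by (auto intro!: derivative_eq_intros bounded_linear_imp_has_derivative bounded_linear_vec_nth
     simp: if_distrib[of "\<lambda>x. x * _"] cong: if_cong)

lemma has_partials_add:
  "has_partials f D \<Longrightarrow> has_partials g E \<Longrightarrow> has_partials (\<lambda>x. f x + g x) (\<lambda>i x. D i x + E i x)"
  unfolding has_partials_def
  by (auto intro!: derivative_eq_intros ext simp: sum.distrib algebra_simps)

lemma has_partials_mult:
  "has_partials f D \<Longrightarrow> has_partials g E \<Longrightarrow>
    has_partials (\<lambda>x. f x * g x) (\<lambda>i x. D i x * g x + f x * E i x)"
  unfolding has_partials_def
  by (auto intro!: derivative_eq_intros ext simp: sum.distrib algebra_simps sum_distrib_left)

lemma has_derivative_partials_comp:
  assumes "(p has_derivative (\<lambda>v. \<Sum>i\<in>UNIV. D i * v $ i)) (at x)" "(h has_real_derivative d) (at (p x))"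
  shows "((\<lambda>x. h (p x)) has_derivative (\<lambda>v. \<Sum>i\<in>UNIV. d * D i * v $ i)) (at x)"
proof -
  have "((\<lambda>x. h (p x)) has_derivative (\<lambda>v. d * (\<Sum>i\<in>UNIV. D i * v $ i))) (at x)"
    using has_derivative_compose[OF assms(1), of h "(*) d"] assms(2)
    by (simp add: has_field_derivative_def)
  then show ?thesis by (simp add: sum_distrib_left mult.assoc)
qed

lemma has_partials_comp:
  assumes "has_partials p D" "\<And>t. (h has_real_derivative h' t) (at t)"
  shows "has_partials (\<lambda>x. h (p x)) (\<lambda>i x. h' (p x) * D i x)"
  unfolding has_partials_def
  by (intro allI has_derivative_partials_comp[OF _ assms(2)]) (use assms(1) in \<open>simp add: has_partials_def\<close>)

lemma has_partials_continuous: "has_partials f D \<Longrightarrow> continuous_on S f"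
  unfolding has_partials_def by (meson continuous_at_imp_continuous_on has_derivative_continuous)

text \<open>Where \<open>p\<close> is below \<open>\<epsilon>\<close> the product vanishes in a neighbourhood, elsewhere \<open>p\<close> is positive and its power is
  differentiable.  The second claim says that the partial derivatives of \<open>f\<close> are cut off as well, with half the margin;
  it is what makes \<open>smooth_gen\<close> closed under differentiation.\<close>
lemma has_partials_powr_mult:
  assumes p: "has_partials p P" and f: "has_partials f D" and "0 < \<epsilon>" and z: "\<And>x. p x \<le> \<epsilon> \<Longrightarrow> f x = 0"
  shows "has_partials (\<lambda>x. p x powr a * f x) (\<lambda>i x. a * (p x powr (a - 1) * f x) * P i x + p x powr a * D i x)"
    and "p x \<le> \<epsilon> / 2 \<Longrightarrow> D i x = 0"
proof -
  have zero: "(\<forall>\<^sub>F y in nhds x. f y = 0)" if "p x < \<epsilon>" for x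
  proof -
    have "open {y. p y < \<epsilon>}"
      using has_partials_continuous[OF p] by (intro open_Collect_less continuous_intros) auto
    then show ?thesis using that z by (auto simp: eventually_nhds intro!: exI[of _ "{y. p y < \<epsilon>}"])
  qed
  have D0: "D i x = 0" if "p x < \<epsilon>" for i x
  proof -
    have "((\<lambda>x. 0::real) has_derivative (\<lambda>v. \<Sum>i\<in>UNIV. 0 * v $ i)) (at x)" by simp
    then have "(f has_derivative (\<lambda>v. \<Sum>i\<in>UNIV. 0 * v $ i)) (at x)"
      by (rule has_derivative_transform_eventually)
         (use zero[OF that] in \<open>auto simp: eventually_nhds_conv_at elim: eventually_mono\<close>)
    then show ?thesis
      using has_partials_unique[of f "\<lambda>i. D i x" x "\<lambda>_. 0"] f unfolding has_partials_def by blast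
  qed
  then show "p x \<le> \<epsilon> / 2 \<Longrightarrow> D i x = 0" using \<open>0 < \<epsilon>\<close> by (auto intro: D0)
  show "has_partials (\<lambda>x. p x powr a * f x) (\<lambda>i x. a * (p x powr (a - 1) * f x) * P i x + p x powr a * D i x)"
    unfolding has_partials_def
  proof
    fix x
    show "((\<lambda>x. p x powr a * f x) has_derivative
         (\<lambda>v. \<Sum>i\<in>UNIV. (a * (p x powr (a - 1) * f x) * P i x + p x powr a * D i x) * v $ i)) (at x)"
    proof (cases "p x < \<epsilon>")
      case True
      have "((\<lambda>x. 0::real) has_derivative (\<lambda>v. 0)) (at x)" by simp
      then have "((\<lambda>x. p x powr a * f x) has_derivative (\<lambda>v. 0)) (at x)"
        by (rule has_derivative_transform_eventually)
           (use zero[OF True] in \<open>auto simp: eventually_nhds_conv_at elim: eventually_mono\<close>)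
      then show ?thesis using True z[of x] D0[OF True] by simp
    next
      case False
      then have pos: "p x > 0" using \<open>0 < \<epsilon>\<close> by simp
      have "((\<lambda>x. p x powr a) has_derivative (\<lambda>v. \<Sum>i\<in>UNIV. a * p x powr (a - 1) * P i x * v $ i)) (at x)"
        using p pos unfolding has_partials_def
        by (intro has_derivative_partials_comp has_real_derivative_powr) auto
      moreover have "(f has_derivative (\<lambda>v. \<Sum>i\<in>UNIV. D i x * v $ i)) (at x)"
        using f by (simp add: has_partials_def)
      ultimately have "((\<lambda>x. p x powr a * f x) has_derivative (\<lambda>v. p x powr a * (\<Sum>i\<in>UNIV. D i x * v $ i)
          + (\<Sum>i\<in>UNIV. a * p x powr (a - 1) * P i x * v $ i) * f x)) (at x)"
        by (rule has_derivative_mult)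
      then show ?thesis
        by (simp add: sum.distrib algebra_simps sum_distrib_left)
    qed
  qed
qed

lemma smooth_gen_has_partials:
  "smooth_gen f \<Longrightarrow> \<exists>D. has_partials f D \<and> (\<forall>i. smooth_gen (D i))"
proof (induction rule: smooth_gen.induct)
  case (const c)
  then show ?case using has_partials_const smooth_gen.const by blast
next
  case (coord j)
  have "smooth_gen (\<lambda>x. if i = j then 1 else 0)" for i
    by (rule smooth_gen.const)
  then show ?case using has_partials_coord[of j] by (intro exI conjI) auto
next
  case (add f g)
  then show ?case using has_partials_add smooth_gen.add by blast
next
  case (mult f g)
  then obtain D E where DE: "has_partials f D" "has_partials g E" "\<And>i. smooth_gen (D i)" "\<And>i. smooth_gen (E i)" by blast
  show ?case
    by (intro exI conjI, rule has_partials_mult[OF DE(1,2)]) (intro allI smooth_gen.add smooth_gen.mult DE mult.hyps)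
next
  case (flat p m)
  then obtain D where D: "has_partials p D" "\<And>i. smooth_gen (D i)" by blast
  have "has_partials (\<lambda>x. flat m (p x)) (\<lambda>i x. (flat (m + 2) (p x) + (- real m) * flat (m + 1) (p x)) * D i x)"
    using has_partials_comp[OF D(1) flat_has_derivative] by simp
  moreover have "smooth_gen (\<lambda>x. (flat (m + 2) (p x) + (- real m) * flat (m + 1) (p x)) * D i x)" for i
    by (intro smooth_gen.add smooth_gen.mult smooth_gen.const smooth_gen.flat flat.hyps D)
  ultimately show ?case by blast
next
  case (primitive p h h')
  then obtain D where D: "has_partials p D" "\<And>i. smooth_gen (D i)" by blast
  show ?case
    by (intro exI conjI, rule has_partials_comp[OF D(1) primitive.hyps(2)])
       (intro allI smooth_gen.mult primitive.hyps D)
next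
  case (powr p f \<epsilon> a)
  then obtain D P where D: "has_partials f D" "\<And>i. smooth_gen (D i)"
    and P: "has_partials p P" "\<And>i. smooth_gen (P i)" by blast
  have "smooth_gen (\<lambda>x. p x powr a * D i x)" for i
    by (rule smooth_gen.powr[where \<epsilon> = "\<epsilon> / 2"])
       (use powr.hyps D has_partials_powr_mult(2)[OF P(1) D(1) powr.hyps(3,4)] in auto)
  moreover have "smooth_gen (\<lambda>x. p x powr (a - 1) * f x)"
    by (rule smooth_gen.powr) (use powr.hyps in auto)
  ultimately have "smooth_gen (\<lambda>x. a * (p x powr (a - 1) * f x) * P i x + p x powr a * D i x)" for i
    using smooth_gen.add[OF smooth_gen.mult[OF smooth_gen.mult[OF smooth_gen.const[of a]] P(2)]] by simp
  then show ?case
    using has_partials_powr_mult(1)[OF P(1) D(1) powr.hyps(3,4), of a] by blast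
qed

lemma smooth_gen_C_k: "smooth_gen f \<Longrightarrow> C_k k f"
proof (induction k arbitrary: f)
  case 0
  then show ?case using smooth_gen_has_partials has_partials_continuous by fastforce
next
  case (Suc k)
  then obtain D where D: "has_partials f D" "\<And>i. smooth_gen (D i)"
    using smooth_gen_has_partials by blast
  then have "f differentiable_on UNIV"
    by (auto simp: has_partials_def differentiable_on_def differentiable_def)
  then show ?case using D Suc.IH by (simp add: has_partials_partial_deriv[OF D(1)])
qed

lemma smooth_gen_test_function:
  assumes "smooth_gen f" "\<And>x. norm x > R \<Longrightarrow> f x = 0"
  shows "f \<in> test_functions"
proof -
  have "{x. f x \<noteq> 0} \<subseteq> cball 0 R" 
  proof
    fix x assume "x \<in> {x. f x \<noteq> 0}"
    then have "\<not> norm x > R" using assms(2)[of x] by auto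
    then show "x \<in> cball 0 R" by simp
  qed
  then have "bounded {x. f x \<noteq> 0}" using bounded_cball bounded_subset by blast
  then show ?thesis using smooth_gen_C_k[OF assms(1)]
    by (simp add: test_functions_def)
qed

lemma smooth_gen_sum:
  "finite A \<Longrightarrow> (\<And>a. a \<in> A \<Longrightarrow> smooth_gen (f a)) \<Longrightarrow> smooth_gen (\<lambda>x. \<Sum>a\<in>A. f a x)"
  by (induction A rule: finite_induct) (auto intro: smooth_gen.add smooth_gen.const)

lemma smooth_gen_prod:
  "finite A \<Longrightarrow> (\<And>a. a \<in> A \<Longrightarrow> smooth_gen (f a)) \<Longrightarrow> smooth_gen (\<lambda>x. \<Prod>a\<in>A. f a x)"
  by (induction A rule: finite_induct) (auto intro: smooth_gen.mult smooth_gen.const)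

lemma smooth_gen_minus:
  "smooth_gen f \<Longrightarrow> smooth_gen g \<Longrightarrow> smooth_gen (\<lambda>x. f x - g x)"
  using smooth_gen.add[OF _ smooth_gen.mult[OF smooth_gen.const[of "-1"]], of f g] by simp

lemma smooth_gen_norm_squared: "smooth_gen (\<lambda>x::real^'n. (norm x)\<^sup>2)"
proof -
  have "smooth_gen (\<lambda>x::real^'n. \<Sum>i\<in>UNIV. x $ i * x $ i)"
    by (intro smooth_gen_sum smooth_gen.mult smooth_gen.coord) auto
  then show ?thesis by (simp add: power2_norm_eq_inner inner_vec_def)
qed

text \<open>As \<open>k\<close> grows these functions increase to the indicator function of \<open>{a<..<b}\<close>.\<close>
definition bump :: "nat \<Rightarrow> real \<Rightarrow> real \<Rightarrow> real \<Rightarrow> real" where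
  "bump k a b t = flat 0 (real k * (t - a)) * flat 0 (real k * (b - t))"

lemma smooth_gen_bump: "smooth_gen p \<Longrightarrow> smooth_gen (\<lambda>x. bump k a b (p x))"
  unfolding bump_def
  by (intro smooth_gen.mult smooth_gen.flat smooth_gen_minus smooth_gen.const)

lemma flat_0_bounds: "0 \<le> flat 0 t" "flat 0 t \<le> 1"
  by (auto simp: flat_def)

lemma bump_bounds: "0 \<le> bump k a b t" "bump k a b t \<le> 1"
  unfolding bump_def using flat_0_bounds by (auto intro: mult_le_one)

lemma bump_outside: "t \<notin> {a<..<b} \<Longrightarrow> bump k a b t = 0"
  by (auto simp: bump_def mult_nonneg_nonpos)

lemma bump_pos: "k > 0 \<Longrightarrow> a < t \<Longrightarrow> t < b \<Longrightarrow> 0 < bump k a b t"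
  by (auto simp: bump_def flat_def)

lemma flat_continuous: "continuous_on S (flat m)"
  using flat_has_derivative by (meson DERIV_isCont continuous_at_imp_continuous_on)

lemma bump_continuous: "continuous_on S (bump k a b)"
  unfolding bump_def
  by (intro continuous_intros continuous_on_compose2[OF flat_continuous[of UNIV]]) auto

lemma bump_borel [measurable]: "bump k a b \<in> borel_measurable borel"
  using bump_continuous by (rule borel_measurable_continuous_onI)

lemma flat_0_scaled_tendsto:
  assumes "0 < t" shows "(\<lambda>k. flat 0 (real k * t)) \<longlonglongrightarrow> 1"
proof -
  have "(\<lambda>k. exp (- inverse (real k * t))) \<longlonglongrightarrow> exp (- 0)"
    using assms by real_asymp
  moreover have "\<forall>\<^sub>F k in sequentially. exp (- inverse (real k * t)) = flat 0 (real k * t)"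
    using eventually_gt_at_top[of 0] by eventually_elim (use assms in \<open>auto simp: flat_def\<close>)
  ultimately show ?thesis by (simp add: Lim_transform_eventually)
qed

lemma bump_tendsto: "(\<lambda>k. bump k a b t) \<longlonglongrightarrow> indicator {a<..<b} t"
proof (cases "t \<in> {a<..<b}")
  case True
  then have "(\<lambda>k. bump k a b t) \<longlonglongrightarrow> 1 * 1"
    unfolding bump_def by (intro tendsto_mult flat_0_scaled_tendsto) auto
  then show ?thesis using True by simp
qed (simp add: bump_outside)

section \<open>Uniqueness of weak gradients\<close>

lemma locally_integrable_measurable:
  fixes f :: "real ^ 'n \<Rightarrow> real"
  assumes "locally_integrable f"
  shows "f \<in> borel_measurable lebesgue"
proof -
  have meas: "(\<lambda>x. indicator (cball 0 (real i)) x *\<^sub>R f x) \<in> borel_measurable lebesgue" for i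
    using assms compact_cball[of 0 "real i"]
    unfolding locally_integrable_def set_integrable_def by (blast intro: borel_measurable_integrable)
  have lim: "(\<lambda>i. indicator (cball 0 (real i)) x *\<^sub>R f x) \<longlonglongrightarrow> f x" for x
  proof (rule tendsto_eventually)
    obtain n where "norm x \<le> real n" using real_arch_simple by blast
    then show "\<forall>\<^sub>F i in sequentially. indicator (cball 0 (real i)) x *\<^sub>R f x = f x"
      by (auto simp: eventually_sequentially intro!: exI[of _ n] split: split_indicator)
  qed
  show ?thesis by (rule borel_measurable_LIMSEQ_real[OF lim meas])
qed

lemma locally_integrable_mult:
  fixes f :: "real ^ 'n \<Rightarrow> real"
  assumes f: "locally_integrable f" and \<phi>: "\<phi> \<in> borel_measurable borel"
    and B: "\<And>x. \<bar>\<phi> x\<bar> \<le> B" and R: "\<And>x. R < norm x \<Longrightarrow> \<phi> x = 0"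
  shows "integrable lebesgue (\<lambda>x. f x * \<phi> x)"
proof (rule Bochner_Integration.integrable_bound)
  have "integrable lebesgue (\<lambda>x. indicator (cball 0 R) x *\<^sub>R f x)"
    using f compact_cball unfolding locally_integrable_def set_integrable_def by blast
  then show "integrable lebesgue (\<lambda>x. B * (indicator (cball 0 R) x *\<^sub>R f x))"
    by (rule integrable_mult_right)
  have [measurable]: "f \<in> borel_measurable lebesgue" using f by (rule locally_integrable_measurable)
  have [measurable]: "\<phi> \<in> borel_measurable lebesgue"
    using \<phi> by (intro measurable_completion) simp
  show "(\<lambda>x. f x * \<phi> x) \<in> borel_measurable lebesgue" by measurable
  show "AE x in lebesgue. norm (f x * \<phi> x) \<le> norm (B * (indicator (cball 0 R) x *\<^sub>R f x))"
  proof (rule AE_I2)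
    fix x
    have "\<bar>f x\<bar> * \<bar>\<phi> x\<bar> \<le> \<bar>f x\<bar> * \<bar>B\<bar>"
      using B[of x] by (intro mult_left_mono) auto
    moreover have "\<phi> x = 0" if "x \<notin> cball 0 R" using R[of x] that by auto
    ultimately show "norm (f x * \<phi> x) \<le> norm (B * (indicator (cball 0 R) x *\<^sub>R f x))"
      by (cases "x \<in> cball 0 R") (auto simp: abs_mult mult.commute)
  qed
qed

lemma continuous_bounded_support:
  fixes \<phi> :: "real ^ 'n \<Rightarrow> real"
  assumes "continuous_on UNIV \<phi>" "\<And>x. R < norm x \<Longrightarrow> \<phi> x = 0"
  obtains B where "\<And>x. \<bar>\<phi> x\<bar> \<le> B"
proof -
  have "bounded (\<phi> ` cball 0 R)"
    using assms(1) by (intro compact_imp_bounded compact_continuous_image) (auto intro: continuous_on_subset)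
  then obtain B where "\<forall>x\<in>cball 0 R. \<bar>\<phi> x\<bar> \<le> B"
    by (auto simp: bounded_iff)
  then have "\<bar>\<phi> x\<bar> \<le> max B 0" for x
    using assms(2)[of x] by (cases "x \<in> cball 0 R") (auto simp: le_max_iff_disj)
  then show thesis by (rule that)
qed

lemma smooth_gen_continuous: "smooth_gen f \<Longrightarrow> continuous_on S f"
  using smooth_gen_has_partials has_partials_continuous by blast

lemma locally_integrable_mult_continuous:
  fixes f :: "real ^ 'n \<Rightarrow> real"
  assumes "locally_integrable f" "continuous_on UNIV \<phi>" "\<And>x. R < norm x \<Longrightarrow> \<phi> x = 0"
  shows "integrable lebesgue (\<lambda>x. f x * \<phi> x)"
proof -
  obtain B where "\<And>x. \<bar>\<phi> x\<bar> \<le> B" using continuous_bounded_support assms(2,3) by blast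
  then show ?thesis
    using assms by (intro locally_integrable_mult[of f \<phi> B R] borel_measurable_continuous_onI)
qed

text \<open>Products of one-dimensional bumps are test functions that converge boundedly to the indicator function of a box.\<close>
lemma AE_zero_if_test_integrals_zero:
  fixes g :: "real ^ 'n \<Rightarrow> real"
  assumes g: "locally_integrable g" and zero: "\<And>\<phi>. \<phi> \<in> test_functions \<Longrightarrow> (LINT x|lebesgue. g x * \<phi> x) = 0"
  shows "AE x in lebesgue. g x = 0"
proof -
  have [measurable]: "g \<in> borel_measurable lebesgue" using g by (rule locally_integrable_measurable)
  obtain g' where g'[measurable]: "g' \<in> borel_measurable lborel" and eq: "AE x in lborel. g x = g' x"
    using completion_ex_borel_measurable_real[of g lborel] by auto
  have eqL: "AE x in lebesgue. g x = g' x" using eq by (rule AE_completion)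
  have conv: "(LINT x|lebesgue. g x * \<phi> x) = (LINT x|lborel. g' x * \<phi> x)" if "\<phi> \<in> borel_measurable borel" for \<phi>
  proof -
    have [measurable]: "\<phi> \<in> borel_measurable lebesgue"
      using that by (intro measurable_completion) simp
    have [measurable]: "g' \<in> borel_measurable lebesgue"
      using g' by (intro measurable_completion) simp
    have "(LINT x|lebesgue. g x * \<phi> x) = (LINT x|lebesgue. g' x * \<phi> x)"
    proof (rule integral_cong_AE)
      show "AE x in lebesgue. g x * \<phi> x = g' x * \<phi> x"
        using eqL by eventually_elim simp
    qed auto
    also have "\<dots> = (LINT x|lborel. g' x * \<phi> x)"
      using that by (intro integral_completion) simp
    finally show ?thesis .
  qed
  have intK: "integrable lborel (\<lambda>x. indicator (box a b) x * g' x)" for a b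
  proof -
    have "integrable lebesgue (\<lambda>x. indicator (cbox a b) x *\<^sub>R g x)"
      using g compact_cbox unfolding locally_integrable_def set_integrable_def by blast
    moreover have "(\<lambda>x. indicator (cbox a b) x * g' x) \<in> borel_measurable lebesgue"
      by (rule measurable_completion) simp
    moreover have "AE x in lebesgue. indicator (cbox a b) x *\<^sub>R g x = indicator (cbox a b) x * g' x"
      using eqL by eventually_elim simp
    ultimately have "integrable lebesgue (\<lambda>x. indicator (cbox a b) x * g' x)"
      using integrable_cong_AE_imp by blast
    then have "integrable lborel (\<lambda>x. indicator (cbox a b) x * g' x)"
      by (subst (asm) integrable_completion) auto
    then show ?thesis
      by (rule Bochner_Integration.integrable_bound)
         (use box_subset_cbox in \<open>auto split: split_indicator\<close>)
  qed
  have boxzero: "(LINT x|lborel. indicator (box a b) x * g' x) = 0" for a b :: "real ^ 'n"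
  proof -
    define \<phi> where "\<phi> k x = (\<Prod>i\<in>UNIV. bump k (a $ i) (b $ i) (x $ i))" for k and x :: "real^'n"
    have box: "indicator (box a b) x = (\<Prod>i\<in>UNIV. indicator {a $ i<..<b $ i} (x $ i) :: real)" for x
    proof (cases "x \<in> box a b")
      case True
      then show ?thesis by (simp add: mem_box_cart)
    next
      case False
      then obtain i where "x $ i \<notin> {a $ i<..<b $ i}" by (auto simp: mem_box_cart)
      then have "(\<Prod>i\<in>UNIV. indicator {a $ i<..<b $ i} (x $ i) :: real) = 0"
        by (intro prod_zero bexI[of _ i]) (auto simp: indicator_def)
      then show ?thesis using False by simp
    qed
    have out: "\<phi> k x = 0" if x: "x \<notin> box a b" for k x
    proof -
      obtain i where "x $ i \<notin> {a $ i<..<b $ i}" using x by (auto simp: mem_box_cart)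
      then show ?thesis unfolding \<phi>_def by (intro prod_zero bexI[of _ i]) (simp_all add: bump_outside)
    qed
    obtain R where R: "box a b \<subseteq> cball 0 R"
      using bounded_box[of a b] unfolding bounded_iff by (auto simp: subset_eq)
    have sm: "smooth_gen (\<phi> k)" for k
      using smooth_gen_prod[OF finite, of UNIV "\<lambda>i x. bump k (a $ i) (b $ i) (x $ i)"]
      by (simp add: \<phi>_def[abs_def] smooth_gen_bump smooth_gen.coord)
    have test: "\<phi> k \<in> test_functions" for k
    proof (rule smooth_gen_test_function[OF sm, of R])
      fix x :: "real^'n" assume "R < norm x"
      then have "x \<notin> box a b" using R by auto
      then show "\<phi> k x = 0" by (rule out)
    qed
    have meas[measurable]: "\<phi> k \<in> borel_measurable borel" for k
      using smooth_gen_continuous[OF sm] by (rule borel_measurable_continuous_onI)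
    have bound: "\<bar>\<phi> k x\<bar> \<le> indicator (box a b) x" for k x
    proof (cases "x \<in> box a b")
      case True
      have "\<bar>\<phi> k x\<bar> \<le> 1" unfolding \<phi>_def
        by (subst abs_of_nonneg) (auto intro!: prod_nonneg prod_le_1 simp: bump_bounds)
      then show ?thesis using True by simp
    qed (simp add: out)
    have "(\<lambda>k. LINT x|lborel. g' x * \<phi> k x) \<longlonglongrightarrow> (LINT x|lborel. g' x * indicator (box a b) x)"
    proof (rule integral_dominated_convergence[where w = "\<lambda>x. \<bar>indicator (box a b) x * g' x\<bar>"])
      show "AE x in lborel. (\<lambda>k. g' x * \<phi> k x) \<longlonglongrightarrow> g' x * indicator (box a b) x"
        unfolding box \<phi>_def by (intro AE_I2 tendsto_intros tendsto_prod bump_tendsto)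
      show "integrable lborel (\<lambda>x. \<bar>indicator (box a b) x * g' x\<bar>)" using intK by (intro integrable_abs)
      show "AE x in lborel. norm (g' x * \<phi> k x) \<le> \<bar>indicator (box a b) x * g' x\<bar>" for k
        using bound by (intro AE_I2) (auto simp: abs_mult mult.commute intro!: mult_left_mono)
    qed auto
    moreover have "(LINT x|lborel. g' x * \<phi> k x) = 0" for k
      using zero[OF test, of k] conv[OF meas, of k] by simp
    ultimately show ?thesis by (simp add: LIMSEQ_const_iff mult.commute)
  qed
  have "AE x in lborel. indicator (box (- (real n *\<^sub>R One)) (real n *\<^sub>R One)) x * g' x = 0" for n
  proof (rule AE_zero_if_box_integrals_zero[OF intK])
    fix a b
    show "(LINT x|lborel. indicator (box a b) x * (indicator (box (- (real n *\<^sub>R One)) (real n *\<^sub>R One)) x * g' x)) = 0"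
      using boxzero by (simp add: mult.assoc[symmetric] indicator_inter_arith[symmetric] box_Int_box)
  qed
  then have "AE x in lborel. \<forall>n. indicator (box (- (real n *\<^sub>R One)) (real n *\<^sub>R One)) x * g' x = 0"
    unfolding AE_all_countable by blast
  then have "AE x in lborel. g' x = 0"
  proof eventually_elim
    case (elim x)
    obtain n where n: "norm x < real n" using reals_Archimedean2 by blast
    have "\<bar>x \<bullet> b\<bar> < real n" if "b \<in> Basis" for b
      using Basis_le_norm[OF that, of x] n by linarith
    then have "x \<in> box (- (real n *\<^sub>R One)) (real n *\<^sub>R One)"
      unfolding mem_box by (auto simp: inner_sum_left_Basis abs_less_iff minus_less_iff)
    then show ?case using elim[rule_format, of n] by simp
  qed
  then have "AE x in lebesgue. g' x = 0" by (rule AE_completion)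
  with eqL show ?thesis by eventually_elim simp
qed

lemma locally_integrable_diff:
  "locally_integrable f \<Longrightarrow> locally_integrable g \<Longrightarrow> locally_integrable (\<lambda>x. f x - g x)"
  unfolding locally_integrable_def by (simp add: set_integral_diff(1))

lemma test_function_bounded_support:
  assumes "\<phi> \<in> test_functions"
  obtains R where "\<And>x. R < norm x \<Longrightarrow> \<phi> x = 0"
proof -
  have "bounded (closure {x. \<phi> x \<noteq> 0})"
    using assms compact_imp_bounded by (auto simp: test_functions_def)
  then have "bounded {x. \<phi> x \<noteq> 0}"
    using bounded_subset closure_subset by metis
  then obtain R where "\<forall>x\<in>{x. \<phi> x \<noteq> 0}. norm x \<le> R"
    unfolding bounded_iff by metis
  then show thesis by (intro that[of R]) (meson mem_Collect_eq not_less)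
qed

lemma test_function_continuous: "\<phi> \<in> test_functions \<Longrightarrow> continuous_on S \<phi>"
proof -
  assume "\<phi> \<in> test_functions"
  then have "C_k 0 \<phi>" unfolding test_functions_def by blast
  then show ?thesis using continuous_on_subset by fastforce
qed

lemma weak_gradient_unique:
  assumes "has_weak_gradient u G" "has_weak_gradient u G'"
  shows "AE x in lebesgue. G x = G' x"
proof -
  have "AE x in lebesgue. G x $ i - G' x $ i = 0" for i
  proof (rule AE_zero_if_test_integrals_zero)
    show "locally_integrable (\<lambda>x. G x $ i - G' x $ i)"
      using assms by (intro locally_integrable_diff) (auto simp: has_weak_gradient_def)
    fix \<phi> :: "real^'a \<Rightarrow> real" assume \<phi>: "\<phi> \<in> test_functions"
    obtain R where R: "\<And>x. R < norm x \<Longrightarrow> \<phi> x = 0"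
      by (rule test_function_bounded_support[OF \<phi>]) blast
    have "(LINT x|lebesgue. G x $ i * \<phi> x - G' x $ i * \<phi> x) =
        (LINT x|lebesgue. G x $ i * \<phi> x) - (LINT x|lebesgue. G' x $ i * \<phi> x)"
      using assms test_function_continuous[OF \<phi>] R
      by (intro Bochner_Integration.integral_diff locally_integrable_mult_continuous) (auto simp: has_weak_gradient_def)
    also have "\<dots> = 0"
    proof -
      have "(LINT x|lebesgue. u x * partial_deriv i \<phi> x) = - (LINT x|lebesgue. G x $ i * \<phi> x)"
           "(LINT x|lebesgue. u x * partial_deriv i \<phi> x) = - (LINT x|lebesgue. G' x $ i * \<phi> x)"
        using assms \<phi> by (simp_all add: has_weak_gradient_def)
      then show ?thesis by linarith
    qed
    finally show "(LINT x|lebesgue. (G x $ i - G' x $ i) * \<phi> x) = 0"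
      by (simp add: left_diff_distrib)
  qed
  then have "AE x in lebesgue. \<forall>i. G x $ i - G' x $ i = 0"
    unfolding AE_all_countable by blast
  then show ?thesis by eventually_elim (simp add: vec_eq_iff)
qed

section \<open>The weak gradient tested with radial fields\<close>

lemma has_partials_norm_squared: "has_partials (\<lambda>x::real^'n. (norm x)\<^sup>2) (\<lambda>i x. 2 * x $ i)"
  unfolding has_partials_def
proof
  fix x :: "real^'n"
  have "((\<lambda>x. x \<bullet> x) has_derivative (\<lambda>v. x \<bullet> v + v \<bullet> x)) (at x)"
    by (rule has_derivative_inner[OF has_derivative_ident has_derivative_ident])
  moreover have "(\<lambda>v. x \<bullet> v + v \<bullet> x) = (\<lambda>v. \<Sum>i\<in>UNIV. 2 * x $ i * v $ i)"
  proof
    fix v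
    have "x \<bullet> v + v \<bullet> x = 2 * (x \<bullet> v)" by (simp add: inner_commute)
    then show "x \<bullet> v + v \<bullet> x = (\<Sum>i\<in>UNIV. 2 * x $ i * v $ i)"
      by (simp add: inner_vec_def sum_distrib_left mult.assoc)
  qed
  ultimately show "((\<lambda>x. (norm x)\<^sup>2) has_derivative (\<lambda>v. \<Sum>i\<in>UNIV. 2 * x $ i * v $ i)) (at x)"
    by (simp add: power2_norm_eq_inner)
qed

lemma power2_powr:
  fixes t :: real
  assumes "0 \<le> t"
  shows "t\<^sup>2 powr c = t powr (2 * c)"
proof (cases "t = 0")
  case False
  then show ?thesis using assms powr_powr[of t 2 c] by simp
qed simp

text \<open>The field \<open>x * norm x powr (- N)\<close> is divergence free away from the origin.  Hence its product with
  \<open>Z ((norm x)\<^sup>2)\<close> has divergence \<open>2 * norm x powr (2 - N) * \<zeta> ((norm x)\<^sup>2)\<close>, in which only the derivative of \<open>Z\<close>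
  occurs.\<close>
lemma weak_gradient_radial_identity:
  fixes u :: "real^'n \<Rightarrow> real"
  assumes G: "has_weak_gradient u G"
    and Z: "\<And>t. (Z has_real_derivative \<zeta> t) (at t)" and sm: "smooth_gen (\<lambda>x::real^'n. \<zeta> ((norm x)\<^sup>2))"
    and a: "0 < a" and low: "\<And>t. t \<le> a \<Longrightarrow> Z t = 0" "\<And>t. t \<le> a \<Longrightarrow> \<zeta> t = 0"
    and high: "\<And>t. b \<le> t \<Longrightarrow> Z t = 0" "\<And>t. b \<le> t \<Longrightarrow> \<zeta> t = 0"
  shows "(LINT x|lebesgue. u x * (2 * norm x powr (2 - real CARD('n)) * \<zeta> ((norm x)\<^sup>2)))
       = - (LINT x|lebesgue. (G x \<bullet> x) * norm x powr (- real CARD('n)) * Z ((norm x)\<^sup>2))"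
proof -
  define n where "n = real CARD('n)"
  define p where "p x = (norm x)\<^sup>2" for x :: "real^'n"
  define F where "F x = p x powr (- n / 2) * Z (p x)" for x
  define \<phi> where "\<phi> i x = x $ i * F x" for i x
  define E where "E i x = (- n / 2) * (p x powr (- n / 2 - 1) * Z (p x)) * (2 * x $ i)
      + p x powr (- n / 2) * (\<zeta> (p x) * (2 * x $ i))" for i x
  have smp: "smooth_gen p" unfolding p_def[abs_def] by (rule smooth_gen_norm_squared)
  have pp: "has_partials p (\<lambda>i x. 2 * x $ i)"
    unfolding p_def[abs_def] by (rule has_partials_norm_squared)
  have smZ: "smooth_gen (\<lambda>x. Z (p x))"
    by (rule smooth_gen.primitive[OF smp Z]) (use sm in \<open>simp add: p_def\<close>)
  have smF: "smooth_gen F" unfolding F_def[abs_def]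
    by (rule smooth_gen.powr[OF smp smZ a]) (rule low)
  have pF: "has_partials F E"
    unfolding F_def[abs_def] E_def[abs_def]
    by (rule has_partials_powr_mult(1)[OF pp has_partials_comp[OF pp Z] a]) (rule low)
  have sm\<phi>: "smooth_gen (\<phi> i)" for i unfolding \<phi>_def[abs_def]
    by (intro smooth_gen.mult smooth_gen.coord smF)
  have p\<phi>: "has_partials (\<phi> i) (\<lambda>j x. (if j = i then 1 else 0) * F x + x $ i * E j x)" for i
    unfolding \<phi>_def[abs_def] by (rule has_partials_mult[OF has_partials_coord pF])
  have big: "b \<le> p x" if "\<bar>b\<bar> + 1 < norm x" for x
  proof -
    have "\<bar>b\<bar> + 1 \<le> (\<bar>b\<bar> + 1) * (\<bar>b\<bar> + 1)" by (simp add: algebra_simps)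
    also have "\<dots> \<le> norm x * norm x" using that by (intro mult_mono) auto
    finally show ?thesis unfolding p_def power2_eq_square by linarith
  qed
  have \<phi>0: "\<phi> i x = 0" if "\<bar>b\<bar> + 1 < norm x" for i x
    using high(1)[OF big[OF that]] by (simp add: \<phi>_def F_def)
  have test: "\<phi> i \<in> test_functions" for i
    using sm\<phi> \<phi>0 by (rule smooth_gen_test_function)
  have d\<phi>: "partial_deriv i (\<phi> i) x = F x + x $ i * E i x" for i x
    by (simp add: has_partials_partial_deriv[OF p\<phi>])
  have d\<phi>0: "F x + x $ i * E i x = 0" if "\<bar>b\<bar> + 1 < norm x" for i x
    using high[OF big[OF that]] by (simp add: E_def F_def)
  have cd\<phi>: "continuous_on UNIV (\<lambda>x. F x + x $ i * E i x)" for i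
  proof -
    obtain D where D: "has_partials F D" "\<And>i. smooth_gen (D i)"
      using smooth_gen_has_partials[OF smF] by blast
    have "E i x = D i x" for i x
      using has_partials_partial_deriv[OF D(1), of i] has_partials_partial_deriv[OF pF, of i] by simp
    then show ?thesis
      using smooth_gen_continuous[OF smooth_gen.add[OF smF smooth_gen.mult[OF smooth_gen.coord[of i] D(2)[of i]]], of UNIV]
      by simp
  qed
  have div: "(\<Sum>i\<in>UNIV. F x + x $ i * E i x) = 2 * norm x powr (2 - n) * \<zeta> ((norm x)\<^sup>2)" for x
  proof (cases "p x \<le> a")
    case True
    then show ?thesis using low[OF True] by (simp add: F_def E_def p_def)
  next
    case False
    then have pos: "p x > 0" using a by linarith
    then have nx: "norm x > 0" by (simp add: p_def)
    have xx: "(\<Sum>i\<in>UNIV. x $ i * x $ i) = p x"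
      by (simp add: p_def power2_norm_eq_inner inner_vec_def)
    have "x $ i * E i x = (x $ i * x $ i) * (- n * (p x powr (- n / 2 - 1) * Z (p x)) + 2 * p x powr (- n / 2) * \<zeta> (p x))" for i
      by (simp add: E_def algebra_simps)
    then have "(\<Sum>i\<in>UNIV. F x + x $ i * E i x)
        = n * F x + p x * (- n * (p x powr (- n / 2 - 1) * Z (p x)) + 2 * p x powr (- n / 2) * \<zeta> (p x))"
      unfolding sum.distrib by (simp only: sum_distrib_right[symmetric] xx) (simp add: n_def)
    also have "p x * (- n * (p x powr (- n / 2 - 1) * Z (p x)) + 2 * p x powr (- n / 2) * \<zeta> (p x))
       = - n * F x + 2 * (p x * p x powr (- n / 2)) * \<zeta> (p x)"
      using pos powr_add[of "p x" 1 "- n / 2 - 1"] by (simp add: F_def algebra_simps)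
    also have "p x * p x powr (- n / 2) = norm x powr (2 - n)"
    proof -
      have "p x * p x powr (- n / 2) = norm x powr 2 * norm x powr (- n)"
        using nx by (simp add: p_def power2_powr)
      also have "\<dots> = norm x powr (2 - n)"
        by (simp only: powr_add[symmetric]) simp
      finally show ?thesis .
    qed
    finally show ?thesis by (simp add: p_def)
  qed
  have uloc: "locally_integrable u" "\<And>i. locally_integrable (\<lambda>x. G x $ i)"
    using G by (simp_all add: has_weak_gradient_def)
  have "(LINT x|lebesgue. u x * (2 * norm x powr (2 - n) * \<zeta> ((norm x)\<^sup>2)))
      = (LINT x|lebesgue. (\<Sum>i\<in>UNIV. u x * (F x + x $ i * E i x)))"
    by (simp add: div[symmetric] sum_distrib_left)
  also have "\<dots> = (\<Sum>i\<in>UNIV. LINT x|lebesgue. u x * (F x + x $ i * E i x))"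
    by (rule Bochner_Integration.integral_sum, rule locally_integrable_mult_continuous[OF uloc(1) cd\<phi> d\<phi>0])
  also have "\<dots> = (\<Sum>i\<in>UNIV. - (LINT x|lebesgue. G x $ i * \<phi> i x))"
  proof (rule sum.cong[OF refl])
    fix i
    have "(LINT x|lebesgue. u x * partial_deriv i (\<phi> i) x) = - (LINT x|lebesgue. G x $ i * \<phi> i x)"
      using G test[of i] unfolding has_weak_gradient_def by blast
    then show "(LINT x|lebesgue. u x * (F x + x $ i * E i x)) = - (LINT x|lebesgue. G x $ i * \<phi> i x)"
      by (simp add: d\<phi>)
  qed
  also have "\<dots> = - (LINT x|lebesgue. (\<Sum>i\<in>UNIV. G x $ i * \<phi> i x))"
  proof -
    have "integrable lebesgue (\<lambda>x. G x $ i * \<phi> i x)" for i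
      by (rule locally_integrable_mult_continuous[OF uloc(2) smooth_gen_continuous[OF sm\<phi>] \<phi>0])
    then show ?thesis by (simp add: sum_negf)
  qed
  also have "(\<lambda>x. \<Sum>i\<in>UNIV. G x $ i * \<phi> i x) = (\<lambda>x. (G x \<bullet> x) * norm x powr (- n) * Z ((norm x)\<^sup>2))"
  proof
    fix x :: "real^'n"
    have "p x powr (- n / 2) = norm x powr (- n)"
      by (simp add: p_def power2_powr)
    then show "(\<Sum>i\<in>UNIV. G x $ i * \<phi> i x) = (G x \<bullet> x) * norm x powr (- n) * Z ((norm x)\<^sup>2)"
      by (simp add: \<phi>_def F_def inner_vec_def sum_distrib_right mult.assoc p_def)
  qed
  finally show ?thesis by (simp add: n_def)
qed

section \<open>The lemma of du Bois-Reymond in the radial variable\<close>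

lemma sphere_area_pos: "0 < sphere_area DIM('a::euclidean_space)"
  using unit_ball_vol_pos[of "real DIM('a)"] by simp

lemma integrable_norm_polar:
  fixes F :: "real \<Rightarrow> real"
  assumes [measurable]: "F \<in> borel_measurable borel"
  shows "integrable lborel (\<lambda>x::'a::euclidean_space. F (norm x)) \<longleftrightarrow>
    integrable lborel (\<lambda>s. sphere_area DIM('a) * s ^ (DIM('a) - 1) * indicator {0..} s * F s)" (is ?int)
    and "(LINT x|lborel. F (norm (x::'a))) =
    (LINT s|lborel. sphere_area DIM('a) * s ^ (DIM('a) - 1) * indicator {0..} s * F s)" (is ?eq)
proof -
  let ?g = "\<lambda>s::real. sphere_area DIM('a) * s ^ (DIM('a) - 1) * indicator {0..} s"
  have nn: "0 \<le> ?g s" for s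
    using sphere_area_pos[where 'a = 'a] by (simp add: indicator_def)
  have D: "distr (lborel :: 'a measure) borel norm = density lborel (\<lambda>s. ennreal (?g s))"
    unfolding distr_norm_lborel
    by (rule arg_cong[where f = "density lborel"]) (auto simp: fun_eq_iff split: split_indicator)
  have "integrable lborel (\<lambda>x::'a. F (norm x)) \<longleftrightarrow> integrable (distr (lborel :: 'a measure) borel norm) F"
    by (subst integrable_distr_eq) auto
  also have "\<dots> \<longleftrightarrow> integrable lborel (\<lambda>s. ?g s *\<^sub>R F s)"
    unfolding D by (rule integrable_density) (use nn in auto)
  finally show ?int by simp
  have "(LINT x|lborel. F (norm (x::'a))) = integral\<^sup>L (distr (lborel :: 'a measure) borel norm) F"
    by (subst integral_distr) auto
  also have "\<dots> = (LINT s|lborel. ?g s *\<^sub>R F s)"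
    unfolding D by (rule integral_density) (use nn in auto)
  finally show ?eq by simp
qed

definition bump_mass :: "nat \<Rightarrow> real \<Rightarrow> real \<Rightarrow> real" where
  "bump_mass k a b = (LINT s|lborel. bump k a b s)"

definition bump_prim :: "nat \<Rightarrow> real \<Rightarrow> real \<Rightarrow> real \<Rightarrow> real" where
  "bump_prim k a b t = (LINT s|lborel. indicator {..<t} s * bump k a b s)"

lemma bump_le_indicator: "bump k a b t \<le> indicator {a..b} t"
  using bump_bounds[of k a b t] bump_outside[of t a b k] by (auto split: split_indicator)

lemma integrable_bump_mult:
  assumes "f \<in> borel_measurable borel" "\<And>s. \<bar>f s\<bar> \<le> B"
  shows "integrable lborel (\<lambda>s. f s * bump k a b s)"
proof (rule Bochner_Integration.integrable_bound)
  show "integrable lborel (\<lambda>s. B * indicator {a..b} s :: real)"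
    by (intro integrable_mult_right integrable_real_indicator) (auto simp: emeasure_lborel_Icc_eq)
  show "(\<lambda>s. f s * bump k a b s) \<in> borel_measurable lborel" using assms(1) by simp
  show "AE s in lborel. norm (f s * bump k a b s) \<le> norm (B * indicator {a..b} s)"
  proof (rule AE_I2)
    fix s
    have "\<bar>f s\<bar> * bump k a b s \<le> B * indicator {a..b} s"
      using bump_le_indicator[of k a b s] bump_bounds[of k a b s] assms(2)[of s]
      by (intro mult_mono) auto
    then show "norm (f s * bump k a b s) \<le> norm (B * indicator {a..b} s)"
      using bump_bounds[of k a b s] abs_ge_zero[of "f s"] assms(2)[of s] by (simp add: abs_mult)
  qed
qed

lemma integrable_bump: "integrable lborel (bump k a b)"
  using integrable_bump_mult[of "\<lambda>_. 1" 1 k a b] by simp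

lemma bump_prim_low: "t \<le> a \<Longrightarrow> bump_prim k a b t = 0"
proof -
  assume "t \<le> a"
  then have "(\<lambda>s. indicator {..<t} s * bump k a b s) = (\<lambda>s. 0)"
    by (auto simp: fun_eq_iff bump_outside split: split_indicator)
  then show ?thesis by (simp add: bump_prim_def)
qed

lemma bump_prim_high: "b \<le> t \<Longrightarrow> bump_prim k a b t = bump_mass k a b"
proof -
  assume "b \<le> t"
  then have "(\<lambda>s. indicator {..<t} s * bump k a b s) = bump k a b"
    by (auto simp: fun_eq_iff bump_outside split: split_indicator)
  then show ?thesis by (simp add: bump_prim_def bump_mass_def)
qed

lemma bump_prim_bounds: "0 \<le> bump_prim k a b t" "bump_prim k a b t \<le> bump_mass k a b"
proof -
  show "0 \<le> bump_prim k a b t" unfolding bump_prim_def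
    by (intro integral_nonneg_AE AE_I2) (simp add: bump_bounds)
  show "bump_prim k a b t \<le> bump_mass k a b" unfolding bump_prim_def bump_mass_def
    by (intro integral_mono integrable_bump integrable_bump_mult[where B = 1])
       (auto simp: bump_bounds split: split_indicator)
qed

lemma bump_prim_derivative: "(bump_prim k a b has_real_derivative bump k a b t) (at t)"
proof -
  define c where "c = min a t - 1"
  define d where "d = t + 1"
  have cd: "c < t" "t < d" "c < a" by (auto simp: c_def d_def)
  have "bump_prim k a b \<tau> = integral {c..\<tau>} (bump k a b)" if "\<tau> \<in> {c..d}" for \<tau>
  proof -
    have "bump_prim k a b \<tau> = (LINT s|lborel. indicator {c..\<tau>} s * bump k a b s)"
      unfolding bump_prim_def
    proof (rule integral_cong_AE)
      have "AE s in lborel. s \<noteq> \<tau>" by (rule AE_lborel_singleton)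
      then show "AE s in lborel. indicator {..<\<tau>} s * bump k a b s = indicator {c..\<tau>} s * bump k a b s"
        by eventually_elim (use cd in \<open>auto simp: bump_outside split: split_indicator\<close>)
    qed auto
    also have "\<dots> = integral {c..\<tau>} (bump k a b)"
      using set_borel_integral_eq_integral(2)[of "{c..\<tau>}" "bump k a b"]
        integrable_bump_mult[of "indicator {c..\<tau>}" 1 k a b]
      by (simp add: set_integrable_def set_lebesgue_integral_def)
    finally show ?thesis .
  qed
  moreover have "((\<lambda>\<tau>. integral {c..\<tau>} (bump k a b)) has_real_derivative bump k a b t) (at t within {c..d})"
    by (rule integral_has_real_derivative[OF bump_continuous]) (use cd in auto)
  ultimately have "(bump_prim k a b has_real_derivative bump k a b t) (at t within {c..d})"
    using cd by (subst has_field_derivative_cong_eventually[where g = "\<lambda>\<tau>. integral {c..\<tau>} (bump k a b)"])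
      (auto simp: eventually_at_filter)
  then show ?thesis using cd by (simp add: at_within_Icc_at)
qed

lemma bump_prim_borel [measurable]: "bump_prim k a b \<in> borel_measurable borel"
  by (intro borel_measurable_continuous_onI continuous_at_imp_continuous_on ballI DERIV_isCont[OF bump_prim_derivative])

lemma bump_mass_pos: "0 < k \<Longrightarrow> a < b \<Longrightarrow> 0 < bump_mass k a b"
proof (rule ccontr)
  assume k: "0 < k" "a < b" "\<not> 0 < bump_mass k a b"
  then have "bump_mass k a b = 0" using bump_prim_bounds[of k a b 0] by linarith
  then have "AE s in lborel. bump k a b s = 0"
    unfolding bump_mass_def by (subst (asm) integral_nonneg_eq_0_iff_AE) (auto simp: integrable_bump bump_bounds)
  then have "AE s in lborel. s \<notin> {a<..<b}"
    by eventually_elim (use bump_pos[OF k(1)] in fastforce)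
  then have "emeasure lborel {a<..<b} = 0"
    by (subst (asm) AE_iff_measurable[of "{a<..<b}"]) auto
  then show False using k by simp
qed

text \<open>Integrated against a function of \<open>s\<close> this gives the primitive of that function, corrected by the multiple of a
  fixed primitive that makes the result vanish for large arguments.\<close>
definition radial_kernel :: "real \<Rightarrow> real \<Rightarrow> real" where
  "radial_kernel s t = (if s < t then 1 else 0) - bump_prim 1 1 2 t / bump_mass 1 1 2"

lemma radial_kernel_measurable [measurable]:
  "(\<lambda>(s, t). radial_kernel s t) \<in> borel_measurable (borel \<Otimes>\<^sub>M borel)"
  unfolding radial_kernel_def by measurable

lemma radial_kernel_zero: "t \<le> min s 1 \<or> max s 2 < t \<Longrightarrow> radial_kernel s t = 0"
  using bump_mass_pos[of 1 1 2] bump_prim_low[of t 1 1 2] bump_prim_high[of 2 t 1 1]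
  by (auto simp: radial_kernel_def)

lemma radial_kernel_bound: "\<bar>radial_kernel s t\<bar> \<le> 1"
proof -
  have "0 \<le> bump_prim 1 1 2 t / bump_mass 1 1 2" "bump_prim 1 1 2 t / bump_mass 1 1 2 \<le> 1"
    using bump_mass_pos[of 1 1 2] bump_prim_bounds[of 1 1 2 t] by auto
  then show ?thesis unfolding radial_kernel_def by auto
qed

lemma bump_prim_kernel:
  "bump_prim k a b t - bump_mass k a b / bump_mass 1 1 2 * bump_prim 1 1 2 t
    = (LINT s|lborel. bump k a b s * radial_kernel s t)"
proof -
  have "(LINT s|lborel. bump k a b s * radial_kernel s t) =
     (LINT s|lborel. indicator {..<t} s * bump k a b s - (bump_prim 1 1 2 t / bump_mass 1 1 2) * bump k a b s)"
    by (rule Bochner_Integration.integral_cong) (auto simp: radial_kernel_def algebra_simps split: split_indicator)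
  also have "\<dots> = bump_prim k a b t - (bump_prim 1 1 2 t / bump_mass 1 1 2) * bump_mass k a b"
    unfolding bump_prim_def[of k a b t] bump_mass_def[of k a b]
    by (subst Bochner_Integration.integral_diff)
       (auto intro!: integrable_bump integrable_bump_mult[where B = 1] integrable_mult_right
         simp del: times_divide_eq_left split: split_indicator)
  finally show ?thesis by simp
qed

lemma AE_zero_half_line:
  fixes d :: "real \<Rightarrow> real"
  assumes int: "\<And>\<alpha> \<beta>. 0 < \<alpha> \<Longrightarrow> integrable lborel (\<lambda>r. indicator {\<alpha>..\<beta>} r * d r)"
    and zero: "\<And>\<alpha> \<beta>. 0 < \<alpha> \<Longrightarrow> \<alpha> < \<beta> \<Longrightarrow> (LINT r|lborel. indicator {\<alpha><..<\<beta>} r * d r) = 0"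
  shows "AE r in lborel. 0 < r \<longrightarrow> d r = 0"
proof -
  have "AE r in lborel. indicator {1 / real (Suc n)<..<real (Suc n)} r * d r = 0" for n
  proof (rule AE_zero_if_box_integrals_zero)
    let ?I = "{1 / real (Suc n)<..<real (Suc n)}"
    have i1: "integrable lborel (\<lambda>r. indicator {1 / real (Suc n)..real (Suc n)} r * d r)"
      by (rule int) simp
    have "integrable lborel (\<lambda>r. indicator ?I r * (indicator {1 / real (Suc n)..real (Suc n)} r * d r))"
      using integrable_mult_indicator[OF _ i1, of ?I] by simp
    then show "integrable lborel (\<lambda>r. indicator ?I r * d r)"
      by (rule Bochner_Integration.integrable_cong[OF refl, THEN iffD1, rotated]) (auto split: split_indicator)
    fix a b :: real
    have eq: "indicator (box a b) r * (indicator ?I r * d r) =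
        indicator {max a (1 / real (Suc n))<..<min b (real (Suc n))} r * d r" for r
      by (auto split: split_indicator)
    show "(LINT r|lborel. indicator (box a b) r * (indicator ?I r * d r)) = 0"
    proof (cases "max a (1 / real (Suc n)) < min b (real (Suc n))")
      case True
      show ?thesis unfolding eq by (rule zero[OF _ True]) (simp add: less_max_iff_disj)
    next
      case False
      then have "{max a (1 / real (Suc n))<..<min b (real (Suc n))} = {}" by (auto simp: not_less)
      then show ?thesis unfolding eq by simp
    qed
  qed
  then have "AE r in lborel. \<forall>n. indicator {1 / real (Suc n)<..<real (Suc n)} r * d r = 0"
    unfolding AE_all_countable by blast
  then show ?thesis
  proof eventually_elim
    case (elim r)
    show ?case
    proof
      assume r: "0 < r"
      obtain n1 where n1: "r < real n1" using reals_Archimedean2 by blast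
      obtain n2 where n2: "1 / r < real n2" using reals_Archimedean2 by blast
      let ?n = "max n1 n2"
      have "r < real (Suc ?n)" using n1 by (simp add: less_max_iff_disj)
      moreover have "1 / r < real (Suc ?n)" using n2 by (simp add: less_max_iff_disj)
      then have "1 / real (Suc ?n) < r" using r by (simp add: field_simps del: of_nat_Suc)
      ultimately show "d r = 0" using elim[rule_format, of ?n] by (simp del: of_nat_Suc)
    qed
  qed
qed

text \<open>The hypothesis \<open>ident\<close> says, in weak form, that \<open>\<sigma> * f\<close> has the derivative \<open>W\<close>, integrated over spheres.
  Rewritten with \<open>radial_kernel\<close> and Fubini's theorem, its right-hand side becomes the integral of the bump against a
  function \<open>\<psi>\<close>.  Thus \<open>\<sigma> * f\<close> and \<open>C - \<psi>\<close>, with \<open>\<psi>\<close> taken at the squared radius, have the same integrals against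
  all bumps and agree almost everywhere; the increments of \<open>\<psi>\<close> are integrals over annuli because those of the kernel
  are indicator functions.\<close>
lemma radial_primitive:
  fixes W :: "'a::euclidean_space \<Rightarrow> real" and f :: "real \<Rightarrow> real"
  defines "\<sigma> \<equiv> sphere_area DIM('a)"
  assumes W[measurable]: "W \<in> borel_measurable borel" and f[measurable]: "f \<in> borel_measurable borel"
    and intW: "\<And>a b. 0 < a \<Longrightarrow> integrable lborel (\<lambda>x. indicator {a..b} (norm x) * W x)"
    and intf: "\<And>a b. 0 < a \<Longrightarrow> integrable lborel (\<lambda>r. indicator {a..b} r * f r)"
    and ident: "\<And>a b k. 0 < a \<Longrightarrow> a < b \<Longrightarrow>
      \<sigma> * (LINT r|lborel. f r * (2 * r) * indicator {0..} r * (bump k a b (r\<^sup>2) - bump_mass k a b / bump_mass 1 1 2 * bump 1 1 2 (r\<^sup>2)))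
      = - (LINT x|lborel. W x * (bump_prim k a b ((norm x)\<^sup>2) - bump_mass k a b / bump_mass 1 1 2 * bump_prim 1 1 2 ((norm x)\<^sup>2)))"
  obtains H where "AE r in lborel. 0 < r \<longrightarrow> f r = H r"
    "\<And>s t. 0 < s \<Longrightarrow> s \<le> t \<Longrightarrow> H t - H s = (LINT x|lborel. indicator {s<..t} (norm x) * W x) / \<sigma>"
proof -
  have \<sigma>: "0 < \<sigma>" unfolding \<sigma>_def by (rule sphere_area_pos)
  define m0 where "m0 = bump_mass 1 1 2"
  have m0: "0 < m0" unfolding m0_def by (rule bump_mass_pos) auto
  define \<psi> where "\<psi> s = (LINT x|lborel. W x * radial_kernel s ((norm x)\<^sup>2))" for s
  have K_meas[measurable]: "(\<lambda>x::'a. radial_kernel s ((norm x)\<^sup>2)) \<in> borel_measurable borel" for s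
    by measurable
  have WK_meas[measurable]: "(\<lambda>(s, x::'a). W x * radial_kernel s ((norm x)\<^sup>2)) \<in> borel_measurable (borel \<Otimes>\<^sub>M borel)"
    by measurable
  have \<psi>_meas[measurable]: "\<psi> \<in> borel_measurable borel"
    unfolding \<psi>_def[abs_def] by measurable
  (* A dominating function for the kernel, uniformly for s between \<alpha> and \<beta>. *)
  define V where "V \<alpha> \<beta> x = indicator {sqrt (min \<alpha> 1)..sqrt (max \<beta> 2)} (norm x) * \<bar>W x\<bar>" for \<alpha> \<beta> and x :: 'a
  have V_int: "integrable lborel (V \<alpha> \<beta>)" if "0 < \<alpha>" for \<alpha> \<beta>
    using integrable_abs[OF intW[of "sqrt (min \<alpha> 1)" "sqrt (max \<beta> 2)"]] that
    by (simp add: V_def[abs_def] abs_mult)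
  have WK_bound: "\<bar>W x * radial_kernel s ((norm x)\<^sup>2)\<bar> \<le> V \<alpha> \<beta> x"
    if s: "0 < \<alpha>" "\<alpha> \<le> s" "s \<le> \<beta>" for s \<alpha> \<beta> x
  proof (cases "norm x \<in> {sqrt (min \<alpha> 1)..sqrt (max \<beta> 2)}")
    case True
    then show ?thesis using mult_left_mono[OF radial_kernel_bound[of s "(norm x)\<^sup>2"], of "\<bar>W x\<bar>"]
      by (simp add: V_def abs_mult)
  next
    case False
    have "(norm x)\<^sup>2 < min \<alpha> 1 \<or> max \<beta> 2 < (norm x)\<^sup>2"
    proof (cases "norm x < sqrt (min \<alpha> 1)")
      case True
      then have "(norm x)\<^sup>2 < (sqrt (min \<alpha> 1))\<^sup>2" by (intro power_strict_mono) auto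
      then show ?thesis using s by simp
    next
      case n: False
      then have "sqrt (max \<beta> 2) < norm x" using False by simp
      then have "(sqrt (max \<beta> 2))\<^sup>2 < (norm x)\<^sup>2" using s by (intro power_strict_mono) auto
      then show ?thesis by simp
    qed
    then have "radial_kernel s ((norm x)\<^sup>2) = 0" using s by (intro radial_kernel_zero) auto
    then show ?thesis using False by (simp add: V_def)
  qed
  have WK_int: "integrable lborel (\<lambda>x. W x * radial_kernel s ((norm x)\<^sup>2))" if "0 < s" for s
    by (rule Bochner_Integration.integrable_bound[OF V_int[OF that, of s]])
       (use WK_bound[OF that, of s s] in \<open>auto simp: V_def abs_mult\<close>)
  have V_nonneg: "0 \<le> V \<alpha> \<beta> x" for \<alpha> \<beta> x by (simp add: V_def)
  define M where "M \<alpha> \<beta> = (LINT x|lborel. V \<alpha> \<beta> x)" for \<alpha> \<beta>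
  have M_nonneg: "0 \<le> M \<alpha> \<beta>" for \<alpha> \<beta>
    unfolding M_def by (intro integral_nonneg_AE AE_I2 V_nonneg)
  have \<psi>_bound: "\<bar>\<psi> s\<bar> \<le> M \<alpha> \<beta>" if s: "0 < \<alpha>" "\<alpha> \<le> s" "s \<le> \<beta>" for s \<alpha> \<beta>
    unfolding \<psi>_def M_def
    by (rule integral_abs_bound_integral[OF WK_int V_int[OF s(1)] WK_bound[OF s]]) (use s in auto)
  have fubini: "(LINT x|lborel. W x * (LINT s|lborel. bump k \<alpha> \<beta> s * radial_kernel s ((norm x)\<^sup>2)))
      = (LINT s|lborel. bump k \<alpha> \<beta> s * \<psi> s)" if \<alpha>: "0 < \<alpha>" for k \<alpha> \<beta>
  proof -
    let ?F = "\<lambda>s x. bump k \<alpha> \<beta> s * (W x * radial_kernel s ((norm x)\<^sup>2))"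
    have bd: "\<bar>?F s x\<bar> \<le> bump k \<alpha> \<beta> s * V \<alpha> \<beta> x" for s x
    proof (cases "s \<in> {\<alpha><..<\<beta>}")
      case True
      then show ?thesis using WK_bound[OF \<alpha>, of s \<beta> x] bump_bounds[of k \<alpha> \<beta> s]
        by (subst abs_mult) (auto intro!: mult_mono)
    qed (simp add: bump_outside)
    have "integrable (lborel \<Otimes>\<^sub>M lborel) (case_prod ?F)"
    proof (rule lborel_pair.Fubini_integrable)
      show "case_prod ?F \<in> borel_measurable (lborel \<Otimes>\<^sub>M lborel)" by measurable
      have i: "integrable lborel (?F s)" for s
        by (rule Bochner_Integration.integrable_bound[OF integrable_mult_right[OF V_int[OF \<alpha>, of \<beta>], of "bump k \<alpha> \<beta> s"]])
           (use bd[of s] V_nonneg bump_bounds(1)[of k \<alpha> \<beta> s] in \<open>auto simp: abs_mult\<close>)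
      then show "AE s in lborel. integrable lborel (\<lambda>x. case (s, x) of (s, x) \<Rightarrow> ?F s x)"
        by (intro AE_I2) simp
      show "integrable lborel (\<lambda>s. LINT x|lborel. norm (case (s, x) of (s, x) \<Rightarrow> ?F s x))"
      proof (rule Bochner_Integration.integrable_bound[OF integrable_mult_left[OF integrable_bump[of k \<alpha> \<beta>], of "M \<alpha> \<beta>"]])
        show "(\<lambda>s. LINT x|lborel. norm (case (s, x) of (s, x) \<Rightarrow> ?F s x)) \<in> borel_measurable lborel" by measurable
        show "AE s in lborel. norm (LINT x|lborel. norm (case (s, x) of (s, x) \<Rightarrow> ?F s x)) \<le> norm (bump k \<alpha> \<beta> s * M \<alpha> \<beta>)"
        proof (rule AE_I2)
          fix s
          have "(LINT x|lborel. \<bar>?F s x\<bar>) \<le> (LINT x|lborel. bump k \<alpha> \<beta> s * V \<alpha> \<beta> x)"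
            by (intro integral_mono integrable_abs i integrable_mult_right V_int \<alpha> bd)
          also have "\<dots> = bump k \<alpha> \<beta> s * M \<alpha> \<beta>" by (simp add: M_def)
          finally have "(LINT x|lborel. \<bar>?F s x\<bar>) \<le> bump k \<alpha> \<beta> s * M \<alpha> \<beta>" .
          moreover have "0 \<le> (LINT x|lborel. \<bar>?F s x\<bar>)" by (rule integral_nonneg_AE) simp
          ultimately show "norm (LINT x|lborel. norm (case (s, x) of (s, x) \<Rightarrow> ?F s x)) \<le> norm (bump k \<alpha> \<beta> s * M \<alpha> \<beta>)"
            by simp
        qed
      qed
    qed
    from lborel_pair.Fubini_integral[OF this]
    have e1: "(LINT x|lborel. LINT s|lborel. ?F s x) = (LINT s|lborel. LINT x|lborel. ?F s x)" .
    have e2: "(LINT s|lborel. ?F s x) = W x * (LINT s|lborel. bump k \<alpha> \<beta> s * radial_kernel s ((norm x)\<^sup>2))" for x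
      by (subst integral_mult_right_zero[symmetric]) (simp add: mult_ac)
    have e3: "(LINT x|lborel. ?F s x) = bump k \<alpha> \<beta> s * \<psi> s" for s
      by (simp add: \<psi>_def)
    show ?thesis using e1 unfolding e2 e3 .
  qed
  have intfb: "integrable lborel (\<lambda>r. f r * (2 * r) * indicator {0..} r * bump k \<alpha> \<beta> (r\<^sup>2))" if \<alpha>: "0 < \<alpha>" for k \<alpha> \<beta>
  proof (rule Bochner_Integration.integrable_bound)
    show "integrable lborel (\<lambda>r. (2 * sqrt \<beta>) * \<bar>indicator {sqrt \<alpha>..sqrt \<beta>} r * f r\<bar>)"
      using \<alpha> by (intro integrable_mult_right integrable_abs intf) simp
    show "AE r in lborel. norm (f r * (2 * r) * indicator {0..} r * bump k \<alpha> \<beta> (r\<^sup>2)) \<le>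
        norm ((2 * sqrt \<beta>) * \<bar>indicator {sqrt \<alpha>..sqrt \<beta>} r * f r\<bar>)"
    proof (rule AE_I2)
      fix r :: real
      show "norm (f r * (2 * r) * indicator {0..} r * bump k \<alpha> \<beta> (r\<^sup>2)) \<le>
        norm ((2 * sqrt \<beta>) * \<bar>indicator {sqrt \<alpha>..sqrt \<beta>} r * f r\<bar>)"
      proof (cases "0 \<le> r \<and> \<alpha> < r\<^sup>2 \<and> r\<^sup>2 < \<beta>")
        case True
        then have r: "sqrt \<alpha> \<le> r" "r \<le> sqrt \<beta>" "0 \<le> r"
          by (auto intro!: real_le_lsqrt real_le_rsqrt)
        have "\<bar>f r\<bar> * (2 * r) * bump k \<alpha> \<beta> (r\<^sup>2) \<le> \<bar>f r\<bar> * (2 * sqrt \<beta>) * 1"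
          using r order_trans[OF r(3,2)] bump_bounds[of k \<alpha> \<beta> "r\<^sup>2"] by (intro mult_mono) auto
        then show ?thesis using r bump_bounds[of k \<alpha> \<beta> "r\<^sup>2"] by (simp add: abs_mult mult_ac)
      next
        case False
        then have "indicator {0..} r * bump k \<alpha> \<beta> (r\<^sup>2) = 0"
          using bump_outside[of "r\<^sup>2" \<alpha> \<beta> k] by (auto split: split_indicator)
        then show ?thesis by (auto simp: mult.assoc)
      qed
    qed
  qed simp
  define A where "A k \<alpha> \<beta> = (LINT r|lborel. f r * (2 * r) * indicator {0..} r * bump k \<alpha> \<beta> (r\<^sup>2))" for k \<alpha> \<beta>
  define C where "C = \<sigma> * A 1 1 2 / m0"
  define \<Phi> where "\<Phi> s = C - \<psi> s" for s
  have \<Phi>_bound: "\<bar>\<Phi> s\<bar> \<le> \<bar>C\<bar> + M \<alpha> \<beta>" if "0 < \<alpha>" "\<alpha> \<le> s" "s \<le> \<beta>" for s \<alpha> \<beta>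
    using \<psi>_bound[OF that] unfolding \<Phi>_def by linarith
  have \<Phi>_meas[measurable]: "\<Phi> \<in> borel_measurable borel" unfolding \<Phi>_def[abs_def] by measurable
  have bump\<psi>_int: "integrable lborel (\<lambda>s. bump k \<alpha> \<beta> s * \<psi> s)" if \<alpha>: "0 < \<alpha>" for k \<alpha> \<beta>
  proof (rule Bochner_Integration.integrable_bound[OF integrable_mult_left[OF integrable_bump[of k \<alpha> \<beta>], of "M \<alpha> \<beta>"]])
    show "AE s in lborel. norm (bump k \<alpha> \<beta> s * \<psi> s) \<le> norm (bump k \<alpha> \<beta> s * M \<alpha> \<beta>)"
    proof (rule AE_I2)
      fix s
      show "norm (bump k \<alpha> \<beta> s * \<psi> s) \<le> norm (bump k \<alpha> \<beta> s * M \<alpha> \<beta>)"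
      proof (cases "s \<in> {\<alpha><..<\<beta>}")
        case True
        then have "\<bar>\<psi> s\<bar> \<le> \<bar>M \<alpha> \<beta>\<bar>" using \<psi>_bound[OF \<alpha>, of s \<beta>] by auto
        then show ?thesis by (simp add: abs_mult mult_left_mono)
      qed (simp add: bump_outside)
    qed
  qed simp
  have key: "\<sigma> * A k \<alpha> \<beta> = (LINT s|lborel. bump k \<alpha> \<beta> s * \<Phi> s)" if \<alpha>: "0 < \<alpha>" "\<alpha> < \<beta>" for k \<alpha> \<beta>
  proof -
    have "(LINT r|lborel. f r * (2 * r) * indicator {0..} r * (bump k \<alpha> \<beta> (r\<^sup>2) - bump_mass k \<alpha> \<beta> / m0 * bump 1 1 2 (r\<^sup>2)))
      = (LINT r|lborel. f r * (2 * r) * indicator {0..} r * bump k \<alpha> \<beta> (r\<^sup>2)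
           - bump_mass k \<alpha> \<beta> / m0 * (f r * (2 * r) * indicator {0..} r * bump 1 1 2 (r\<^sup>2)))"
      by (rule Bochner_Integration.integral_cong) (auto simp: algebra_simps)
    also have "\<dots> = A k \<alpha> \<beta> - bump_mass k \<alpha> \<beta> / m0 * A 1 1 2"
      unfolding A_def using intfb[OF \<alpha>(1), of k \<beta>] intfb[of 1 1 2]
      by (subst Bochner_Integration.integral_diff) auto
    finally have eq: "(LINT r|lborel. f r * (2 * r) * indicator {0..} r * (bump k \<alpha> \<beta> (r\<^sup>2) - bump_mass k \<alpha> \<beta> / m0 * bump 1 1 2 (r\<^sup>2)))
      = A k \<alpha> \<beta> - bump_mass k \<alpha> \<beta> / m0 * A 1 1 2" .
    have "\<sigma> * (A k \<alpha> \<beta> - bump_mass k \<alpha> \<beta> / m0 * A 1 1 2) =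
      - (LINT x|lborel. W x * (LINT s|lborel. bump k \<alpha> \<beta> s * radial_kernel s ((norm x)\<^sup>2)))"
      using ident[OF \<alpha>, of k, folded m0_def] unfolding eq bump_prim_kernel[folded m0_def] .
    then have "\<sigma> * A k \<alpha> \<beta> = bump_mass k \<alpha> \<beta> * C - (LINT s|lborel. bump k \<alpha> \<beta> s * \<psi> s)"
      by (simp add: fubini[OF \<alpha>(1)] C_def algebra_simps)
    also have "\<dots> = (LINT s|lborel. bump k \<alpha> \<beta> s * C - bump k \<alpha> \<beta> s * \<psi> s)"
      using bump\<psi>_int[OF \<alpha>(1), of k \<beta>] integrable_bump[of k \<alpha> \<beta>]
      by (subst Bochner_Integration.integral_diff) (auto simp: bump_mass_def)
    finally show ?thesis by (simp add: \<Phi>_def algebra_simps)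
  qed
  have subst: "(LINT s|lborel. bump k (\<alpha>\<^sup>2) (\<beta>\<^sup>2) s * \<Phi> s) =
      (LINT r|lborel. \<Phi> (r\<^sup>2) * (2 * r) * indicator {0..} r * bump k (\<alpha>\<^sup>2) (\<beta>\<^sup>2) (r\<^sup>2))"
    if \<alpha>: "0 < \<alpha>" "\<alpha> < \<beta>" for k \<alpha> \<beta>
  proof -
    let ?b = "bump k (\<alpha>\<^sup>2) (\<beta>\<^sup>2)"
    have i: "integrable lborel (\<lambda>s. ?b s * \<Phi> s)"
      using bump\<psi>_int[of "\<alpha>\<^sup>2" k "\<beta>\<^sup>2"] integrable_bump[of k "\<alpha>\<^sup>2" "\<beta>\<^sup>2"] \<alpha>
      by (simp add: \<Phi>_def right_diff_distrib)
    have "(LINT s|lborel. ?b s * \<Phi> s) = (LINT s|lborel. (?b s * \<Phi> s) * indicator {\<alpha>\<^sup>2..\<beta>\<^sup>2} s)"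
      by (rule Bochner_Integration.integral_cong) (auto simp: bump_outside split: split_indicator)
    also have "\<dots> = (LINT r|lborel. (?b (r\<^sup>2) * \<Phi> (r\<^sup>2)) * (2 * r) * indicator {\<alpha>..\<beta>} r)"
    proof (rule integral_substitution(2))
      show "set_integrable lborel {\<alpha>\<^sup>2..\<beta>\<^sup>2} (\<lambda>s. ?b s * \<Phi> s)"
        using integrable_mult_indicator[OF _ i, of "{\<alpha>\<^sup>2..\<beta>\<^sup>2}"] by (simp add: set_integrable_def)
      show "((\<lambda>r. r\<^sup>2) has_real_derivative 2 * r) (at r)" for r :: real
        by (auto intro!: derivative_eq_intros)
    qed (use \<alpha> in \<open>auto intro!: continuous_intros\<close>)
    also have "\<dots> = (LINT r|lborel. \<Phi> (r\<^sup>2) * (2 * r) * indicator {0..} r * ?b (r\<^sup>2))"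
    proof (rule Bochner_Integration.integral_cong[OF refl])
      fix r :: real
      show "(?b (r\<^sup>2) * \<Phi> (r\<^sup>2)) * (2 * r) * indicator {\<alpha>..\<beta>} r = \<Phi> (r\<^sup>2) * (2 * r) * indicator {0..} r * ?b (r\<^sup>2)"
      proof (cases "r \<in> {\<alpha>..\<beta>}")
        case False
        have "?b (r\<^sup>2) = 0" if "0 \<le> r"
        proof -
          have "r < \<alpha> \<or> \<beta> < r" using False by auto
          then have "r\<^sup>2 < \<alpha>\<^sup>2 \<or> \<beta>\<^sup>2 < r\<^sup>2"
            using that \<alpha> by (auto intro: power_strict_mono)
          then show ?thesis by (intro bump_outside) auto
        qed
        then show ?thesis using False by (auto split: split_indicator)
      qed (use \<alpha> in auto)
    qed
    finally show ?thesis .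
  qed
  define d where "d r = (\<sigma> * f r - \<Phi> (r\<^sup>2)) * (2 * r)" for r
  have [measurable]: "d \<in> borel_measurable borel" unfolding d_def[abs_def] by measurable
  have \<Phi>2_int: "integrable lborel (\<lambda>r. indicator {\<alpha>..\<beta>} r * (\<Phi> (r\<^sup>2) * (2 * r)))" if \<alpha>: "0 < \<alpha>" for \<alpha> \<beta>
  proof (rule Bochner_Integration.integrable_bound)
    show "integrable lborel (\<lambda>r. ((\<bar>C\<bar> + M (\<alpha>\<^sup>2) (\<beta>\<^sup>2)) * (2 * \<beta>)) * indicator {\<alpha>..\<beta>} r :: real)"
      by (intro integrable_mult_right integrable_real_indicator) (auto simp: emeasure_lborel_Icc_eq)
    show "AE r in lborel. norm (indicator {\<alpha>..\<beta>} r * (\<Phi> (r\<^sup>2) * (2 * r))) \<le>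
       norm (((\<bar>C\<bar> + M (\<alpha>\<^sup>2) (\<beta>\<^sup>2)) * (2 * \<beta>)) * indicator {\<alpha>..\<beta>} r)"
    proof (rule AE_I2)
      fix r :: real
      have "\<bar>\<Phi> (r\<^sup>2)\<bar> * (2 * r) \<le> (\<bar>C\<bar> + M (\<alpha>\<^sup>2) (\<beta>\<^sup>2)) * (2 * \<beta>)" if "\<alpha> \<le> r" "r \<le> \<beta>"
        using that \<alpha> \<Phi>_bound[of "\<alpha>\<^sup>2" "r\<^sup>2" "\<beta>\<^sup>2"]
        by (intro mult_mono) (auto simp: power_mono intro: order_trans[OF abs_ge_zero])
      then show "norm (indicator {\<alpha>..\<beta>} r * (\<Phi> (r\<^sup>2) * (2 * r))) \<le>
       norm (((\<bar>C\<bar> + M (\<alpha>\<^sup>2) (\<beta>\<^sup>2)) * (2 * \<beta>)) * indicator {\<alpha>..\<beta>} r)"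
        using \<alpha> by (cases "r \<in> {\<alpha>..\<beta>}") (auto simp: abs_mult M_nonneg)
    qed
  qed simp
  have f2_int: "integrable lborel (\<lambda>r. indicator {\<alpha>..\<beta>} r * (\<sigma> * f r * (2 * r)))" if \<alpha>: "0 < \<alpha>" for \<alpha> \<beta>
  proof (rule Bochner_Integration.integrable_bound)
    show "integrable lborel (\<lambda>r. (\<sigma> * (2 * \<beta>)) * \<bar>indicator {\<alpha>..\<beta>} r * f r\<bar>)"
      using \<alpha> by (intro integrable_mult_right integrable_abs intf)
    show "AE r in lborel. norm (indicator {\<alpha>..\<beta>} r * (\<sigma> * f r * (2 * r))) \<le>
       norm ((\<sigma> * (2 * \<beta>)) * \<bar>indicator {\<alpha>..\<beta>} r * f r\<bar>)"
      using \<alpha> \<sigma> by (intro AE_I2) (auto simp: abs_mult mult_left_mono mult_right_mono split: split_indicator)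
  qed simp
  have d_int: "integrable lborel (\<lambda>r. indicator {\<alpha>..\<beta>} r * d r)" if \<alpha>: "0 < \<alpha>" for \<alpha> \<beta>
    using Bochner_Integration.integrable_diff[OF f2_int[OF \<alpha>, of \<beta>] \<Phi>2_int[OF \<alpha>, of \<beta>]]
    by (simp add: d_def left_diff_distrib right_diff_distrib)
  have d_AE: "AE r in lborel. 0 < r \<longrightarrow> d r = 0"
  proof (rule AE_zero_half_line[OF d_int])
    fix \<alpha> \<beta> :: real assume \<alpha>: "0 < \<alpha>" "\<alpha> < \<beta>"
    let ?b = "\<lambda>k r. bump k (\<alpha>\<^sup>2) (\<beta>\<^sup>2) (r\<^sup>2)"
    have sq: "0 < \<alpha>\<^sup>2" "\<alpha>\<^sup>2 < \<beta>\<^sup>2" using \<alpha> by (auto intro: power_strict_mono)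
    have ind: "indicator {\<alpha>..\<beta>} r * ?b k r = indicator {0..} r * ?b k r" for r k
    proof (cases "r \<in> {\<alpha>..\<beta>}")
      case False
      have "?b k r = 0" if "0 \<le> r"
      proof -
        have "r < \<alpha> \<or> \<beta> < r" using False by auto
        then have "r\<^sup>2 < \<alpha>\<^sup>2 \<or> \<beta>\<^sup>2 < r\<^sup>2"
          using that \<alpha> by (auto intro: power_strict_mono)
        then show ?thesis by (intro bump_outside) auto
      qed
      then show ?thesis using False by (auto split: split_indicator)
    qed (use \<alpha> in auto)
    have lim: "(\<lambda>k. LINT r|lborel. indicator {\<alpha>..\<beta>} r * d r * ?b k r) \<longlonglongrightarrow>
        (LINT r|lborel. indicator {\<alpha>..\<beta>} r * d r * indicator {\<alpha>\<^sup>2<..<\<beta>\<^sup>2} (r\<^sup>2))"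
    proof (rule integral_dominated_convergence[where w = "\<lambda>r. \<bar>indicator {\<alpha>..\<beta>} r * d r\<bar>"])
      show "integrable lborel (\<lambda>r. \<bar>indicator {\<alpha>..\<beta>} r * d r\<bar>)" by (intro integrable_abs d_int \<alpha>)
      show "AE r in lborel. (\<lambda>k. indicator {\<alpha>..\<beta>} r * d r * ?b k r) \<longlonglongrightarrow> indicator {\<alpha>..\<beta>} r * d r * indicator {\<alpha>\<^sup>2<..<\<beta>\<^sup>2} (r\<^sup>2)"
        by (intro AE_I2 tendsto_mult tendsto_const bump_tendsto)
      show "AE r in lborel. norm (indicator {\<alpha>..\<beta>} r * d r * ?b k r) \<le> \<bar>indicator {\<alpha>..\<beta>} r * d r\<bar>" for k
        using bump_bounds by (intro AE_I2) (simp add: abs_mult mult_left_le)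
    qed measurable
    moreover have "(LINT r|lborel. indicator {\<alpha>..\<beta>} r * d r * ?b k r) = 0" for k
    proof -
      have "(LINT r|lborel. \<Phi> (r\<^sup>2) * (2 * r) * indicator {0..} r * ?b k r) = \<sigma> * A k (\<alpha>\<^sup>2) (\<beta>\<^sup>2)"
        using key[OF sq, of k] subst[OF \<alpha>, of k] by simp
      moreover have int2: "integrable lborel (\<lambda>r. \<Phi> (r\<^sup>2) * (2 * r) * indicator {0..} r * ?b k r)"
      proof -
        have "integrable lborel (\<lambda>r. (indicator {\<alpha>..\<beta>} r * (\<Phi> (r\<^sup>2) * (2 * r))) * ?b k r)"
        proof (rule Bochner_Integration.integrable_bound[OF \<Phi>2_int[OF \<alpha>(1), of \<beta>]])
          show "AE r in lborel. norm ((indicator {\<alpha>..\<beta>} r * (\<Phi> (r\<^sup>2) * (2 * r))) * ?b k r) \<le>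
              norm (indicator {\<alpha>..\<beta>} r * (\<Phi> (r\<^sup>2) * (2 * r)))"
          proof (rule AE_I2)
            fix r
            have "norm (z * ?b k r) \<le> norm z" for z :: real
              using mult_left_le[OF bump_bounds(2)[of k "\<alpha>\<^sup>2" "\<beta>\<^sup>2" "r\<^sup>2"] abs_ge_zero[of z]]
              by (simp add: abs_mult bump_bounds)
            then show "norm ((indicator {\<alpha>..\<beta>} r * (\<Phi> (r\<^sup>2) * (2 * r))) * ?b k r) \<le>
              norm (indicator {\<alpha>..\<beta>} r * (\<Phi> (r\<^sup>2) * (2 * r)))" .
          qed
        qed simp
        moreover have "(indicator {\<alpha>..\<beta>} r * (\<Phi> (r\<^sup>2) * (2 * r))) * ?b k r = \<Phi> (r\<^sup>2) * (2 * r) * indicator {0..} r * ?b k r" for r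
          using arg_cong[OF ind[of r k], of "\<lambda>z. (\<Phi> (r\<^sup>2) * (2 * r)) * z"] by (simp only: mult_ac)
        ultimately show ?thesis by simp
      qed
      moreover have "(LINT r|lborel. indicator {\<alpha>..\<beta>} r * d r * ?b k r) =
        (LINT r|lborel. \<sigma> * (f r * (2 * r) * indicator {0..} r * ?b k r) - \<Phi> (r\<^sup>2) * (2 * r) * indicator {0..} r * ?b k r)"
      proof (rule Bochner_Integration.integral_cong[OF refl])
        fix r
        have "indicator {\<alpha>..\<beta>} r * d r * ?b k r = d r * (indicator {0..} r * ?b k r)"
          using arg_cong[OF ind[of r k], of "\<lambda>z. d r * z"] by (simp only: mult_ac)
        then show "indicator {\<alpha>..\<beta>} r * d r * ?b k r =
          \<sigma> * (f r * (2 * r) * indicator {0..} r * ?b k r) - \<Phi> (r\<^sup>2) * (2 * r) * indicator {0..} r * ?b k r"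
          by (simp add: d_def algebra_simps)
      qed
      ultimately show ?thesis
        using intfb[OF sq(1), of k "\<beta>\<^sup>2"] by (subst (asm) Bochner_Integration.integral_diff) (auto simp: A_def)
    qed
    ultimately have "(LINT r|lborel. indicator {\<alpha>..\<beta>} r * d r * indicator {\<alpha>\<^sup>2<..<\<beta>\<^sup>2} (r\<^sup>2)) = 0"
      by (simp add: LIMSEQ_const_iff)
    moreover have "indicator {\<alpha>..\<beta>} r * d r * indicator {\<alpha>\<^sup>2<..<\<beta>\<^sup>2} (r\<^sup>2) = indicator {\<alpha><..<\<beta>} r * d r" for r
    proof (cases "r \<in> {\<alpha>..\<beta>}")
      case True
      then have "r\<^sup>2 \<in> {\<alpha>\<^sup>2<..<\<beta>\<^sup>2} \<longleftrightarrow> r \<in> {\<alpha><..<\<beta>}"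
        using \<alpha> by (auto intro: power_strict_mono power_less_imp_less_base)
      then show ?thesis using True by (auto split: split_indicator)
    qed (auto split: split_indicator)
    ultimately show "(LINT r|lborel. indicator {\<alpha><..<\<beta>} r * d r) = 0" by simp
  qed
  define H where "H r = \<Phi> (r\<^sup>2) / \<sigma>" for r
  have "AE r in lborel. 0 < r \<longrightarrow> f r = H r"
    using d_AE by eventually_elim (use \<sigma> in \<open>auto simp: d_def H_def field_simps\<close>)
  moreover have "H t - H s = (LINT x|lborel. indicator {s<..t} (norm x) * W x) / \<sigma>" if st: "0 < s" "s \<le> t" for s t
  proof -
    have "H t - H s = (\<psi> (s\<^sup>2) - \<psi> (t\<^sup>2)) / \<sigma>"
      by (simp add: H_def \<Phi>_def diff_divide_distrib)
    also have "\<psi> (s\<^sup>2) - \<psi> (t\<^sup>2) = (LINT x|lborel. W x * radial_kernel (s\<^sup>2) ((norm x)\<^sup>2) - W x * radial_kernel (t\<^sup>2) ((norm x)\<^sup>2))"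
      unfolding \<psi>_def using st by (subst Bochner_Integration.integral_diff) (auto intro!: WK_int)
    also have "\<dots> = (LINT x|lborel. indicator {s<..t} (norm x) * W x)"
    proof (rule Bochner_Integration.integral_cong[OF refl])
      fix x :: 'a
      have "s\<^sup>2 < (norm x)\<^sup>2 \<longleftrightarrow> s < norm x" "t\<^sup>2 < (norm x)\<^sup>2 \<longleftrightarrow> t < norm x"
        using st by (auto intro: power_strict_mono power_less_imp_less_base)
      then show "W x * radial_kernel (s\<^sup>2) ((norm x)\<^sup>2) - W x * radial_kernel (t\<^sup>2) ((norm x)\<^sup>2) = indicator {s<..t} (norm x) * W x"
        using st by (auto simp: radial_kernel_def algebra_simps split: split_indicator)
    qed
    finally show ?thesis .
  qed
  ultimately show thesis by (rule that)
qed

section \<open>The profile of a radial function\<close>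

text \<open>Here \<open>g\<close> is to be thought of as the norm of the gradient divided by the area of the unit sphere, so that the last
  clause bounds increments of \<open>H\<close> by the integral of the absolute value of its derivative.\<close>
definition radial_profile :: "('a::euclidean_space \<Rightarrow> real) \<Rightarrow> ('a \<Rightarrow> real) \<Rightarrow> (real \<Rightarrow> real) \<Rightarrow> bool" where
  "radial_profile u g H \<longleftrightarrow> u \<in> borel_measurable borel \<and> g \<in> borel_measurable borel \<and> (\<forall>x. 0 \<le> g x) \<and>
     (AE x in lborel. u x = H (norm x)) \<and>
     (\<forall>s t. 0 < s \<longrightarrow> s \<le> t \<longrightarrow>
        ennreal \<bar>H t - H s\<bar> \<le> (\<integral>\<^sup>+x. ennreal (g x * norm x powr (1 - real DIM('a))) * indicator {s<..t} (norm x) \<partial>lborel))"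

lemma powr_polar_weight:
  assumes "0 < n"
  shows "s ^ (n - 1) * indicator {0..} s * s powr (2 - real n) = s * indicator {0..} s"
  using power_mult_powr_minus[OF assms, of s "real n - 2"]
  by (cases "0 \<le> s") (auto simp: mult_ac split: split_indicator)

lemma integral_lebesgue_borel_AE:
  fixes f g :: "'a::euclidean_space \<Rightarrow> real"
  assumes "f \<in> borel_measurable lebesgue" "g \<in> borel_measurable borel" "AE x in lebesgue. f x = g x"
  shows "(LINT x|lebesgue. f x) = (LINT x|lborel. g x)"
    and "integrable lebesgue f \<longleftrightarrow> integrable lborel g"
proof -
  have g: "g \<in> borel_measurable lebesgue" using assms(2) by (intro measurable_completion) simp
  show "(LINT x|lebesgue. f x) = (LINT x|lborel. g x)"
    using integral_cong_AE[OF assms(1) g assms(3)] assms(2) by (simp add: integral_completion)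
  show "integrable lebesgue f \<longleftrightarrow> integrable lborel g"
    using integrable_cong_AE[OF assms(1) g assms(3)] assms(2) by (simp add: integrable_completion)
qed

text \<open>The weak gradient and the function are replaced by Borel representatives, the identity
  \<open>weak_gradient_radial_identity\<close> is brought to one radial variable, and \<open>radial_primitive\<close> produces the profile.\<close>
lemma weak_gradient_radial_profile:
  fixes u :: "real^'n \<Rightarrow> real"
  assumes G: "has_weak_gradient u G" and rad: "radial u"
  obtains u' g H where "radial_profile u' g H" "AE x in lebesgue. u x = u' x"
    "AE x in lebesgue. g x = norm (G x) / sphere_area CARD('n)"
proof -
  define \<sigma> where "\<sigma> = sphere_area DIM(real^'n)"
  have \<sigma>: "0 < \<sigma>" unfolding \<sigma>_def by (rule sphere_area_pos)
  let ?n = "real CARD('n)"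
  have uloc: "locally_integrable u" and Gloc: "\<And>i. locally_integrable (\<lambda>x. G x $ i)"
    using G by (simp_all add: has_weak_gradient_def)
  have um: "u \<in> borel_measurable lebesgue" by (rule locally_integrable_measurable[OF uloc])
  obtain u0 where u0: "u0 \<in> borel_measurable lborel" "AE x in lborel. u x = u0 x"
    using completion_ex_borel_measurable_real[OF um] by auto
  obtain f0 where "AE x in lebesgue. u x = f0 (norm x)" using rad by (auto simp: radial_def)
  then have "AE x in lborel. u x = f0 (norm x)" by (simp add: AE_completion_iff)
  with u0(2) have "AE x in lborel. u0 x = f0 (norm x)" by eventually_elim simp
  with u0(1) obtain f where f[measurable]: "f \<in> borel_measurable borel" and f0: "AE x in lborel. u0 x = f (norm x)"
    using radial_borel_profile[of u0 f0] by auto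
  have uf: "AE x in lebesgue. u x = f (norm x)"
    by (rule AE_completion) (use u0(2) f0 in eventually_elim, simp)
  have "\<forall>i. \<exists>g'. g' \<in> borel_measurable borel \<and> (AE x in lborel. G x $ i = g' x)"
  proof
    fix i
    show "\<exists>g'. g' \<in> borel_measurable borel \<and> (AE x in lborel. G x $ i = g' x)"
      using completion_ex_borel_measurable_real[OF locally_integrable_measurable[OF Gloc[of i]]] by simp blast
  qed
  from choice[OF this] obtain G0 where "\<forall>i. G0 i \<in> borel_measurable borel \<and> (AE x in lborel. G x $ i = G0 i x)" ..
  then have G0m[measurable]: "\<And>i. G0 i \<in> borel_measurable borel"
    and G0: "\<And>i. AE x in lborel. G x $ i = G0 i x"
    by simp_all
  define V where "V x = (\<chi> i. G0 i x)" for x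
  have "AE x in lborel. \<forall>i. G x $ i = G0 i x" unfolding AE_all_countable using G0 by blast
  then have GV: "AE x in lborel. G x = V x"
    by eventually_elim (simp add: V_def vec_eq_iff)
  have GVL: "AE x in lebesgue. G x = V x" using GV by (rule AE_completion)
  have Vm[measurable]: "V \<in> borel_measurable borel"
    by (subst borel_measurable_euclidean_space) (auto simp: Basis_vec_def inner_axis V_def)
  define W where "W x = (V x \<bullet> x) * norm x powr (- ?n)" for x
  have [measurable]: "W \<in> borel_measurable borel" unfolding W_def[abs_def] by measurable
  have W_le: "\<bar>W x\<bar> \<le> norm (V x) * norm x powr (1 - ?n)" for x
  proof (cases "x = 0")
    case False
    have "\<bar>W x\<bar> \<le> (norm (V x) * norm x) * norm x powr (- ?n)"
      unfolding W_def abs_mult by (intro mult_mono Cauchy_Schwarz_ineq2) auto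
    also have "\<dots> = norm (V x) * (norm x * norm x powr (- ?n))" by simp
    also have "norm x * norm x powr (- ?n) = norm x powr (1 - ?n)"
      using powr_add[of "norm x" 1 "- ?n"] False by simp
    finally show ?thesis .
  qed (simp add: W_def)
  have intW: "integrable lborel (\<lambda>x. indicator {a..b} (norm x) * W x)" if a: "0 < a" for a b
  proof -
    have "integrable lebesgue (\<lambda>x. \<Sum>i\<in>UNIV. G x $ i * (indicator {a..b} (norm x) * x $ i * norm x powr (- ?n)))"
    proof (rule Bochner_Integration.integrable_sum)
      fix i
      show "integrable lebesgue (\<lambda>x. G x $ i * (indicator {a..b} (norm x) * x $ i * norm x powr (- ?n)))"
      proof (rule locally_integrable_mult[OF Gloc, of _ "\<bar>b\<bar> * a powr (- ?n)" b])
        fix x :: "real^'n"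
        show "\<bar>indicator {a..b} (norm x) * x $ i * norm x powr (- ?n)\<bar> \<le> \<bar>b\<bar> * a powr (- ?n)"
        proof (cases "norm x \<in> {a..b}")
          case True
          have "\<bar>x $ i\<bar> * norm x powr (- ?n) \<le> \<bar>b\<bar> * a powr (- ?n)"
            using True a component_le_norm_cart[of x i]
            by (intro mult_mono) (auto intro!: powr_mono2')
          then show ?thesis using True by (simp add: abs_mult)
        qed simp
      next
        show "(\<lambda>x. indicator {a..b} (norm x) * x $ i * norm x powr (- ?n)) \<in> borel_measurable borel"
          by measurable
      qed auto
    qed
    also have "?this \<longleftrightarrow> integrable lborel (\<lambda>x. indicator {a..b} (norm x) * W x)"
    proof (rule integral_lebesgue_borel_AE(2))
      show "(\<lambda>x. \<Sum>i\<in>UNIV. G x $ i * (indicator {a..b} (norm x) * x $ i * norm x powr (- ?n))) \<in> borel_measurable lebesgue"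
        using calculation by (rule borel_measurable_integrable)
      show "AE x in lebesgue. (\<Sum>i\<in>UNIV. G x $ i * (indicator {a..b} (norm x) * x $ i * norm x powr (- ?n))) =
          indicator {a..b} (norm x) * W x"
        using GVL
      proof eventually_elim
        case (elim x)
        show ?case unfolding W_def elim inner_vec_def sum_distrib_right sum_distrib_left
          by (rule sum.cong) (auto simp: mult_ac)
      qed
    qed measurable
    finally show ?thesis .
  qed
  have intf: "integrable lborel (\<lambda>r. indicator {a..b} r * f r)" if a: "0 < a" for a b
  proof -
    have "integrable lebesgue (\<lambda>x. u x * indicator {a..b} (norm x))"
    proof (rule locally_integrable_mult[OF uloc, of _ 1 b])
      show "(\<lambda>x::real^'n. indicator {a..b} (norm x) :: real) \<in> borel_measurable borel" by measurable
    qed auto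
    also have "?this \<longleftrightarrow> integrable lborel (\<lambda>x::real^'n. f (norm x) * indicator {a..b} (norm x))"
    proof (rule integral_lebesgue_borel_AE(2))
      show "(\<lambda>x. u x * indicator {a..b} (norm x)) \<in> borel_measurable lebesgue"
        using calculation by (rule borel_measurable_integrable)
      show "AE x in lebesgue. u x * indicator {a..b} (norm x) = f (norm x) * indicator {a..b} (norm x)"
        using uf by eventually_elim simp
    qed measurable
    also have "\<dots> \<longleftrightarrow> integrable lborel (\<lambda>s. \<sigma> * s ^ (DIM(real^'n) - 1) * indicator {0..} s * (f s * indicator {a..b} s))"
      unfolding \<sigma>_def by (rule integrable_norm_polar) measurable
    finally have i: "integrable lborel (\<lambda>s. \<sigma> * s ^ (DIM(real^'n) - 1) * indicator {0..} s * (f s * indicator {a..b} s))" .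
    show ?thesis
    proof (rule Bochner_Integration.integrable_bound[OF integrable_mult_right[OF i, of "1 / (\<sigma> * a ^ (DIM(real^'n) - 1))"]])
      show "AE r in lborel. norm (indicator {a..b} r * f r) \<le>
         norm (1 / (\<sigma> * a ^ (DIM(real^'n) - 1)) * (\<sigma> * r ^ (DIM(real^'n) - 1) * indicator {0..} r * (f r * indicator {a..b} r)))"
      proof (rule AE_I2)
        fix r :: real
        show "norm (indicator {a..b} r * f r) \<le>
         norm (1 / (\<sigma> * a ^ (DIM(real^'n) - 1)) * (\<sigma> * r ^ (DIM(real^'n) - 1) * indicator {0..} r * (f r * indicator {a..b} r)))"
        proof (cases "r \<in> {a..b}")
          case True
          have "a ^ (DIM(real^'n) - 1) \<le> r ^ (DIM(real^'n) - 1)" using True a by (intro power_mono) auto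
          then have "1 \<le> r ^ (DIM(real^'n) - 1) / a ^ (DIM(real^'n) - 1)"
            using a by (subst le_divide_eq) simp
          moreover define q where "q = 1 / (\<sigma> * a ^ (DIM(real^'n) - 1)) * (\<sigma> * r ^ (DIM(real^'n) - 1))"
          ultimately have q: "1 \<le> q"
 using \<sigma> by simp
          then have "1 * \<bar>f r\<bar> \<le> q * \<bar>f r\<bar>" by (intro mult_right_mono) auto
          then have fq: "\<bar>f r\<bar> \<le> \<bar>q * f r\<bar>" using q by (simp add: abs_mult)
          have e: "1 / (\<sigma> * a ^ (DIM(real^'n) - 1)) * (\<sigma> * r ^ (DIM(real^'n) - 1) * indicator {0..} r * (f r * indicator {a..b} r)) = q * f r"
            using True a by (simp add: q_def)
          show ?thesis unfolding e using fq True by simp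
        qed simp
      qed
    qed measurable
  qed
  have ident: "\<sigma> * (LINT r|lborel. f r * (2 * r) * indicator {0..} r * (bump k a b (r\<^sup>2) - bump_mass k a b / bump_mass 1 1 2 * bump 1 1 2 (r\<^sup>2)))
      = - (LINT x|lborel. W x * (bump_prim k a b ((norm x)\<^sup>2) - bump_mass k a b / bump_mass 1 1 2 * bump_prim 1 1 2 ((norm x)\<^sup>2)))"
    if ab: "0 < a" "a < b" for a b k
  proof -
    define c where "c = bump_mass k a b / bump_mass 1 1 2"
    define Z where "Z t = bump_prim k a b t - c * bump_prim 1 1 2 t" for t
    define \<zeta> where "\<zeta> t = bump k a b t - c * bump 1 1 2 t" for t
    have m: "0 < bump_mass 1 1 2" by (rule bump_mass_pos) auto
    have [measurable]: "Z \<in> borel_measurable borel" "\<zeta> \<in> borel_measurable borel"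
      unfolding Z_def[abs_def] \<zeta>_def[abs_def] by measurable
    have id: "(LINT x|lebesgue. u x * (2 * norm x powr (2 - ?n) * \<zeta> ((norm x)\<^sup>2)))
       = - (LINT x|lebesgue. (G x \<bullet> x) * norm x powr (- ?n) * Z ((norm x)\<^sup>2))"
    proof (rule weak_gradient_radial_identity[OF G, where a = "min a 1" and b = "max b 2"])
      show "(Z has_real_derivative \<zeta> t) (at t)" for t
        unfolding Z_def[abs_def] \<zeta>_def
        by (rule DERIV_diff[OF bump_prim_derivative DERIV_cmult[OF bump_prim_derivative]])
      show "smooth_gen (\<lambda>x::real^'n. \<zeta> ((norm x)\<^sup>2))"
        unfolding \<zeta>_def
        by (rule smooth_gen_minus[OF smooth_gen_bump[OF smooth_gen_norm_squared]
              smooth_gen.mult[OF smooth_gen.const smooth_gen_bump[OF smooth_gen_norm_squared]]])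
      show "Z t = 0" if "t \<le> min a 1" for t using that by (simp add: Z_def bump_prim_low)
      show "\<zeta> t = 0" if "t \<le> min a 1" for t using that by (simp add: \<zeta>_def bump_outside)
      show "Z t = 0" if "max b 2 \<le> t" for t using that m by (simp add: Z_def bump_prim_high c_def)
      show "\<zeta> t = 0" if "max b 2 \<le> t" for t using that by (simp add: \<zeta>_def bump_outside)
    qed (use ab in simp)
    have "(LINT x|lebesgue. u x * (2 * norm x powr (2 - ?n) * \<zeta> ((norm x)\<^sup>2)))
       = (LINT x|lborel. f (norm (x::real^'n)) * (2 * norm x powr (2 - ?n) * \<zeta> ((norm x)\<^sup>2)))"
    proof (rule integral_lebesgue_borel_AE(1))
      have "(\<lambda>x::real^'n. 2 * norm x powr (2 - ?n) * \<zeta> ((norm x)\<^sup>2)) \<in> borel_measurable lebesgue"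
        by (rule measurable_completion) measurable
      then show "(\<lambda>x. u x * (2 * norm x powr (2 - ?n) * \<zeta> ((norm x)\<^sup>2))) \<in> borel_measurable lebesgue"
        using um by (rule borel_measurable_times[rotated])
      show "AE x in lebesgue. u x * (2 * norm x powr (2 - ?n) * \<zeta> ((norm x)\<^sup>2)) = f (norm x) * (2 * norm x powr (2 - ?n) * \<zeta> ((norm x)\<^sup>2))"
        using uf by eventually_elim simp
    qed measurable
    also have "\<dots> = (LINT s|lborel. \<sigma> * s ^ (DIM(real^'n) - 1) * indicator {0..} s * (f s * (2 * s powr (2 - ?n) * \<zeta> (s\<^sup>2))))"
      unfolding \<sigma>_def by (rule integrable_norm_polar) measurable
    also have "\<dots> = (LINT s|lborel. \<sigma> * (f s * (2 * s) * indicator {0..} s * \<zeta> (s\<^sup>2)))"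
    proof (rule Bochner_Integration.integral_cong[OF refl])
      fix s :: real
      have e: "s ^ (DIM(real^'n) - 1) * indicator {0..} s * s powr (2 - ?n) = s * indicator {0..} s"
        using powr_polar_weight[of "CARD('n)" s] by simp
      show "\<sigma> * s ^ (DIM(real^'n) - 1) * indicator {0..} s * (f s * (2 * s powr (2 - ?n) * \<zeta> (s\<^sup>2))) =
        \<sigma> * (f s * (2 * s) * indicator {0..} s * \<zeta> (s\<^sup>2))"
        using arg_cong[OF e, of "\<lambda>z. 2 * (\<sigma> * f s * \<zeta> (s\<^sup>2)) * z"] by (simp only: mult_ac)
    qed
    also have "\<dots> = \<sigma> * (LINT s|lborel. f s * (2 * s) * indicator {0..} s * \<zeta> (s\<^sup>2))" by simp
    finally have lhs: "(LINT x|lebesgue. u x * (2 * norm x powr (2 - ?n) * \<zeta> ((norm x)\<^sup>2))) = \<dots>" .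
    have rhs: "(LINT x|lebesgue. (G x \<bullet> x) * norm x powr (- ?n) * Z ((norm x)\<^sup>2)) = (LINT x|lborel. W x * Z ((norm x)\<^sup>2))"
    proof (rule integral_lebesgue_borel_AE(1))
      have [measurable]: "(\<lambda>x. G x $ i) \<in> borel_measurable lebesgue" for i
        by (rule locally_integrable_measurable[OF Gloc])
      have [measurable]: "(\<lambda>x::real^'n. x $ i) \<in> borel_measurable lebesgue" for i
        by (rule measurable_completion) simp
      have [measurable]: "(\<lambda>x::real^'n. norm x powr (- ?n) * Z ((norm x)\<^sup>2)) \<in> borel_measurable lebesgue"
        by (rule measurable_completion) measurable
      have "(\<lambda>x. (\<Sum>i\<in>UNIV. G x $ i * x $ i) * (norm x powr (- ?n) * Z ((norm x)\<^sup>2))) \<in> borel_measurable lebesgue"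
        by measurable
      then show "(\<lambda>x. (G x \<bullet> x) * norm x powr (- ?n) * Z ((norm x)\<^sup>2)) \<in> borel_measurable lebesgue"
        by (simp add: inner_vec_def mult.assoc)
      show "AE x in lebesgue. (G x \<bullet> x) * norm x powr (- ?n) * Z ((norm x)\<^sup>2) = W x * Z ((norm x)\<^sup>2)"
        using GVL by eventually_elim (simp add: W_def)
    qed measurable
    show ?thesis using id[unfolded lhs rhs] unfolding Z_def \<zeta>_def c_def .
  qed
  obtain H where H: "AE r in lborel. 0 < r \<longrightarrow> f r = H r"
    "\<And>s t. 0 < s \<Longrightarrow> s \<le> t \<Longrightarrow> H t - H s = (LINT x|lborel. indicator {s<..t} (norm x) * W x) / \<sigma>"
    by (rule radial_primitive[OF \<open>W \<in> borel_measurable borel\<close> f intW intf, folded \<sigma>_def, OF _ _ ident]) blast+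
  define g where "g x = norm (V x) / \<sigma>" for x
  have [measurable]: "g \<in> borel_measurable borel" unfolding g_def[abs_def] by measurable
  have "radial_profile (\<lambda>x. f (norm x)) g H"
    unfolding radial_profile_def
  proof (intro conjI allI impI)
    show "AE x::real^'n in lborel. f (norm x) = H (norm x)"
      by (rule AE_norm_lborel[OF H(1)])
    fix s t :: real assume st: "0 < s" "s \<le> t"
    have i: "integrable lborel (\<lambda>x. indicator {s<..t} (norm x) * W x)"
    proof -
      have "integrable lborel (\<lambda>x. indicator {s<..t} (norm x) *\<^sub>R (indicator {s..t} (norm x) * W x))"
        using integrable_mult_indicator[OF _ intW[OF st(1), of t], of "{x. norm x \<in> {s<..t}}"]
        by (simp add: indicator_def)
      then show ?thesis
        by (rule Bochner_Integration.integrable_cong[OF refl, THEN iffD1, rotated]) (auto split: split_indicator)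
    qed
    have "ennreal \<bar>H t - H s\<bar> = ennreal (\<bar>LINT x|lborel. indicator {s<..t} (norm x) * W x\<bar> / \<sigma>)"
      using \<sigma> by (simp add: H(2)[OF st] abs_divide)
    also have "\<dots> \<le> ennreal ((LINT x|lborel. \<bar>indicator {s<..t} (norm x) * W x\<bar>) / \<sigma>)"
      using \<sigma> by (intro ennreal_leI divide_right_mono integral_abs_bound) auto
    also have "(LINT x|lborel. \<bar>indicator {s<..t} (norm x) * W x\<bar>) / \<sigma> = (LINT x|lborel. \<bar>indicator {s<..t} (norm x) * W x\<bar> / \<sigma>)"
      by simp
    also have "ennreal \<dots> = (\<integral>\<^sup>+x. ennreal (\<bar>indicator {s<..t} (norm x) * W x\<bar> / \<sigma>) \<partial>lborel)"
      using \<sigma> by (intro nn_integral_eq_integral[symmetric] integrable_divide integrable_abs i) auto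
    also have "\<dots> \<le> (\<integral>\<^sup>+x. ennreal (g x * norm x powr (1 - real DIM(real^'n))) * indicator {s<..t} (norm x) \<partial>lborel)"
    proof (rule nn_integral_mono)
      fix x
      have "\<bar>W x\<bar> / \<sigma> \<le> g x * norm x powr (1 - real DIM(real^'n))"
        using divide_right_mono[OF W_le[of x], of \<sigma>] \<sigma> by (simp add: g_def)
      then show "ennreal (\<bar>indicator {s<..t} (norm x) * W x\<bar> / \<sigma>) \<le> ennreal (g x * norm x powr (1 - real DIM(real^'n))) * indicator {s<..t} (norm x)"
        by (auto simp: abs_mult intro: ennreal_leI split: split_indicator)
    qed
    finally show "ennreal \<bar>H t - H s\<bar> \<le> (\<integral>\<^sup>+x. ennreal (g x * norm x powr (1 - real DIM(real^'n))) * indicator {s<..t} (norm x) \<partial>lborel)" .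
  qed (use \<sigma> in \<open>auto simp: g_def\<close>)
  moreover have "AE x in lebesgue. g x = norm (G x) / sphere_area CARD('n)"
    using GVL by eventually_elim (simp add: g_def \<sigma>_def)
  ultimately show thesis using uf that by blast
qed

section \<open>Pointwise estimates of the profile\<close>

text \<open>After division by \<open>\<alpha> powr (m - 1)\<close> this is Young's inequality for \<open>\<beta> powr m\<close> and \<open>\<alpha> powr m\<close> with weights \<open>1 / m\<close> and \<open>1 - 1 / m\<close>.\<close>
lemma powr_diff_le:
  fixes \<alpha> \<beta> m :: real
  assumes "0 \<le> \<beta>" "\<beta> \<le> \<alpha>" "1 < m"
  shows "\<alpha> powr m - \<beta> powr m \<le> m * \<alpha> powr (m - 1) * (\<alpha> - \<beta>)"
proof (cases "\<beta> = 0 \<or> \<alpha> = 0")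
  case True
  have "\<alpha> powr m = \<alpha> powr (m - 1) * \<alpha>"
    using assms powr_add[of \<alpha> "m - 1" 1] by (cases "\<alpha> = 0") auto
  moreover have "1 * (\<alpha> powr (m - 1) * \<alpha>) \<le> m * (\<alpha> powr (m - 1) * \<alpha>)"
    using assms by (intro mult_right_mono) auto
  ultimately show ?thesis using True assms by auto
next
  case False
  then have pos: "0 < \<beta>" "0 < \<alpha>" using assms by auto
  have "(\<beta> powr m) powr (1 / m) * (\<alpha> powr m) powr (1 - 1 / m) \<le> 1 / m * \<beta> powr m + (1 - 1 / m) * \<alpha> powr m"
    using assms pos by (intro Youngs_inequality_0) auto
  also have "(\<beta> powr m) powr (1 / m) = \<beta>" using assms pos by (simp add: powr_powr)
  also have "(\<alpha> powr m) powr (1 - 1 / m) = \<alpha> powr (m - 1)" using assms by (simp add: powr_powr algebra_simps)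
  finally have "m * (\<beta> * \<alpha> powr (m - 1)) \<le> m * (1 / m * \<beta> powr m + (1 - 1 / m) * \<alpha> powr m)"
    using assms by (intro mult_left_mono) auto
  also have "\<dots> = \<beta> powr m + (m - 1) * \<alpha> powr m" using assms by (simp add: algebra_simps)
  finally have "m * \<beta> * \<alpha> powr (m - 1) \<le> \<beta> powr m + (m - 1) * \<alpha> powr m" by simp
  moreover have "\<alpha> powr m = \<alpha> powr (m - 1) * \<alpha>"
    using pos powr_add[of \<alpha> "m - 1" 1] by simp
  ultimately show ?thesis by (simp add: algebra_simps)
qed

lemma emeasure_annulus:
  assumes "0 \<le> s" "s \<le> t"
  shows "emeasure lborel {x::'a::euclidean_space. s < norm x \<and> norm x \<le> t} =
    ennreal (unit_ball_vol (real DIM('a)) * (t ^ DIM('a) - s ^ DIM('a)))"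
proof -
  have "{x::'a. s < norm x \<and> norm x \<le> t} = cball 0 t - cball 0 s" by auto
  also have "emeasure lborel \<dots> = emeasure lborel (cball (0::'a) t) - emeasure lborel (cball (0::'a) s)"
    using assms by (intro emeasure_Diff) (auto simp: emeasure_cball)
  also have "\<dots> = ennreal (unit_ball_vol (real DIM('a)) * t ^ DIM('a) - unit_ball_vol (real DIM('a)) * s ^ DIM('a))"
    using assms by (simp add: emeasure_cball ennreal_minus)
  finally show ?thesis by (simp add: right_diff_distrib)
qed

lemma nn_integral_Cauchy_Schwarz_bound:
  fixes f h :: "'a \<Rightarrow> real"
  assumes [measurable]: "f \<in> borel_measurable M" "h \<in> borel_measurable M"
    and nn: "\<And>x. 0 \<le> f x" "\<And>x. 0 \<le> h x" "0 \<le> A" "0 \<le> B"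
    and f: "(\<integral>\<^sup>+x. ennreal ((f x)\<^sup>2) \<partial>M) \<le> ennreal (A\<^sup>2)"
    and h: "(\<integral>\<^sup>+x. ennreal ((h x)\<^sup>2) \<partial>M) \<le> ennreal (B\<^sup>2)"
  shows "(\<integral>\<^sup>+x. ennreal (f x * h x) \<partial>M) \<le> ennreal (A * B)"
proof -
  have "(\<integral>\<^sup>+x. ennreal (f x * h x) \<partial>M) = (\<integral>\<^sup>+x. ennreal (f x) * ennreal (h x) \<partial>M)"
    by (simp add: ennreal_mult nn)
  moreover have "(\<integral>\<^sup>+x. ennreal (f x) * ennreal (h x) \<partial>M)\<^sup>2 \<le> ennreal (A\<^sup>2) * ennreal (B\<^sup>2)"
    using order_trans[OF Cauchy_Schwarz_nn_integral[of "\<lambda>x. ennreal (f x)" M "\<lambda>x. ennreal (h x)"]] mult_mono[OF f h]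
    by (simp add: ennreal_power nn)
  moreover have "ennreal (A\<^sup>2) * ennreal (B\<^sup>2) = (ennreal (A * B))\<^sup>2"
    using nn by (simp add: ennreal_mult[symmetric] ennreal_power power_mult_distrib)
  ultimately have le: "(\<integral>\<^sup>+x. ennreal (f x * h x) \<partial>M)\<^sup>2 \<le> (ennreal (A * B))\<^sup>2" by simp
  show ?thesis
  proof (rule ccontr)
    assume "\<not> ?thesis"
    then have "(ennreal (A * B))\<^sup>2 < (\<integral>\<^sup>+x. ennreal (f x * h x) \<partial>M)\<^sup>2"
    proof -
      assume "\<not> (\<integral>\<^sup>+x. ennreal (f x * h x) \<partial>M) \<le> ennreal (A * B)"
      then have lt: "ennreal (A * B) < (\<integral>\<^sup>+x. ennreal (f x * h x) \<partial>M)" by simp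
      show ?thesis
      proof (cases "(\<integral>\<^sup>+x. ennreal (f x * h x) \<partial>M)" rule: ennreal_cases)
        case (real r)
        then have "A * B < r" using lt nn by (simp add: ennreal_less_iff)
        then have "(A * B)\<^sup>2 < r\<^sup>2" using nn by (intro power_strict_mono) auto
        then show ?thesis using real nn by (simp add: ennreal_power ennreal_less_iff)
      next
        case top
        then show ?thesis by (simp add: ennreal_power ennreal_top_eq_mult_iff power2_eq_square ennreal_mult_less_top)
      qed
    qed
    then show False using le by simp
  qed
qed

text \<open>The number \<open>D\<close> is any bound for the \<open>L\<^sup>2\<close> norm of \<open>g\<close>, not the norm itself, so that all members of a bounded
  sequence can share it.  The same applies to \<open>Q\<close> in \<open>radial_energy_bound\<close>.\<close>
locale radial_gradient_bound =
  fixes u g :: "'a::euclidean_space \<Rightarrow> real" and H :: "real \<Rightarrow> real" and D :: real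
  assumes prof: "radial_profile u g H" and dim: "2 \<le> DIM('a)" and D_nonneg: "0 \<le> D"
    and g2: "(\<integral>\<^sup>+x. ennreal ((g x)\<^sup>2) \<partial>lborel) \<le> ennreal (D\<^sup>2)"
begin

definition J :: "'a \<Rightarrow> real" where "J x = g x * norm x powr (1 - real DIM('a))"

lemma u_meas[measurable]: "u \<in> borel_measurable borel"
  and g_meas[measurable]: "g \<in> borel_measurable borel"
  and g_nonneg: "0 \<le> g x"
  and u_H: "AE x in lborel. u x = H (norm x)"
  and H_incr: "0 < s \<Longrightarrow> s \<le> t \<Longrightarrow> ennreal \<bar>H t - H s\<bar> \<le> (\<integral>\<^sup>+x. ennreal (J x) * indicator {s<..t} (norm x) \<partial>lborel)"
  using prof by (auto simp: radial_profile_def J_def)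

lemma J_meas[measurable]: "J \<in> borel_measurable borel"
  unfolding J_def[abs_def] by measurable

lemma J_nonneg: "0 \<le> J x" by (simp add: J_def g_nonneg)

lemma g_Cauchy_Schwarz:
  assumes "h \<in> borel_measurable borel" "\<And>x. 0 \<le> h x" "0 \<le> B" "(\<integral>\<^sup>+x. ennreal ((h x)\<^sup>2) \<partial>lborel) \<le> ennreal (B\<^sup>2)"
  shows "(\<integral>\<^sup>+x. ennreal (g x * h x) \<partial>lborel) \<le> ennreal (D * B)"
  using assms g2 D_nonneg by (intro nn_integral_Cauchy_Schwarz_bound) (auto simp: g_nonneg)

lemma J_annulus:
  assumes s: "0 < s" "s \<le> t"
  shows "(\<integral>\<^sup>+x. ennreal (J x) * indicator {s<..t} (norm x) \<partial>lborel)
    \<le> ennreal (D * (s powr (1 - real DIM('a)) * sqrt (unit_ball_vol (real DIM('a)) * (t ^ DIM('a) - s ^ DIM('a)))))"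
proof -
  let ?w = "s powr (1 - real DIM('a))" and ?V = "unit_ball_vol (real DIM('a)) * (t ^ DIM('a) - s ^ DIM('a))"
  have V: "0 \<le> ?V" using s unit_ball_vol_nonneg by (intro mult_nonneg_nonneg) (auto intro: power_mono)
  have "(\<integral>\<^sup>+x. ennreal (J x) * indicator {s<..t} (norm x) \<partial>lborel)
     = (\<integral>\<^sup>+x. ennreal (g x * (norm x powr (1 - real DIM('a)) * indicator {s<..t} (norm x))) \<partial>lborel)"
    by (intro nn_integral_cong) (auto simp: J_def split: split_indicator)
  also have "\<dots> \<le> ennreal (D * (?w * sqrt ?V))"
  proof (rule g_Cauchy_Schwarz)
    have "(\<integral>\<^sup>+x. ennreal ((norm (x::'a) powr (1 - real DIM('a)) * indicator {s<..t} (norm x))\<^sup>2) \<partial>lborel)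
       \<le> (\<integral>\<^sup>+x. ennreal (?w\<^sup>2) * indicator {x::'a. s < norm x \<and> norm x \<le> t} x \<partial>lborel)"
    proof (rule nn_integral_mono)
      fix x :: 'a
      have "norm x powr (1 - real DIM('a)) \<le> ?w" if "s < norm x"
        using that s dim by (intro powr_mono2') auto
      then have "(norm x powr (1 - real DIM('a)))\<^sup>2 \<le> ?w\<^sup>2" if "s < norm x"
        using that by (intro power_mono) auto
      then show "ennreal ((norm x powr (1 - real DIM('a)) * indicator {s<..t} (norm x))\<^sup>2)
        \<le> ennreal (?w\<^sup>2) * indicator {x::'a. s < norm x \<and> norm x \<le> t} x"
        by (auto split: split_indicator intro: ennreal_leI)
    qed
    also have "\<dots> = ennreal (?w\<^sup>2) * ennreal ?V"
      using s by (subst nn_integral_cmult_indicator) (auto simp: emeasure_annulus)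
    also have "\<dots> = ennreal ((?w * sqrt ?V)\<^sup>2)"
      using V by (simp add: ennreal_mult[symmetric] power_mult_distrib)
    finally show "(\<integral>\<^sup>+x. ennreal ((norm (x::'a) powr (1 - real DIM('a)) * indicator {s<..t} (norm x))\<^sup>2) \<partial>lborel)
       \<le> ennreal ((?w * sqrt ?V)\<^sup>2)" .
  qed (use V in auto)
  finally show ?thesis .
qed

lemma H_incr_bound:
  assumes s: "0 < s" "s \<le> t"
  shows "\<bar>H t - H s\<bar> \<le> D * (s powr (1 - real DIM('a)) * sqrt (unit_ball_vol (real DIM('a)) * (t ^ DIM('a) - s ^ DIM('a))))"
proof -
  have "0 \<le> unit_ball_vol (real DIM('a)) * (t ^ DIM('a) - s ^ DIM('a))"
    using s unit_ball_vol_nonneg by (intro mult_nonneg_nonneg) (auto intro: power_mono)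
  then have "0 \<le> D * (s powr (1 - real DIM('a)) * sqrt (unit_ball_vol (real DIM('a)) * (t ^ DIM('a) - s ^ DIM('a))))"
    using D_nonneg by auto
  then show ?thesis
    using order_trans[OF H_incr[OF s] J_annulus[OF s]] by (simp only: ennreal_le_iff)
qed

lemma H_continuous: "0 < s \<Longrightarrow> isCont H s"
proof -
  assume s: "0 < s"
  let ?f = "\<lambda>t. D * ((s / 2) powr (1 - real DIM('a)) * sqrt (unit_ball_vol (real DIM('a)) * \<bar>t ^ DIM('a) - s ^ DIM('a)\<bar>))"
  have "(?f \<longlongrightarrow> D * ((s / 2) powr (1 - real DIM('a)) * sqrt (unit_ball_vol (real DIM('a)) * \<bar>s ^ DIM('a) - s ^ DIM('a)\<bar>))) (at s)"
    by (intro tendsto_intros)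
  then have lim: "(?f \<longlongrightarrow> 0) (at s)" by simp
  have "\<forall>\<^sub>F t in at s. norm (H t - H s) \<le> ?f t"
  proof -
    have "\<forall>\<^sub>F t in at s. t \<in> {s / 2<..}"
      using s by (intro eventually_at_in_open') auto
    then show ?thesis
    proof eventually_elim
      case (elim t)
      have w: "a powr (1 - real DIM('a)) \<le> (s / 2) powr (1 - real DIM('a))" if "s / 2 \<le> a" for a
        using that s dim by (intro powr_mono2') auto
      show ?case
      proof (cases "s \<le> t")
        case True
        have "s ^ DIM('a) \<le> t ^ DIM('a)" using True s by (intro power_mono) auto
        moreover have "D * (s powr (1 - real DIM('a)) * sqrt (unit_ball_vol (real DIM('a)) * (t ^ DIM('a) - s ^ DIM('a))))
          \<le> D * ((s / 2) powr (1 - real DIM('a)) * sqrt (unit_ball_vol (real DIM('a)) * (t ^ DIM('a) - s ^ DIM('a))))"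
          using w[of s] s D_nonneg calculation unit_ball_vol_nonneg[of "real DIM('a)"]
          by (intro mult_left_mono mult_right_mono) auto
        ultimately show ?thesis using H_incr_bound[OF s True] by simp
      next
        case False
        then have t: "0 < t" "t \<le> s" using elim s by auto
        have "t ^ DIM('a) \<le> s ^ DIM('a)" using t by (intro power_mono) auto
        moreover have "D * (t powr (1 - real DIM('a)) * sqrt (unit_ball_vol (real DIM('a)) * (s ^ DIM('a) - t ^ DIM('a))))
          \<le> D * ((s / 2) powr (1 - real DIM('a)) * sqrt (unit_ball_vol (real DIM('a)) * (s ^ DIM('a) - t ^ DIM('a))))"
          using w[of t] elim D_nonneg calculation unit_ball_vol_nonneg[of "real DIM('a)"]
          by (intro mult_left_mono mult_right_mono) auto
        ultimately show ?thesis using H_incr_bound[OF t] by (simp add: abs_minus_commute)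
      qed
    qed
  qed
  then have "((\<lambda>t. H t - H s) \<longlongrightarrow> 0) (at s)"
    using lim by (rule Lim_null_comparison)
  then have "(H \<longlongrightarrow> H s) (at s)" by (rule LIM_zero_cancel)
  then show ?thesis by (simp add: isCont_def)
qed

text \<open>The profile need not be differentiable, so the chain rule is replaced by bisection.  On a short interval
  \<open>m * \<bar>H\<bar> powr (m - 1)\<close> varies by less than \<open>\<epsilon>\<close>, which gives the estimate there up to a multiple of \<open>\<epsilon>\<close>, and the
  estimates on adjacent intervals add up.\<close>
lemma H_powr_chain:
  assumes m: "1 < m" and st: "0 < s" "s \<le> t"
  shows "ennreal (\<bar>H s\<bar> powr m) \<le> ennreal (\<bar>H t\<bar> powr m)
    + (\<integral>\<^sup>+x. ennreal (m * \<bar>u x\<bar> powr (m - 1) * J x) * indicator {s<..t} (norm x) \<partial>lborel)"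
proof (rule ennreal_le_epsilon)
  fix e :: real assume e: "0 < e"
  define K where "K = D * (s powr (1 - real DIM('a)) * sqrt (unit_ball_vol (real DIM('a)) * (t ^ DIM('a) - s ^ DIM('a))))"
  have JK: "(\<integral>\<^sup>+x. ennreal (J x) * indicator {s<..t} (norm x) \<partial>lborel) \<le> ennreal K"
    unfolding K_def by (rule J_annulus[OF st])
  have K: "0 \<le> K" unfolding K_def
    using st D_nonneg unit_ball_vol_nonneg[of "real DIM('a)"]
    by (intro mult_nonneg_nonneg) (auto intro!: mult_nonneg_nonneg power_mono)
  (* K bounds the integral of J over the annulus, so that the total error is at most \<epsilon> * K \<le> e. *)
  define \<epsilon> where "\<epsilon> = e / (K + 1)"
  have \<epsilon>: "0 < \<epsilon>" using e K by (simp add: \<epsilon>_def)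
  define P where "P a b \<longleftrightarrow> ennreal (\<bar>H a\<bar> powr m) \<le> ennreal (\<bar>H b\<bar> powr m)
    + (\<integral>\<^sup>+x. ennreal ((m * \<bar>u x\<bar> powr (m - 1) + \<epsilon>) * J x) * indicator {a<..b} (norm x) \<partial>lborel)" for a b
  have "P s t"
  proof (rule Bolzano[OF st(2)])
    fix a b c assume ab: "P a b" "P b c" "a \<le> b" "b \<le> c"
    let ?F = "\<lambda>x. ennreal ((m * \<bar>u x\<bar> powr (m - 1) + \<epsilon>) * J x)"
    have "(\<integral>\<^sup>+x. ?F x * indicator {a<..b} (norm x) \<partial>lborel) + (\<integral>\<^sup>+x. ?F x * indicator {b<..c} (norm x) \<partial>lborel)
       = (\<integral>\<^sup>+x. ?F x * indicator {a<..b} (norm x) + ?F x * indicator {b<..c} (norm x) \<partial>lborel)"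
      by (rule nn_integral_add[symmetric]) measurable
    also have "\<dots> = (\<integral>\<^sup>+x. ?F x * indicator {a<..c} (norm x) \<partial>lborel)"
      using ab(3,4) by (intro nn_integral_cong) (auto split: split_indicator)
    finally have "(\<integral>\<^sup>+x. ?F x * indicator {b<..c} (norm x) \<partial>lborel) + (\<integral>\<^sup>+x. ?F x * indicator {a<..b} (norm x) \<partial>lborel)
       = (\<integral>\<^sup>+x. ?F x * indicator {a<..c} (norm x) \<partial>lborel)" by (simp add: add.commute)
    moreover have "ennreal (\<bar>H a\<bar> powr m) \<le> ennreal (\<bar>H c\<bar> powr m) + (\<integral>\<^sup>+x. ?F x * indicator {b<..c} (norm x) \<partial>lborel)
       + (\<integral>\<^sup>+x. ?F x * indicator {a<..b} (norm x) \<partial>lborel)"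
      using ab(1,2) unfolding P_def by (meson add_right_mono order_trans)
    ultimately show "P a c" unfolding P_def by (simp add: add.assoc)
  next
    fix x assume x: "s \<le> x" "x \<le> t"
    have "isCont (\<lambda>y. m * \<bar>H y\<bar> powr (m - 1)) x"
      unfolding isCont_def
      using H_continuous[of x] x st m
      by (intro tendsto_mult tendsto_const tendsto_powr' tendsto_rabs) (auto simp: isCont_def)
    then have "\<exists>d>0. \<forall>y. dist y x < d \<longrightarrow> dist (m * \<bar>H y\<bar> powr (m - 1)) (m * \<bar>H x\<bar> powr (m - 1)) < \<epsilon> / 2"
      using \<epsilon> unfolding continuous_at_eps_delta by (simp only: half_gt_zero)
    then obtain d where d: "0 < d" "\<And>y. \<bar>y - x\<bar> < d \<Longrightarrow> \<bar>m * \<bar>H y\<bar> powr (m - 1) - m * \<bar>H x\<bar> powr (m - 1)\<bar> < \<epsilon> / 2"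
      unfolding dist_real_def by blast
    show "\<exists>d>0. \<forall>a b. a \<le> x \<and> x \<le> b \<and> b - a < d \<longrightarrow> P a b"
    proof (intro exI conjI allI impI)
      show "0 < min d (s / 2)" using d st by simp
      fix a b assume ab: "a \<le> x \<and> x \<le> b \<and> b - a < min d (s / 2)"
      then have a: "0 < a" "a \<le> b" using x st by auto
      let ?F = "\<lambda>x. ennreal ((m * \<bar>u x\<bar> powr (m - 1) + \<epsilon>) * J x)"
      show "P a b"
      proof (cases "\<bar>H a\<bar> \<le> \<bar>H b\<bar>")
        case True
        then have "ennreal (\<bar>H a\<bar> powr m) \<le> ennreal (\<bar>H b\<bar> powr m)" using m by (intro ennreal_leI powr_mono2) auto
        then show ?thesis unfolding P_def by (rule order_trans) simp
      next
        case False
        let ?w = "m * \<bar>H a\<bar> powr (m - 1)"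
        have "\<bar>H a\<bar> powr m - \<bar>H b\<bar> powr m \<le> ?w * (\<bar>H a\<bar> - \<bar>H b\<bar>)"
          using False m by (intro powr_diff_le) auto
        also have "\<dots> \<le> ?w * \<bar>H b - H a\<bar>" using m by (intro mult_left_mono) auto
        finally have "\<bar>H a\<bar> powr m \<le> \<bar>H b\<bar> powr m + ?w * \<bar>H b - H a\<bar>" by simp
        then have "ennreal (\<bar>H a\<bar> powr m) \<le> ennreal (\<bar>H b\<bar> powr m + ?w * \<bar>H b - H a\<bar>)"
          by (rule ennreal_leI)
        also have "\<dots> = ennreal (\<bar>H b\<bar> powr m) + ennreal ?w * ennreal \<bar>H b - H a\<bar>"
          using m by (subst ennreal_plus) (auto simp: ennreal_mult)
        also have "ennreal ?w * ennreal \<bar>H b - H a\<bar> \<le> ennreal ?w * (\<integral>\<^sup>+x. ennreal (J x) * indicator {a<..b} (norm x) \<partial>lborel)"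
          by (intro mult_left_mono H_incr[OF a]) simp
        also have "\<dots> = (\<integral>\<^sup>+x. ennreal ?w * (ennreal (J x) * indicator {a<..b} (norm x)) \<partial>lborel)"
          by (rule nn_integral_cmult[symmetric]) measurable
        also have "\<dots> \<le> (\<integral>\<^sup>+x. ?F x * indicator {a<..b} (norm x) \<partial>lborel)"
        proof (rule nn_integral_mono_AE, use u_H in eventually_elim)
          case (elim z)
          show ?case
          proof (cases "norm z \<in> {a<..b}")
            case True
            have "?w \<le> m * \<bar>u z\<bar> powr (m - 1) + \<epsilon>"
            proof -
              have "\<bar>a - x\<bar> < d" "\<bar>norm z - x\<bar> < d" using True ab by (auto simp: abs_less_iff)
              from this[THEN d(2)] show ?thesis unfolding elim by linarith
            qed
            then have "?w * J z \<le> (m * \<bar>u z\<bar> powr (m - 1) + \<epsilon>) * J z"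
              by (intro mult_right_mono J_nonneg)
            then show ?thesis using True m J_nonneg[of z] by (simp add: ennreal_mult[symmetric] ennreal_leI)
          qed simp
        qed
        finally show ?thesis unfolding P_def by (simp add: add_left_mono)
      qed
    qed
  qed
  then have "ennreal (\<bar>H s\<bar> powr m) \<le> ennreal (\<bar>H t\<bar> powr m)
    + (\<integral>\<^sup>+x. ennreal ((m * \<bar>u x\<bar> powr (m - 1) + \<epsilon>) * J x) * indicator {s<..t} (norm x) \<partial>lborel)"
    unfolding P_def .
  also have "(\<integral>\<^sup>+x. ennreal ((m * \<bar>u x\<bar> powr (m - 1) + \<epsilon>) * J x) * indicator {s<..t} (norm x) \<partial>lborel)
    = (\<integral>\<^sup>+x. ennreal (m * \<bar>u x\<bar> powr (m - 1) * J x) * indicator {s<..t} (norm x) + ennreal \<epsilon> * (ennreal (J x) * indicator {s<..t} (norm x)) \<partial>lborel)"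
    using m \<epsilon> J_nonneg
    by (intro nn_integral_cong) (auto simp: distrib_right ennreal_mult[symmetric] split: split_indicator)
  also have "\<dots> = (\<integral>\<^sup>+x. ennreal (m * \<bar>u x\<bar> powr (m - 1) * J x) * indicator {s<..t} (norm x) \<partial>lborel)
     + ennreal \<epsilon> * (\<integral>\<^sup>+x. ennreal (J x) * indicator {s<..t} (norm x) \<partial>lborel)"
    by (simp add: nn_integral_add nn_integral_cmult)
  also have "\<dots> \<le> (\<integral>\<^sup>+x. ennreal (m * \<bar>u x\<bar> powr (m - 1) * J x) * indicator {s<..t} (norm x) \<partial>lborel) + ennreal e"
  proof (intro add_left_mono)
    have "ennreal \<epsilon> * (\<integral>\<^sup>+x. ennreal (J x) * indicator {s<..t} (norm x) \<partial>lborel) \<le> ennreal \<epsilon> * ennreal K"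
      by (intro mult_left_mono JK) simp
    also have "\<dots> = ennreal (\<epsilon> * K)" using \<epsilon> K by (simp add: ennreal_mult)
    also have "\<dots> \<le> ennreal e" using e K by (intro ennreal_leI) (simp add: \<epsilon>_def field_simps)
    finally show "ennreal \<epsilon> * (\<integral>\<^sup>+x. ennreal (J x) * indicator {s<..t} (norm x) \<partial>lborel) \<le> ennreal e" .
  qed
  finally show "ennreal (\<bar>H s\<bar> powr m) \<le> ennreal (\<bar>H t\<bar> powr m)
    + (\<integral>\<^sup>+x. ennreal (m * \<bar>u x\<bar> powr (m - 1) * J x) * indicator {s<..t} (norm x) \<partial>lborel) + ennreal e"
    by (simp add: add.assoc add_left_mono)
qed

end

lemma powr_mult_eq: "a + b = c \<Longrightarrow> (x::real) powr a * x powr b = x powr c"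
  by (auto simp: powr_add)

lemma powr_powr_eq: "a * b = c \<Longrightarrow> ((x::real) powr a) powr b = x powr c"
  by (auto simp: powr_powr)

lemma power2_powr_eq: "2 * a = c \<Longrightarrow> ((x::real) powr a)\<^sup>2 = x powr c"
  unfolding power2_eq_square by (rule powr_mult_eq) simp

locale radial_energy_bound = radial_gradient_bound u g H D
  for u g :: "'a::euclidean_space \<Rightarrow> real" and H :: "real \<Rightarrow> real" and D :: real +
  fixes b q Q :: real
  assumes b: "0 \<le> b" "b < 2" and q: "2 < q" and Q_nonneg: "0 \<le> Q"
    and uq: "(\<integral>\<^sup>+x. ennreal (\<bar>u x\<bar> powr q * norm x powr (- b)) \<partial>lborel) \<le> ennreal (Q powr q)"
begin

lemma n2: "2 \<le> real DIM('a)" using dim by simp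

text \<open>If \<open>\<bar>H\<bar>\<close> stayed above \<open>\<epsilon>\<close>, the annulus between the radii \<open>R\<close> and \<open>2 * R\<close> would contribute at least a multiple
  of \<open>R powr (N - b)\<close> to the weighted moment, and \<open>b < 2 \<le> N\<close>.\<close>
lemma H_decay:
  assumes s: "0 < s" and e: "0 < \<epsilon>"
  shows "\<exists>t>s. \<bar>H t\<bar> < \<epsilon>"
proof (rule ccontr)
  assume neg: "\<not> (\<exists>t>s. \<bar>H t\<bar> < \<epsilon>)"
  have large: "\<epsilon> \<le> \<bar>H t\<bar>" if "s < t" for t using neg that by (meson not_le)
  let ?w = "unit_ball_vol (real DIM('a))"
  have w: "0 < ?w" by (rule unit_ball_vol_pos) simp
  define c where "c = \<epsilon> powr q * 2 powr (- b) * ?w"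
  have c: "0 < c" using e w by (simp add: c_def)
  define R where "R = max s ((Q powr q / c + 1) powr (1 / (real DIM('a) - b)))"
  have R: "s \<le> R" "0 < R" using s by (auto simp: R_def)
  have "Q powr q / c + 1 = ((Q powr q / c + 1) powr (1 / (real DIM('a) - b))) powr (real DIM('a) - b)"
    using b n2 c Q_nonneg by (simp add: powr_powr add_nonneg_pos)
  also have "\<dots> \<le> R powr (real DIM('a) - b)"
    using b n2 by (intro powr_mono2) (auto simp: R_def)
  finally have big: "Q powr q < c * R powr (real DIM('a) - b)"
    using c by (simp add: field_simps)
  have "ennreal (c * R powr (real DIM('a) - b)) \<le> (\<integral>\<^sup>+x. ennreal (\<epsilon> powr q * (2 * R) powr (- b)) * indicator {x::'a. R < norm x \<and> norm x \<le> 2 * R} x \<partial>lborel)"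
  proof -
    have "1 * R ^ DIM('a) \<le> (2 ^ DIM('a) - 1) * R ^ DIM('a)"
      using R dim by (intro mult_right_mono) (auto simp: self_le_power le_diff_eq intro: order_trans[OF _ power_increasing[of 1 "DIM('a)" 2]])
    then have le: "R ^ DIM('a) \<le> (2 * R) ^ DIM('a) - R ^ DIM('a)"
      by (simp add: power_mult_distrib algebra_simps)
    have "c * R powr (real DIM('a) - b) = \<epsilon> powr q * (2 * R) powr (- b) * (?w * R ^ DIM('a))"
      using R by (simp add: c_def powr_mult powr_diff powr_minus powr_realpow field_simps)
    also have "\<dots> \<le> \<epsilon> powr q * (2 * R) powr (- b) * (?w * ((2 * R) ^ DIM('a) - R ^ DIM('a)))"
      using le w by (intro mult_left_mono) auto
    finally have "ennreal (c * R powr (real DIM('a) - b)) \<le> ennreal (\<epsilon> powr q * (2 * R) powr (- b)) * ennreal (?w * ((2 * R) ^ DIM('a) - R ^ DIM('a)))"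
      using le R w by (subst ennreal_mult[symmetric]) (auto intro: ennreal_leI order_trans[OF zero_le_power[of R]])
    also have "\<dots> = (\<integral>\<^sup>+x. ennreal (\<epsilon> powr q * (2 * R) powr (- b)) * indicator {x::'a. R < norm x \<and> norm x \<le> 2 * R} x \<partial>lborel)"
      using R by (subst nn_integral_cmult_indicator) (auto simp: emeasure_annulus)
    finally show ?thesis .
  qed
  also have "\<dots> \<le> (\<integral>\<^sup>+x. ennreal (\<bar>u x\<bar> powr q * norm x powr (- b)) \<partial>lborel)"
  proof (rule nn_integral_mono_AE, use u_H in eventually_elim)
    case (elim x)
    show ?case
    proof (cases "R < norm x \<and> norm x \<le> 2 * R")
      case True
      have "\<epsilon> powr q * (2 * R) powr (- b) \<le> \<bar>u x\<bar> powr q * norm x powr (- b)"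
        using True R e b q large[of "norm x"] unfolding elim by (intro mult_mono powr_mono2 powr_mono2') auto
      then show ?thesis using True by (simp add: ennreal_leI)
    qed simp
  qed
  also have "\<dots> \<le> ennreal (Q powr q)" by (rule uq)
  finally show False using big by (simp add: ennreal_le_iff)
qed

lemma H_powr_tail:
  assumes m: "1 < m" and s: "0 < s"
  shows "ennreal (\<bar>H s\<bar> powr m) \<le> (\<integral>\<^sup>+x. ennreal (m * \<bar>u x\<bar> powr (m - 1) * J x) * indicator {s<..} (norm x) \<partial>lborel)"
proof (rule ennreal_le_epsilon)
  fix e :: real assume e: "0 < e"
  obtain t where t: "s < t" "\<bar>H t\<bar> < e powr (1 / m)"
    using H_decay[OF s, of "e powr (1 / m)"] e by auto
  have "\<bar>H t\<bar> powr m \<le> (e powr (1 / m)) powr m" using t m by (intro powr_mono2) auto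
  also have "\<dots> = e" using e m by (simp add: powr_powr)
  finally have He: "ennreal (\<bar>H t\<bar> powr m) \<le> ennreal e" by (rule ennreal_leI)
  have "ennreal (\<bar>H s\<bar> powr m) \<le> ennreal (\<bar>H t\<bar> powr m)
    + (\<integral>\<^sup>+x. ennreal (m * \<bar>u x\<bar> powr (m - 1) * J x) * indicator {s<..t} (norm x) \<partial>lborel)"
    using t by (intro H_powr_chain m s) auto
  also have "\<dots> \<le> ennreal e + (\<integral>\<^sup>+x. ennreal (m * \<bar>u x\<bar> powr (m - 1) * J x) * indicator {s<..} (norm x) \<partial>lborel)"
    by (intro add_mono He nn_integral_mono) (auto split: split_indicator)
  finally show "ennreal (\<bar>H s\<bar> powr m) \<le> (\<integral>\<^sup>+x. ennreal (m * \<bar>u x\<bar> powr (m - 1) * J x) * indicator {s<..} (norm x) \<partial>lborel) + ennreal e"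
    by (simp add: add.commute)
qed

lemma H_tail:
  assumes s: "0 < s"
  shows "ennreal \<bar>H s\<bar> \<le> (\<integral>\<^sup>+x. ennreal (J x) * indicator {s<..} (norm x) \<partial>lborel)"
proof (rule ennreal_le_epsilon)
  fix e :: real assume e: "0 < e"
  obtain t where t: "s < t" "\<bar>H t\<bar> < e"
    using H_decay[OF s e] by auto
  have "\<bar>H s\<bar> \<le> e + \<bar>H t - H s\<bar>" using t by linarith
  then have "ennreal \<bar>H s\<bar> \<le> ennreal (e + \<bar>H t - H s\<bar>)" by (rule ennreal_leI)
  also have "\<dots> = ennreal e + ennreal \<bar>H t - H s\<bar>" using e by (simp add: ennreal_plus)
  also have "\<dots> \<le> ennreal e + (\<integral>\<^sup>+x. ennreal (J x) * indicator {s<..t} (norm x) \<partial>lborel)"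
    using t s by (intro add_left_mono H_incr) auto
  also have "\<dots> \<le> ennreal e + (\<integral>\<^sup>+x. ennreal (J x) * indicator {s<..} (norm x) \<partial>lborel)"
    by (intro add_left_mono nn_integral_mono) (auto split: split_indicator)
  finally show "ennreal \<bar>H s\<bar> \<le> (\<integral>\<^sup>+x. ennreal (J x) * indicator {s<..} (norm x) \<partial>lborel) + ennreal e"
    by (simp add: add.commute)
qed

lemma AE_nonzero: "AE x::'a in lborel. x \<noteq> 0"
  by (rule AE_lborel_singleton)

text \<open>A vanishing gradient makes the profile constant, and a constant that comes close to \<open>0\<close> at infinity is \<open>0\<close>.\<close>
lemma u_zero_if_degenerate:
  assumes "D = 0 \<or> Q = 0"
  shows "AE x in lborel. u x = 0"
  using assms
proof
  assume "Q = 0"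
  then have "(\<integral>\<^sup>+x. ennreal (\<bar>u x\<bar> powr q * norm x powr (- b)) \<partial>lborel) = 0" using uq by simp
  then have "AE x in lborel. ennreal (\<bar>u x\<bar> powr q * norm x powr (- b)) = 0"
    by (subst (asm) nn_integral_0_iff_AE) auto
  with AE_nonzero show ?thesis
  proof eventually_elim
    case (elim x)
    show ?case
    proof (rule ccontr)
      assume "u x \<noteq> 0"
      then have "0 < \<bar>u x\<bar> powr q * norm x powr (- b)" using elim by simp
      then show False using elim by (simp add: ennreal_eq_0_iff)
    qed
  qed
next
  assume "D = 0"
  then have "(\<integral>\<^sup>+x. ennreal ((g x)\<^sup>2) \<partial>lborel) = 0" using g2 by simp
  then have "AE x in lborel. ennreal ((g x)\<^sup>2) = 0"
    by (subst (asm) nn_integral_0_iff_AE) auto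
  then have J0: "AE x in lborel. J x = 0"
    by eventually_elim (auto simp: J_def ennreal_eq_0_iff)
  have H0: "H s = 0" if "0 < s" for s
  proof -
    have "AE x in lborel. ennreal (J x) * indicator {s<..} (norm x) = 0"
      using J0 by eventually_elim simp
    then have "(\<integral>\<^sup>+x. ennreal (J x) * indicator {s<..} (norm x) \<partial>lborel) = 0"
      by (subst nn_integral_0_iff_AE) auto
    then show ?thesis using H_tail[OF that] by (simp add: ennreal_eq_0_iff)
  qed
  from u_H AE_nonzero show ?thesis by eventually_elim (simp add: H0)
qed

lemma weighted_Cauchy_Schwarz:
  assumes "0 \<le> B" "(\<integral>\<^sup>+x. ennreal (\<bar>u x\<bar> powr p * norm x powr (- c)) \<partial>lborel) \<le> ennreal (B\<^sup>2)"
  shows "(\<integral>\<^sup>+x. ennreal (g x * (\<bar>u x\<bar> powr (p / 2) * norm x powr (- c / 2))) \<partial>lborel) \<le> ennreal (D * B)"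
proof (rule g_Cauchy_Schwarz)
  have "(\<bar>u x\<bar> powr (p / 2) * norm x powr (- c / 2))\<^sup>2 = \<bar>u x\<bar> powr p * norm x powr (- c)" for x
    by (simp add: power_mult_distrib power2_powr_eq[where c = p] power2_powr_eq[where c = "- c"])
  then show "(\<integral>\<^sup>+x. ennreal ((\<bar>u x\<bar> powr (p / 2) * norm x powr (- c / 2))\<^sup>2) \<partial>lborel) \<le> ennreal (B\<^sup>2)"
    using assms by simp
qed (use assms in auto)

text \<open>In \<open>H_powr_tail\<close> the Cauchy-Schwarz inequality separates \<open>g\<close> from the weighted \<open>p\<close>-th moment; the remaining
  power of \<open>norm x\<close> is decreasing and therefore at most its value at the radius \<open>s\<close>.\<close>
lemma H_powr_pointwise:
  assumes p: "0 < p" and c: "c \<le> 2 * real DIM('a) - 2" and s: "0 < s" and B: "0 \<le> B"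
    and Ip: "(\<integral>\<^sup>+x. ennreal (\<bar>u x\<bar> powr p * norm x powr (- c)) \<partial>lborel) \<le> ennreal (B\<^sup>2)"
  shows "\<bar>H s\<bar> powr ((p + 2) / 2) \<le> (p + 2) / 2 * (D * B) * s powr (- (real DIM('a) - 1 - c / 2))"
proof -
  let ?m = "(p + 2) / 2" and ?e = "- (real DIM('a) - 1 - c / 2)"
  have m1: "?m - 1 = p / 2" by (simp add: field_simps)
  have "ennreal (\<bar>H s\<bar> powr ?m) \<le> (\<integral>\<^sup>+x. ennreal (?m * \<bar>u x\<bar> powr (?m - 1) * J x) * indicator {s<..} (norm x) \<partial>lborel)"
    using p s by (intro H_powr_tail) auto
  also have "\<dots> \<le> (\<integral>\<^sup>+x. ennreal (?m * s powr ?e) * ennreal (g x * (\<bar>u x\<bar> powr (p / 2) * norm x powr (- c / 2))) \<partial>lborel)"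
  proof (rule nn_integral_mono)
    fix x
    show "ennreal (?m * \<bar>u x\<bar> powr (?m - 1) * J x) * indicator {s<..} (norm x)
      \<le> ennreal (?m * s powr ?e) * ennreal (g x * (\<bar>u x\<bar> powr (p / 2) * norm x powr (- c / 2)))"
    proof (cases "s < norm x")
      case True
      have "norm x powr (1 - real DIM('a)) = norm x powr ?e * norm x powr (- c / 2)"
        by (simp add: powr_add[symmetric])
      moreover have "norm x powr ?e \<le> s powr ?e" using True s c by (intro powr_mono2') auto
      ultimately have "norm x powr (1 - real DIM('a)) \<le> s powr ?e * norm x powr (- c / 2)"
        by (simp add: mult_right_mono)
      then have "(?m * \<bar>u x\<bar> powr (p / 2) * g x) * norm x powr (1 - real DIM('a)) \<le> (?m * \<bar>u x\<bar> powr (p / 2) * g x) * (s powr ?e * norm x powr (- c / 2))"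
        using p g_nonneg[of x] by (intro mult_left_mono) auto
      then have "?m * \<bar>u x\<bar> powr (?m - 1) * J x \<le> (?m * s powr ?e) * (g x * (\<bar>u x\<bar> powr (p / 2) * norm x powr (- c / 2)))"
        unfolding m1 J_def by (simp only: mult_ac)
      then show ?thesis using True p g_nonneg[of x] by (subst ennreal_mult[symmetric]) (auto intro: ennreal_leI)
    qed simp
  qed
  also have "\<dots> = ennreal (?m * s powr ?e) * (\<integral>\<^sup>+x. ennreal (g x * (\<bar>u x\<bar> powr (p / 2) * norm x powr (- c / 2))) \<partial>lborel)"
    by (rule nn_integral_cmult) measurable
  also have "\<dots> \<le> ennreal (?m * s powr ?e) * ennreal (D * B)"
    by (intro mult_left_mono weighted_Cauchy_Schwarz B Ip) simp
  also have "\<dots> = ennreal (?m * (D * B) * s powr ?e)"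
    using p D_nonneg B by (subst ennreal_mult[symmetric]) (auto simp: mult_ac)
  finally show ?thesis using p D_nonneg B by (subst (asm) ennreal_le_iff) auto
qed

lemma radial_bound:
  assumes s: "0 < s"
  shows "\<bar>H s\<bar> \<le> ((q + 2) / 2 * D * Q powr (q / 2)) powr (2 / (q + 2)) * s powr (- ((2 * real DIM('a) - 2 - b) / (q + 2)))"
proof -
  let ?m = "(q + 2) / 2"
  have Q2: "(Q powr (q / 2))\<^sup>2 = Q powr q" by (simp add: power2_eq_square powr_add[symmetric])
  have "\<bar>H s\<bar> powr ?m \<le> ?m * (D * Q powr (q / 2)) * s powr (- (real DIM('a) - 1 - b / 2))"
    using q b n2 s uq by (intro H_powr_pointwise) (auto simp: Q2)
  then have "(\<bar>H s\<bar> powr ?m) powr (2 / (q + 2)) \<le> (?m * (D * Q powr (q / 2)) * s powr (- (real DIM('a) - 1 - b / 2))) powr (2 / (q + 2))"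
    using q by (intro powr_mono2) auto
  also have "(\<bar>H s\<bar> powr ?m) powr (2 / (q + 2)) = \<bar>H s\<bar>"
    using q powr_powr_eq[of ?m "2 / (q + 2)" 1 "\<bar>H s\<bar>"] by simp
  also have "(?m * (D * Q powr (q / 2)) * s powr (- (real DIM('a) - 1 - b / 2))) powr (2 / (q + 2))
     = (?m * (D * Q powr (q / 2))) powr (2 / (q + 2)) * (s powr (- (real DIM('a) - 1 - b / 2))) powr (2 / (q + 2))"
    by (rule powr_mult)
  also have "(s powr (- (real DIM('a) - 1 - b / 2))) powr (2 / (q + 2)) = s powr (- ((2 * real DIM('a) - 2 - b) / (q + 2)))"
    using q by (intro powr_powr_eq) (simp add: field_simps)
  finally show ?thesis by (simp add: mult.assoc)
qed

text \<open>Split \<open>\<bar>u\<bar> powr r * norm x powr (- \<eta>)\<close> into \<open>\<bar>u\<bar> powr q * norm x powr (- b)\<close> and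
  \<open>\<bar>u\<bar> powr (r - q) * norm x powr (b - \<eta>)\<close>.  The exponent \<open>r\<close> is the one for which \<open>radial_bound\<close> bounds the second
  factor by a constant.\<close>
lemma lower_endpoint:
  assumes \<eta>: "\<eta> \<le> b" and D: "0 < D" and Q: "0 < Q"
    and r: "r = q + (q + 2) * (b - \<eta>) / (2 * real DIM('a) - 2 - b)" and \<alpha>: "\<alpha> = 2 * (r - q) / (q + 2)"
  shows "(\<integral>\<^sup>+x. ennreal (\<bar>u x\<bar> powr r * norm x powr (- \<eta>)) \<partial>lborel)
    \<le> ennreal (((q + 2) / 2) powr \<alpha> * D powr \<alpha> * Q powr (r - \<alpha>))"
proof -
  define A where "A = (q + 2) / 2 * D * Q powr (q / 2)"
  define \<kappa> where "\<kappa> = (2 * real DIM('a) - 2 - b) / (q + 2)"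
  have den: "0 < 2 * real DIM('a) - 2 - b" using b n2 by linarith
  have rq: "0 \<le> r - q" using \<eta> den q by (simp add: r)
  have \<kappa>r: "\<kappa> * (r - q) = b - \<eta>" using den q by (simp add: \<kappa>_def r)
  have A: "0 < A" using q D Q by (simp add: A_def)
  have "(\<integral>\<^sup>+x. ennreal (\<bar>u x\<bar> powr r * norm x powr (- \<eta>)) \<partial>lborel)
    \<le> (\<integral>\<^sup>+x. ennreal (A powr \<alpha>) * ennreal (\<bar>u x\<bar> powr q * norm x powr (- b)) \<partial>lborel)"
  proof (rule nn_integral_mono_AE, use u_H AE_nonzero in eventually_elim)
    case (elim x)
    have "\<bar>u x\<bar> powr r * norm x powr (- \<eta>) \<le> A powr \<alpha> * (\<bar>u x\<bar> powr q * norm x powr (- b))"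
    proof (cases "u x = 0")
      case False
      have "\<bar>u x\<bar> powr (r - q) \<le> (A powr (2 / (q + 2)) * norm x powr (- \<kappa>)) powr (r - q)"
        using elim radial_bound[of "norm x"] rq by (intro powr_mono2) (auto simp: A_def \<kappa>_def)
      also have "\<dots> = (A powr (2 / (q + 2))) powr (r - q) * (norm x powr (- \<kappa>)) powr (r - q)"
        by (rule powr_mult)
      also have "(A powr (2 / (q + 2))) powr (r - q) = A powr \<alpha>"
        by (simp add: powr_powr \<alpha>)
      also have "(norm x powr (- \<kappa>)) powr (r - q) = norm x powr (\<eta> - b)"
        using \<kappa>r by (simp add: powr_powr)
      finally have "\<bar>u x\<bar> powr (r - q) \<le> A powr \<alpha> * norm x powr (\<eta> - b)" .
      then have "(\<bar>u x\<bar> powr q * norm x powr (- \<eta>)) * \<bar>u x\<bar> powr (r - q) \<le> (\<bar>u x\<bar> powr q * norm x powr (- \<eta>)) * (A powr \<alpha> * norm x powr (\<eta> - b))"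
        by (intro mult_left_mono) auto
      moreover have "\<bar>u x\<bar> powr r = \<bar>u x\<bar> powr q * \<bar>u x\<bar> powr (r - q)"
        by (simp add: powr_add[symmetric])
      moreover have "norm x powr (- b) = norm x powr (- \<eta>) * norm x powr (\<eta> - b)"
        by (simp add: powr_add[symmetric])
      ultimately show ?thesis by (simp add: mult_ac)
    qed simp
    then show ?case by (simp add: ennreal_mult[symmetric] ennreal_leI)
  qed
  also have "\<dots> = ennreal (A powr \<alpha>) * (\<integral>\<^sup>+x. ennreal (\<bar>u x\<bar> powr q * norm x powr (- b)) \<partial>lborel)"
    by (rule nn_integral_cmult) measurable
  also have "\<dots> \<le> ennreal (A powr \<alpha>) * ennreal (Q powr q)" by (intro mult_left_mono uq) simp
  also have "\<dots> = ennreal (A powr \<alpha> * Q powr q)" by (simp add: ennreal_mult)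
  also have "A powr \<alpha> * Q powr q = ((q + 2) / 2) powr \<alpha> * D powr \<alpha> * Q powr (r - \<alpha>)"
  proof -
    have "A powr \<alpha> = ((q + 2) / 2) powr \<alpha> * D powr \<alpha> * (Q powr (q / 2)) powr \<alpha>"
      by (simp only: A_def powr_mult)
    also have "(Q powr (q / 2)) powr \<alpha> = Q powr (q / 2 * \<alpha>)" by (rule powr_powr)
    finally have "A powr \<alpha> * Q powr q = ((q + 2) / 2) powr \<alpha> * D powr \<alpha> * Q powr (q / 2 * \<alpha> + q)"
      by (simp add: powr_add mult.assoc)
    moreover have "q / 2 * \<alpha> + q = r - \<alpha>" using q by (simp add: \<alpha> field_simps)
    ultimately show ?thesis by simp
  qed
  finally show ?thesis .
qed

lemma H_sup_bound:
  assumes n3: "2 < real DIM('a)" and s: "0 < s"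
  shows "\<bar>H s\<bar> \<le> D * sqrt (sphere_area DIM('a) / (real DIM('a) - 2)) * s powr (- ((real DIM('a) - 2) / 2))"
proof -
  let ?B = "sqrt (sphere_area DIM('a) / (real DIM('a) - 2)) * s powr (- ((real DIM('a) - 2) / 2))"
  have \<sigma>: "0 < sphere_area DIM('a)" by (rule sphere_area_pos)
  have "ennreal \<bar>H s\<bar> \<le> (\<integral>\<^sup>+x. ennreal (J x) * indicator {s<..} (norm x) \<partial>lborel)" by (rule H_tail[OF s])
  also have "\<dots> = (\<integral>\<^sup>+x. ennreal (g x * (norm x powr (1 - real DIM('a)) * indicator {s<..} (norm x))) \<partial>lborel)"
    by (intro nn_integral_cong) (auto simp: J_def split: split_indicator)
  also have "\<dots> \<le> ennreal (D * ?B)"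
  proof (rule g_Cauchy_Schwarz)
    have sq: "(norm (x::'a) powr (1 - real DIM('a)))\<^sup>2 = norm x powr (- (2 * real DIM('a) - 2))" for x
      by (simp add: power2_eq_square powr_add[symmetric])
    have "(\<integral>\<^sup>+x. ennreal ((norm (x::'a) powr (1 - real DIM('a)) * indicator {s<..} (norm x))\<^sup>2) \<partial>lborel)
      = (\<integral>\<^sup>+x. ennreal (norm (x::'a) powr (- (2 * real DIM('a) - 2))) * indicator {s<..} (norm x) \<partial>lborel)"
      by (intro nn_integral_cong) (auto simp: power_mult_distrib sq split: split_indicator)
    also have "\<dots> \<le> ennreal (sphere_area DIM('a) / (2 * real DIM('a) - 2 - real DIM('a)) * s powr (real DIM('a) - (2 * real DIM('a) - 2)))"
      using n3 s by (intro nn_integral_norm_powr_outside) auto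
    also have "sphere_area DIM('a) / (2 * real DIM('a) - 2 - real DIM('a)) * s powr (real DIM('a) - (2 * real DIM('a) - 2)) = ?B\<^sup>2"
      using n3 \<sigma> by (simp add: power_mult_distrib power2_eq_square[of "s powr _"] powr_add[symmetric])
    finally show "(\<integral>\<^sup>+x. ennreal ((norm (x::'a) powr (1 - real DIM('a)) * indicator {s<..} (norm x))\<^sup>2) \<partial>lborel) \<le> ennreal (?B\<^sup>2)" .
  qed (use n3 \<sigma> in auto)
  finally show ?thesis using n3 \<sigma> D_nonneg by (subst (asm) ennreal_le_iff) (auto simp: mult.assoc)
qed

text \<open>The profile is bounded by the tail of \<open>J\<close>, to which the Cauchy-Schwarz inequality is applied with an auxiliary
  power of \<open>norm x\<close>.  In contrast to an integration by parts this does not presuppose that the left-hand side is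
  finite.\<close>
lemma hardy:
  assumes n3: "2 < real DIM('a)"
  shows "(\<integral>\<^sup>+x. ennreal (\<bar>u x\<bar>\<^sup>2 * norm x powr (- 2)) \<partial>lborel) \<le> ennreal ((2 * sphere_area DIM('a) / (real DIM('a) - 2))\<^sup>2 * D\<^sup>2)"
proof -
  (* Any \<delta> strictly between 0 and N - 2 makes both power integrals converge; this one makes them equal. *)
  define \<delta> where "\<delta> = (real DIM('a) - 2) / 2"
  have \<delta>: "0 < \<delta>" using n3 by (simp add: \<delta>_def)
  define c where "c = sphere_area DIM('a) / \<delta>"
  have c: "0 < c" using sphere_area_pos[where 'a = 'a] \<delta> by (simp add: c_def)
  define k where "k y = ennreal ((g y)\<^sup>2 * norm y powr (2 - real DIM('a) + \<delta>))" for y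
  have [measurable]: "k \<in> borel_measurable borel" unfolding k_def[abs_def] by measurable
  have H2: "ennreal (\<bar>H s\<bar>\<^sup>2) \<le> ennreal (c * s powr (- \<delta>)) * (\<integral>\<^sup>+y. k y * indicator {s<..} (norm y) \<partial>lborel)" if s: "0 < s" for s
  proof -
    let ?f = "\<lambda>x::'a. ennreal (norm x powr (- (real DIM('a) + \<delta>) / 2)) * indicator {s<..} (norm x)"
    let ?h = "\<lambda>x. ennreal (g x * norm x powr (1 - real DIM('a) + (real DIM('a) + \<delta>) / 2)) * indicator {s<..} (norm x)"
    have "ennreal (\<bar>H s\<bar>\<^sup>2) = (ennreal \<bar>H s\<bar>)\<^sup>2" by (simp add: ennreal_power)
    also have "\<dots> \<le> (\<integral>\<^sup>+x. ennreal (J x) * indicator {s<..} (norm x) \<partial>lborel)\<^sup>2"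
      by (intro power_mono H_tail s) simp
    also have "(\<integral>\<^sup>+x. ennreal (J x) * indicator {s<..} (norm x) \<partial>lborel) = (\<integral>\<^sup>+x. ?f x * ?h x \<partial>lborel)"
    proof (intro nn_integral_cong)
      fix x :: 'a
      have "norm x powr (1 - real DIM('a)) = norm x powr (- (real DIM('a) + \<delta>) / 2) * norm x powr (1 - real DIM('a) + (real DIM('a) + \<delta>) / 2)"
        by (rule powr_mult_eq[symmetric]) (simp add: field_simps)
      then have "J x = norm x powr (- (real DIM('a) + \<delta>) / 2) * (g x * norm x powr (1 - real DIM('a) + (real DIM('a) + \<delta>) / 2))"
        by (simp add: J_def)
      then show "ennreal (J x) * indicator {s<..} (norm x) = ?f x * ?h x"
        by (auto simp: ennreal_mult g_nonneg split: split_indicator)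
    qed
    also have "(\<integral>\<^sup>+x. ?f x * ?h x \<partial>lborel)\<^sup>2 \<le> (\<integral>\<^sup>+x. ?f x ^ 2 \<partial>lborel) * (\<integral>\<^sup>+x. ?h x ^ 2 \<partial>lborel)"
      by (rule Cauchy_Schwarz_nn_integral) measurable
    also have "(\<integral>\<^sup>+x. ?f x ^ 2 \<partial>lborel) = (\<integral>\<^sup>+x. ennreal (norm (x::'a) powr (- (real DIM('a) + \<delta>))) * indicator {s<..} (norm x) \<partial>lborel)"
    proof (intro nn_integral_cong)
      fix x :: 'a
      have "(norm x powr (- (real DIM('a) + \<delta>) / 2))\<^sup>2 = norm x powr (- (real DIM('a) + \<delta>))"
        by (rule power2_powr_eq) (simp add: field_simps)
      then show "?f x ^ 2 = ennreal (norm x powr (- (real DIM('a) + \<delta>))) * indicator {s<..} (norm x)"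
        by (simp add: power_mult_distrib ennreal_power indicator_def)
    qed
    also have "(\<integral>\<^sup>+x. ?h x ^ 2 \<partial>lborel) = (\<integral>\<^sup>+y. k y * indicator {s<..} (norm y) \<partial>lborel)"
    proof (intro nn_integral_cong)
      fix x :: 'a
      have "(norm x powr (1 - real DIM('a) + (real DIM('a) + \<delta>) / 2))\<^sup>2 = norm x powr (2 - real DIM('a) + \<delta>)"
        by (rule power2_powr_eq) (simp add: field_simps)
      then show "?h x ^ 2 = k x * indicator {s<..} (norm x)"
        by (simp add: power_mult_distrib ennreal_power indicator_def k_def g_nonneg)
    qed
    also have "(\<integral>\<^sup>+x. ennreal (norm (x::'a) powr (- (real DIM('a) + \<delta>))) * indicator {s<..} (norm x) \<partial>lborel) \<le> ennreal (sphere_area DIM('a) / (real DIM('a) + \<delta> - real DIM('a)) * s powr (real DIM('a) - (real DIM('a) + \<delta>)))"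
      using \<delta> s by (intro nn_integral_norm_powr_outside) auto
    also have "sphere_area DIM('a) / (real DIM('a) + \<delta> - real DIM('a)) * s powr (real DIM('a) - (real DIM('a) + \<delta>)) = c * s powr (- \<delta>)" by (simp add: c_def)
    finally show ?thesis by (simp add: mult_right_mono)
  qed
  have "(\<integral>\<^sup>+x. ennreal (\<bar>u x\<bar>\<^sup>2 * norm x powr (- 2)) \<partial>lborel)
     \<le> (\<integral>\<^sup>+x. ennreal c * (ennreal (norm (x::'a) powr (- (2 + \<delta>))) * (\<integral>\<^sup>+y. k y * indicator {norm x<..} (norm y) \<partial>lborel)) \<partial>lborel)"
  proof (rule nn_integral_mono_AE, use u_H AE_nonzero in eventually_elim)
    case (elim x)
    have "ennreal (\<bar>u x\<bar>\<^sup>2 * norm x powr (- 2)) = ennreal (\<bar>H (norm x)\<bar>\<^sup>2) * ennreal (norm x powr (- 2))"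
      using elim by (simp add: ennreal_mult)
    also have "\<dots> \<le> ennreal (c * norm x powr (- \<delta>)) * (\<integral>\<^sup>+y. k y * indicator {norm x<..} (norm y) \<partial>lborel) * ennreal (norm x powr (- 2))"
      using elim by (intro mult_right_mono H2) auto
    also have "\<dots> = ennreal (c * norm x powr (- \<delta>) * norm x powr (- 2)) * (\<integral>\<^sup>+y. k y * indicator {norm x<..} (norm y) \<partial>lborel)"
      using c by (subst (2) ennreal_mult) (auto simp: mult_ac)
    also have "c * norm x powr (- \<delta>) * norm x powr (- 2) = c * norm x powr (- (2 + \<delta>))"
      unfolding mult.assoc by (rule arg_cong[OF powr_mult_eq]) simp
    finally show ?case using c by (simp add: ennreal_mult mult.assoc)
  qed
  also have "\<dots> = ennreal c * (\<integral>\<^sup>+x. ennreal (norm (x::'a) powr (- (2 + \<delta>))) * (\<integral>\<^sup>+y. k y * indicator {norm x<..} (norm y) \<partial>lborel) \<partial>lborel)"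
    by (rule nn_integral_cmult) (simp add: indicator_def)
  also have "\<dots> \<le> ennreal c * (ennreal (sphere_area DIM('a) / (real DIM('a) - (2 + \<delta>))) * (\<integral>\<^sup>+y. k y * ennreal (norm y powr (real DIM('a) - (2 + \<delta>))) \<partial>lborel))"
    using n3 by (intro mult_left_mono nn_integral_norm_powr_tail) (auto simp: \<delta>_def field_simps)
  also have "real DIM('a) - (2 + \<delta>) = \<delta>" by (simp add: \<delta>_def field_simps)
  also have "(\<integral>\<^sup>+y. k y * ennreal (norm y powr \<delta>) \<partial>lborel) = (\<integral>\<^sup>+y. ennreal ((g y)\<^sup>2) \<partial>lborel)"
  proof (rule nn_integral_cong_AE, use AE_nonzero in eventually_elim)
    case (elim y)
    have "norm y powr (2 - real DIM('a) + \<delta>) * norm y powr \<delta> = 1"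
      using elim by (simp add: powr_add[symmetric] \<delta>_def field_simps)
    then show ?case by (simp add: k_def ennreal_mult[symmetric] mult.assoc)
  qed
  also have "ennreal c * (ennreal (sphere_area DIM('a) / \<delta>) * (\<integral>\<^sup>+y. ennreal ((g y)\<^sup>2) \<partial>lborel)) \<le> ennreal c * (ennreal c * ennreal (D\<^sup>2))"
    unfolding c_def[symmetric] by (intro mult_left_mono g2) simp_all
  also have "\<dots> = ennreal ((2 * sphere_area DIM('a) / (real DIM('a) - 2))\<^sup>2 * D\<^sup>2)"
  proof -
    have "2 * sphere_area DIM('a) / (real DIM('a) - 2) = c" by (simp add: c_def \<delta>_def)
    then show ?thesis using c by (simp add: ennreal_mult[symmetric] power2_eq_square mult.assoc)
  qed
  finally show ?thesis .
qed

end

section \<open>Endpoint inequalities and interpolation\<close>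

context radial_energy_bound
begin

text \<open>Split off \<open>\<bar>u\<bar>\<^sup>2 * norm x powr (- 2)\<close>, which Hardy's inequality controls.  At the critical exponent the remaining
  factor is a power of \<open>\<bar>u\<bar> * norm x powr ((N - 2) / 2)\<close>, which \<open>H_sup_bound\<close> controls.\<close>
lemma upper_endpoint:
  assumes n3: "2 < real DIM('a)" and \<eta>: "\<eta> < 2" and r: "r = 2 * (real DIM('a) - \<eta>) / (real DIM('a) - 2)" and D: "0 < D"
  shows "(\<integral>\<^sup>+x. ennreal (\<bar>u x\<bar> powr r * norm x powr (- \<eta>)) \<partial>lborel)
    \<le> ennreal (sqrt (sphere_area DIM('a) / (real DIM('a) - 2)) powr (r - 2) * (2 * sphere_area DIM('a) / (real DIM('a) - 2))\<^sup>2 * D powr r)"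
proof -
  define c where "c = sqrt (sphere_area DIM('a) / (real DIM('a) - 2))"
  define C where "C = (2 * sphere_area DIM('a) / (real DIM('a) - 2))\<^sup>2"
  have c: "0 < c" using n3 sphere_area_pos[where 'a = 'a] by (simp add: c_def)
  have C: "0 \<le> C" by (simp add: C_def)
  have r2: "r - 2 = 2 * (2 - \<eta>) / (real DIM('a) - 2)" using n3 by (simp add: r field_simps)
  then have rpos: "0 \<le> r - 2" using n3 \<eta> by simp
  have e: "- ((real DIM('a) - 2) / 2) * (r - 2) = \<eta> - 2"
  proof -
    have e1: "(real DIM('a) - 2) * (r - 2) = 2 * (2 - \<eta>)" using n3 by (simp add: r2)
    have "- ((real DIM('a) - 2) / 2) * (r - 2) = - (((real DIM('a) - 2) * (r - 2)) / 2)"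
      by (simp only: minus_mult_left[symmetric] times_divide_eq_left)
    also have "\<dots> = \<eta> - 2" unfolding e1 by (simp add: field_simps)
    finally show ?thesis .
  qed
  have "(\<integral>\<^sup>+x. ennreal (\<bar>u x\<bar> powr r * norm x powr (- \<eta>)) \<partial>lborel)
    \<le> (\<integral>\<^sup>+x. ennreal ((c * D) powr (r - 2)) * ennreal (\<bar>u x\<bar>\<^sup>2 * norm x powr (- 2)) \<partial>lborel)"
  proof (rule nn_integral_mono_AE, use u_H AE_nonzero in eventually_elim)
    case (elim x)
    have "\<bar>u x\<bar> powr r * norm x powr (- \<eta>) \<le> (c * D) powr (r - 2) * (\<bar>u x\<bar>\<^sup>2 * norm x powr (- 2))"
    proof (cases "u x = 0")
      case False
      have "\<bar>u x\<bar> powr (r - 2) \<le> (c * D * norm x powr (- ((real DIM('a) - 2) / 2))) powr (r - 2)"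
        using elim H_sup_bound[OF n3, of "norm x"] rpos by (intro powr_mono2) (auto simp: c_def mult.commute)
      also have "\<dots> = (c * D) powr (r - 2) * norm x powr (\<eta> - 2)"
        using powr_powr_eq[OF e, of "norm x"] by (simp add: powr_mult)
      finally have "(\<bar>u x\<bar>\<^sup>2 * norm x powr (- \<eta>)) * \<bar>u x\<bar> powr (r - 2) \<le> (\<bar>u x\<bar>\<^sup>2 * norm x powr (- \<eta>)) * ((c * D) powr (r - 2) * norm x powr (\<eta> - 2))"
        by (intro mult_left_mono) auto
      moreover have "\<bar>u x\<bar> powr r = \<bar>u x\<bar>\<^sup>2 * \<bar>u x\<bar> powr (r - 2)"
        using powr_mult_eq[of 2 "r - 2" r "\<bar>u x\<bar>"] False by simp
      moreover have "norm x powr (- 2) = norm x powr (- \<eta>) * norm x powr (\<eta> - 2)"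
        by (rule powr_mult_eq[symmetric]) simp
      ultimately show ?thesis by (simp add: mult_ac)
    qed simp
    then show ?case by (simp add: ennreal_mult[symmetric] ennreal_leI)
  qed
  also have "\<dots> = ennreal ((c * D) powr (r - 2)) * (\<integral>\<^sup>+x. ennreal (\<bar>u x\<bar>\<^sup>2 * norm x powr (- 2)) \<partial>lborel)"
    by (rule nn_integral_cmult) measurable
  also have "\<dots> \<le> ennreal ((c * D) powr (r - 2)) * ennreal (C * D\<^sup>2)"
    unfolding C_def by (intro mult_left_mono hardy n3) simp
  also have "\<dots> = ennreal (c powr (r - 2) * C * D powr r)"
  proof -
    have "D powr r = D\<^sup>2 * D powr (r - 2)" using powr_mult_eq[of 2 "r - 2" r D] D by simp
    then have "(c * D) powr (r - 2) * (C * D\<^sup>2) = c powr (r - 2) * C * D powr r"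
      by (simp add: powr_mult)
    then show ?thesis using C by (subst ennreal_mult[symmetric]) auto
  qed
  finally show ?thesis by (simp add: c_def C_def)
qed

text \<open>The tail estimate with exponent \<open>p + 2\<close>, integrated with the weight, leaves the integral of
  \<open>\<bar>u\<bar> powr (p + 1) * g * norm x powr (1 - \<eta>)\<close>.  Of this, \<open>\<bar>u\<bar> powr ((p + 2) / 2) * norm x powr (1 - \<eta> / 2)\<close> is bounded
  by \<open>H_powr_pointwise\<close>, and the Cauchy-Schwarz inequality takes care of the rest.\<close>
lemma planar_step:
  assumes n2: "DIM('a) = 2" and \<eta>: "\<eta> < 2" and p: "0 < p" and B: "0 \<le> B"
    and Ip: "(\<integral>\<^sup>+x. ennreal (\<bar>u x\<bar> powr p * norm x powr (- \<eta>)) \<partial>lborel) \<le> ennreal (B\<^sup>2)"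
  shows "(\<integral>\<^sup>+x. ennreal (\<bar>u x\<bar> powr (p + 2) * norm x powr (- \<eta>)) \<partial>lborel)
    \<le> ennreal (sphere_area DIM('a) / (2 - \<eta>) * (p + 2) * ((p + 2) / 2) * D\<^sup>2 * B\<^sup>2)"
proof -
  define m where "m = (p + 2) / 2"
  define K where "K = m * (D * B)"
  have K: "0 \<le> K" using p B D_nonneg by (simp add: K_def m_def)
  have ptw: "\<bar>H s\<bar> powr m \<le> K * s powr (- (1 - \<eta> / 2))" if "0 < s" for s
    using H_powr_pointwise[OF p _ that B Ip] n2 \<eta> by (simp add: m_def K_def)
  define k where "k y = ennreal ((p + 2) * \<bar>u y\<bar> powr (p + 1) * J y)" for y
  have [measurable]: "k \<in> borel_measurable borel" unfolding k_def[abs_def] by measurable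
  have "(\<integral>\<^sup>+x. ennreal (\<bar>u x\<bar> powr (p + 2) * norm x powr (- \<eta>)) \<partial>lborel)
    \<le> (\<integral>\<^sup>+x. ennreal (norm (x::'a) powr (- \<eta>)) * (\<integral>\<^sup>+y. k y * indicator {norm x<..} (norm y) \<partial>lborel) \<partial>lborel)"
  proof (rule nn_integral_mono_AE, use u_H AE_nonzero in eventually_elim)
    case (elim x)
    have "ennreal (\<bar>u x\<bar> powr (p + 2)) \<le> (\<integral>\<^sup>+y. k y * indicator {norm x<..} (norm y) \<partial>lborel)"
      using H_powr_tail[of "p + 2" "norm x"] elim p by (simp add: k_def add.commute)
    then show ?case by (simp add: ennreal_mult mult.commute mult_left_mono)
  qed
  also have "\<dots> \<le> ennreal (sphere_area DIM('a) / (real DIM('a) - \<eta>)) * (\<integral>\<^sup>+y. k y * ennreal (norm y powr (real DIM('a) - \<eta>)) \<partial>lborel)"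
    using \<eta> n2 by (intro nn_integral_norm_powr_tail) auto
  also have "\<dots> \<le> ennreal (sphere_area DIM('a) / (real DIM('a) - \<eta>)) *
      (\<integral>\<^sup>+y. ennreal ((p + 2) * K) * ennreal (g y * (\<bar>u y\<bar> powr (p / 2) * norm y powr (- \<eta> / 2))) \<partial>lborel)"
  proof (rule mult_left_mono[OF nn_integral_mono_AE], use u_H AE_nonzero in eventually_elim)
    case (elim y)
    have e1: "\<bar>u y\<bar> powr (p + 1) = \<bar>u y\<bar> powr m * \<bar>u y\<bar> powr (p / 2)"
      by (rule powr_mult_eq[symmetric]) (simp add: m_def field_simps)
    have e2: "norm y powr (1 - real DIM('a)) * norm y powr (real DIM('a) - \<eta>) = norm y powr (1 - \<eta> / 2) * norm y powr (- \<eta> / 2)"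
      by (simp add: powr_mult_eq[where c = "1 - \<eta>"])
    have "\<bar>u y\<bar> powr m * norm y powr (1 - \<eta> / 2) \<le> K * norm y powr (- (1 - \<eta> / 2)) * norm y powr (1 - \<eta> / 2)"
      using ptw[of "norm y"] elim by (intro mult_right_mono) auto
    also have "\<dots> = K" using elim by (simp add: mult.assoc powr_add[symmetric])
    finally have le: "\<bar>u y\<bar> powr m * norm y powr (1 - \<eta> / 2) \<le> K" .
    have "(p + 2) * \<bar>u y\<bar> powr (p + 1) * J y * norm y powr (real DIM('a) - \<eta>)
       = ((p + 2) * (g y * (\<bar>u y\<bar> powr (p / 2)))) * \<bar>u y\<bar> powr m * (norm y powr (1 - real DIM('a)) * norm y powr (real DIM('a) - \<eta>))"
      by (simp only: e1 J_def mult_ac)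
    also have "\<dots> = ((p + 2) * (g y * (\<bar>u y\<bar> powr (p / 2) * norm y powr (- \<eta> / 2)))) * (\<bar>u y\<bar> powr m * norm y powr (1 - \<eta> / 2))"
      by (simp only: e2 mult_ac)
    also have "\<dots> \<le> ((p + 2) * (g y * (\<bar>u y\<bar> powr (p / 2) * norm y powr (- \<eta> / 2)))) * K"
      using p g_nonneg[of y] by (intro mult_left_mono le) auto
    finally have "(p + 2) * \<bar>u y\<bar> powr (p + 1) * J y * norm y powr (real DIM('a) - \<eta>)
      \<le> (p + 2) * K * (g y * (\<bar>u y\<bar> powr (p / 2) * norm y powr (- \<eta> / 2)))" by (simp add: mult_ac)
    then show ?case
      using p K J_nonneg[of y] g_nonneg[of y] unfolding k_def
      by (subst (1 2) ennreal_mult[symmetric]) (auto intro: ennreal_leI)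
  qed simp
  also have "(\<integral>\<^sup>+y. ennreal ((p + 2) * K) * ennreal (g y * (\<bar>u y\<bar> powr (p / 2) * norm y powr (- \<eta> / 2))) \<partial>lborel)
     = ennreal ((p + 2) * K) * (\<integral>\<^sup>+y. ennreal (g y * (\<bar>u y\<bar> powr (p / 2) * norm y powr (- \<eta> / 2))) \<partial>lborel)"
    by (rule nn_integral_cmult) measurable
  also have "ennreal (sphere_area DIM('a) / (real DIM('a) - \<eta>)) * \<dots> \<le> ennreal (sphere_area DIM('a) / (real DIM('a) - \<eta>)) * (ennreal ((p + 2) * K) * ennreal (D * B))"
    by (intro mult_left_mono weighted_Cauchy_Schwarz B Ip) simp_all
  also have "\<dots> = ennreal (sphere_area DIM('a) / (2 - \<eta>) * (p + 2) * ((p + 2) / 2) * D\<^sup>2 * B\<^sup>2)"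
  proof -
    have "0 \<le> sphere_area DIM('a) / (real DIM('a) - \<eta>)"
      using \<eta> n2 sphere_area_pos[where 'a = 'a] by auto
    moreover have "0 \<le> (p + 2) * K" "0 \<le> D * B" using p K B D_nonneg by auto
    ultimately have "ennreal (sphere_area DIM('a) / (real DIM('a) - \<eta>)) * (ennreal ((p + 2) * K) * ennreal (D * B))
      = ennreal (sphere_area DIM('a) / (real DIM('a) - \<eta>) * ((p + 2) * K * (D * B)))"
      by (simp only: ennreal_mult mult_nonneg_nonneg)
    also have "sphere_area DIM('a) / (real DIM('a) - \<eta>) * ((p + 2) * K * (D * B))
      = sphere_area DIM('a) / (2 - \<eta>) * (p + 2) * ((p + 2) / 2) * D\<^sup>2 * B\<^sup>2"
    proof -
      have e1: "real DIM('a) - \<eta> = 2 - \<eta>" using n2 by simp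
      have "S / t * ((p + 2) * K * (D * B)) = S / t * (p + 2) * ((p + 2) / 2) * D\<^sup>2 * B\<^sup>2" for S t :: real
        by (simp add: K_def m_def power2_eq_square mult_ac)
      then show ?thesis unfolding e1 .
    qed
    finally show ?thesis .
  qed
  finally show ?thesis .
qed

end

text \<open>A Gagliardo-Nirenberg inequality whose constant is uniform over all profiles.  It is restricted to positive \<open>D\<close> and
  \<open>Q\<close> because \<open>0 powr 0 = 0\<close>; otherwise the function vanishes by \<open>u_zero_if_degenerate\<close>.\<close>
definition gn_inequality :: "'a::euclidean_space itself \<Rightarrow> real \<Rightarrow> real \<Rightarrow> real \<Rightarrow> real \<Rightarrow> real \<Rightarrow> bool" where
  "gn_inequality _ b q \<eta> r \<alpha> \<longleftrightarrow>
    (\<exists>C>0. \<forall>(u :: 'a \<Rightarrow> real) g H D Q. radial_energy_bound u g H D b q Q \<longrightarrow> 0 < D \<longrightarrow> 0 < Q \<longrightarrow>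
       (\<integral>\<^sup>+x. ennreal (\<bar>u x\<bar> powr r * norm x powr (- \<eta>)) \<partial>lborel) \<le> ennreal (C * D powr \<alpha> * Q powr (r - \<alpha>)))"

text \<open>Hoelder's inequality in the form of Young's inequality for the two integrands, each normalised by the bound for
  its integral.\<close>
lemma gn_inequality_interpolate:
  assumes g0: "gn_inequality TYPE('a::euclidean_space) b q \<eta> r0 \<alpha>0" and g1: "gn_inequality TYPE('a) b q \<eta> r1 \<alpha>1"
    and l: "0 \<le> l" "l \<le> 1" and r: "r = (1 - l) * r0 + l * r1" and \<alpha>: "\<alpha> = (1 - l) * \<alpha>0 + l * \<alpha>1"
  shows "gn_inequality TYPE('a) b q \<eta> r \<alpha>"
proof -
  obtain C0 where C0: "0 < C0" "\<And>(u :: 'a \<Rightarrow> real) g H D Q. radial_energy_bound u g H D b q Q \<Longrightarrow> 0 < D \<Longrightarrow> 0 < Q \<Longrightarrow>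
       (\<integral>\<^sup>+x. ennreal (\<bar>u x\<bar> powr r0 * norm x powr (- \<eta>)) \<partial>lborel) \<le> ennreal (C0 * D powr \<alpha>0 * Q powr (r0 - \<alpha>0))"
    using g0 unfolding gn_inequality_def by blast
  obtain C1 where C1: "0 < C1" "\<And>(u :: 'a \<Rightarrow> real) g H D Q. radial_energy_bound u g H D b q Q \<Longrightarrow> 0 < D \<Longrightarrow> 0 < Q \<Longrightarrow>
       (\<integral>\<^sup>+x. ennreal (\<bar>u x\<bar> powr r1 * norm x powr (- \<eta>)) \<partial>lborel) \<le> ennreal (C1 * D powr \<alpha>1 * Q powr (r1 - \<alpha>1))"
    using g1 unfolding gn_inequality_def by blast
  show ?thesis unfolding gn_inequality_def
  proof (intro exI[of _ "C0 powr (1 - l) * C1 powr l"] conjI allI impI)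
    show "0 < C0 powr (1 - l) * C1 powr l" using C0 C1 by simp
    fix u :: "'a \<Rightarrow> real" and g H D Q
    assume rad: "radial_energy_bound u g H D b q Q" and D: "0 < D" and Q: "0 < Q"
    interpret radial_energy_bound u g H D b q Q by (rule rad)
    define A0 where "A0 = C0 * D powr \<alpha>0 * Q powr (r0 - \<alpha>0)"
    define A1 where "A1 = C1 * D powr \<alpha>1 * Q powr (r1 - \<alpha>1)"
    have A: "0 < A0" "0 < A1" using C0 C1 D Q by (auto simp: A0_def A1_def)
    let ?A = "A0 powr (1 - l) * A1 powr l"
    let ?f0 = "\<lambda>x. \<bar>u x\<bar> powr r0 * norm x powr (- \<eta>)" and ?f1 = "\<lambda>x. \<bar>u x\<bar> powr r1 * norm x powr (- \<eta>)"
    have pt: "\<bar>u x\<bar> powr r * norm x powr (- \<eta>) \<le> ?A * (1 - l) / A0 * ?f0 x + ?A * l / A1 * ?f1 x" for x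
    proof (cases "u x = 0 \<or> x = 0")
      case True
      then show ?thesis using A l by auto
    next
      case False
      have "(?f0 x / A0) powr (1 - l) * (?f1 x / A1) powr l \<le> (1 - l) * (?f0 x / A0) + l * (?f1 x / A1)"
        using l A False by (intro Youngs_inequality_0) auto
      then have "?A * ((?f0 x / A0) powr (1 - l) * (?f1 x / A1) powr l) \<le> ?A * ((1 - l) * (?f0 x / A0) + l * (?f1 x / A1))"
        using A by (intro mult_left_mono) auto
      also have "?A * ((?f0 x / A0) powr (1 - l) * (?f1 x / A1) powr l) = ?f0 x powr (1 - l) * ?f1 x powr l"
        using A by (simp add: powr_divide)
      also have "\<dots> = (\<bar>u x\<bar> powr (r0 * (1 - l)) * \<bar>u x\<bar> powr (r1 * l)) * (norm x powr (- \<eta> * (1 - l)) * norm x powr (- \<eta> * l))"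
        by (simp only: powr_mult powr_powr mult_ac)
      also have "\<bar>u x\<bar> powr (r0 * (1 - l)) * \<bar>u x\<bar> powr (r1 * l) = \<bar>u x\<bar> powr r"
        by (rule powr_mult_eq) (simp add: r mult.commute)
      also have "norm x powr (- \<eta> * (1 - l)) * norm x powr (- \<eta> * l) = norm x powr (- \<eta>)"
        by (rule powr_mult_eq) (simp add: algebra_simps)
      finally show ?thesis by (simp add: algebra_simps)
    qed
    have "(\<integral>\<^sup>+x. ennreal (\<bar>u x\<bar> powr r * norm x powr (- \<eta>)) \<partial>lborel)
      \<le> (\<integral>\<^sup>+x. ennreal (?A * (1 - l) / A0) * ennreal (?f0 x) + ennreal (?A * l / A1) * ennreal (?f1 x) \<partial>lborel)"
    proof (rule nn_integral_mono)
      fix x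
      have "ennreal (\<bar>u x\<bar> powr r * norm x powr (- \<eta>)) \<le> ennreal (?A * (1 - l) / A0 * ?f0 x + ?A * l / A1 * ?f1 x)"
        by (rule ennreal_leI[OF pt])
      also have "\<dots> = ennreal (?A * (1 - l) / A0 * ?f0 x) + ennreal (?A * l / A1 * ?f1 x)"
        using l A by (intro ennreal_plus) auto
      also have "\<dots> = ennreal (?A * (1 - l) / A0) * ennreal (?f0 x) + ennreal (?A * l / A1) * ennreal (?f1 x)"
        using l A by (intro arg_cong2[where f = "(+)"] ennreal_mult) auto
      finally show "ennreal (\<bar>u x\<bar> powr r * norm x powr (- \<eta>)) \<le> ennreal (?A * (1 - l) / A0) * ennreal (?f0 x) + ennreal (?A * l / A1) * ennreal (?f1 x)" .
    qed
    also have "\<dots> = ennreal (?A * (1 - l) / A0) * (\<integral>\<^sup>+x. ennreal (?f0 x) \<partial>lborel) + ennreal (?A * l / A1) * (\<integral>\<^sup>+x. ennreal (?f1 x) \<partial>lborel)"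
      by (simp add: nn_integral_add nn_integral_cmult)
    also have "\<dots> \<le> ennreal (?A * (1 - l) / A0) * ennreal A0 + ennreal (?A * l / A1) * ennreal A1"
      unfolding A0_def[symmetric]
      by (intro add_mono mult_left_mono C0(2)[OF rad D Q, folded A0_def] C1(2)[OF rad D Q, folded A1_def]) auto
    also have "\<dots> = ennreal (?A * (1 - l) / A0 * A0 + ?A * l / A1 * A1)"
      using l A by (simp add: ennreal_mult'[symmetric] ennreal_plus[symmetric] del: ennreal_plus)
    also have "?A * (1 - l) / A0 * A0 + ?A * l / A1 * A1 = ?A"
    proof -
      have "?A * (1 - l) / A0 * A0 = ?A * (1 - l)" "?A * l / A1 * A1 = ?A * l" using A by auto
      then show ?thesis by (simp add: right_diff_distrib)
    qed
    also have "?A = C0 powr (1 - l) * C1 powr l * D powr \<alpha> * Q powr (r - \<alpha>)"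
    proof -
      have "?A = (C0 powr (1 - l) * C1 powr l) * (D powr (\<alpha>0 * (1 - l)) * D powr (\<alpha>1 * l)) * (Q powr ((r0 - \<alpha>0) * (1 - l)) * Q powr ((r1 - \<alpha>1) * l))"
        unfolding A0_def A1_def by (simp only: powr_mult powr_powr mult_ac)
      also have "D powr (\<alpha>0 * (1 - l)) * D powr (\<alpha>1 * l) = D powr \<alpha>"
        by (rule powr_mult_eq) (simp add: \<alpha> mult.commute)
      also have "Q powr ((r0 - \<alpha>0) * (1 - l)) * Q powr ((r1 - \<alpha>1) * l) = Q powr (r - \<alpha>)"
        by (rule powr_mult_eq) (simp add: r \<alpha> algebra_simps)
      finally show ?thesis .
    qed
    finally show "(\<integral>\<^sup>+x. ennreal (\<bar>u x\<bar> powr r * norm x powr (- \<eta>)) \<partial>lborel) \<le> ennreal (C0 powr (1 - l) * C1 powr l * D powr \<alpha> * Q powr (r - \<alpha>))" .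
  qed
qed

text \<open>The only power of \<open>D\<close> for which both sides of the inequality behave alike under dilations of the variable.\<close>
definition gn_weight :: "real \<Rightarrow> real \<Rightarrow> real \<Rightarrow> real \<Rightarrow> real \<Rightarrow> real" where
  "gn_weight n b q \<eta> r = ((n - \<eta>) - r * (n - b) / q) / ((n - 2) / 2 - (n - b) / q)"

lemma gn_weight_affine:
  "gn_weight n b q \<eta> ((1 - l) * r0 + l * r1) = (1 - l) * gn_weight n b q \<eta> r0 + l * gn_weight n b q \<eta> r1"
  unfolding gn_weight_def times_divide_eq_right add_divide_distrib[symmetric]
  by (rule arg_cong[where f = "\<lambda>z. z / _"]) (simp add: algebra_simps add_divide_distrib diff_divide_distrib)

lemma gn_weight_denominator:
  fixes n b q :: real
  assumes "2 < q" "q * (n - 2) < 2 * (n - b)"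
  shows "(n - 2) / 2 - (n - b) / q < 0"
proof -
  have "(n - 2) / 2 < (n - b) / q" using assms by (simp add: field_simps)
  then show ?thesis by simp
qed

text \<open>The inequality holds at the lower endpoint and at some exponent above \<open>r\<close>: the critical one if \<open>N \<ge> 3\<close>, and one
  reached by repeatedly adding \<open>2\<close> if \<open>N = 2\<close>.  As \<open>gn_weight\<close> is affine in \<open>r\<close>, interpolation yields the right powers.\<close>
theorem gn_inequality_radial:
  fixes b q \<eta> r :: real
  defines "n \<equiv> real DIM('a::euclidean_space)"
  assumes dim: "2 \<le> DIM('a)" and b: "0 \<le> b" "b < 2" and q: "2 < q" and sub: "q * (n - 2) < 2 * (n - b)"
    and \<eta>: "0 \<le> \<eta>" "\<eta> \<le> b"
    and r0: "q + (q + 2) * (b - \<eta>) / (2 * n - 2 - b) \<le> r"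
    and r1: "DIM('a) = 2 \<or> r \<le> 2 * (n - \<eta>) / (n - 2)"
  shows "gn_inequality TYPE('a) b q \<eta> r (gn_weight n b q \<eta> r)"
proof -
  define r0 where "r0 = q + (q + 2) * (b - \<eta>) / (2 * n - 2 - b)"
  have n2: "2 \<le> n" using dim by (simp add: n_def)
  have den: "0 < 2 * n - 2 - b" using n2 b by linarith
  have d0: "(n - 2) / 2 - (n - b) / q < 0" using gn_weight_denominator[OF q sub] .
  have r0q: "q \<le> r0" using den q \<eta> by (simp add: r0_def)
  have \<alpha>0: "gn_weight n b q \<eta> r0 = 2 * (r0 - q) / (q + 2)"
  proof -
    have "2 * (r0 - q) / (q + 2) = 2 * (b - \<eta>) / (2 * n - 2 - b)" using q by (simp add: r0_def)
    moreover have "(n - \<eta>) - r0 * (n - b) / q = 2 * (b - \<eta>) / (2 * n - 2 - b) * ((n - 2) / 2 - (n - b) / q)"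
      using den q by (simp add: r0_def divide_simps) (simp add: algebra_simps)
    ultimately show ?thesis using d0 by (simp add: gn_weight_def)
  qed
  have base: "gn_inequality TYPE('a) b q \<eta> r0 (gn_weight n b q \<eta> r0)"
    unfolding gn_inequality_def
  proof (intro exI[of _ "((q + 2) / 2) powr (gn_weight n b q \<eta> r0)"] conjI allI impI)
    fix u :: "'a \<Rightarrow> real" and g H D Q
    assume "radial_energy_bound u g H D b q Q" and D: "0 < D" and Q: "0 < Q"
    then interpret radial_energy_bound u g H D b q Q by simp
    show "(\<integral>\<^sup>+x. ennreal (\<bar>u x\<bar> powr r0 * norm x powr (- \<eta>)) \<partial>lborel)
      \<le> ennreal (((q + 2) / 2) powr gn_weight n b q \<eta> r0 * D powr gn_weight n b q \<eta> r0 * Q powr (r0 - gn_weight n b q \<eta> r0))"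
      by (rule lower_endpoint[OF \<eta>(2) D Q _ \<alpha>0]) (simp add: r0_def n_def)
  qed (use q in simp)
  obtain r1 where r1: "r \<le> r1" "gn_inequality TYPE('a) b q \<eta> r1 (gn_weight n b q \<eta> r1)"
  proof (cases "DIM('a) = 2")
    case True
    then have n: "n = 2" by (simp add: n_def)
    have w: "gn_weight n b q \<eta> (p + 2) = gn_weight n b q \<eta> p + 2" for p
      using b q by (simp add: gn_weight_def n field_simps)
    have "gn_inequality TYPE('a) b q \<eta> (r0 + 2 * real k) (gn_weight n b q \<eta> (r0 + 2 * real k))" for k
    proof (induction k)
      case 0
      then show ?case using base by simp
    next
      case (Suc k)
      define p where "p = r0 + 2 * real k"
      define \<alpha> where "\<alpha> = gn_weight n b q \<eta> p"
      have p: "0 < p" using r0q q by (simp add: p_def)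
      obtain C where C: "0 < C" "\<And>(u :: 'a \<Rightarrow> real) g H D Q. radial_energy_bound u g H D b q Q \<Longrightarrow> 0 < D \<Longrightarrow> 0 < Q \<Longrightarrow>
         (\<integral>\<^sup>+x. ennreal (\<bar>u x\<bar> powr p * norm x powr (- \<eta>)) \<partial>lborel) \<le> ennreal (C * D powr \<alpha> * Q powr (p - \<alpha>))"
        using Suc.IH unfolding gn_inequality_def p_def[symmetric] \<alpha>_def[symmetric] by blast
      define c where "c = sphere_area DIM('a) / (2 - \<eta>) * (p + 2) * ((p + 2) / 2)"
      have c: "0 < c" using sphere_area_pos[where 'a = 'a] p \<eta> b by (simp add: c_def)
      have "gn_inequality TYPE('a) b q \<eta> (p + 2) (\<alpha> + 2)"
        unfolding gn_inequality_def
      proof (intro exI[of _ "c * C"] conjI allI impI)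
        show "0 < c * C" using c C by simp
        fix u :: "'a \<Rightarrow> real" and g H D Q
        assume rad: "radial_energy_bound u g H D b q Q" and D: "0 < D" and Q: "0 < Q"
        then interpret radial_energy_bound u g H D b q Q by simp
        define B where "B = sqrt (C * D powr \<alpha> * Q powr (p - \<alpha>))"
        have B: "0 \<le> B" "B\<^sup>2 = C * D powr \<alpha> * Q powr (p - \<alpha>)" using C D Q by (simp_all add: B_def)
        have "(\<integral>\<^sup>+x. ennreal (\<bar>u x\<bar> powr (p + 2) * norm x powr (- \<eta>)) \<partial>lborel) \<le> ennreal (c * D\<^sup>2 * B\<^sup>2)"
          unfolding c_def using C(2)[OF rad D Q] B \<eta> b by (intro planar_step True p) auto
        also have "c * D\<^sup>2 * B\<^sup>2 = c * C * D powr (\<alpha> + 2) * Q powr (p + 2 - (\<alpha> + 2))"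
          using D by (simp add: B powr_add)
        finally show "(\<integral>\<^sup>+x. ennreal (\<bar>u x\<bar> powr (p + 2) * norm x powr (- \<eta>)) \<partial>lborel)
            \<le> ennreal (c * C * D powr (\<alpha> + 2) * Q powr (p + 2 - (\<alpha> + 2)))" .
      qed
      moreover have "r0 + 2 * real (Suc k) = p + 2" by (simp add: p_def)
      ultimately show ?case by (simp only: w \<alpha>_def)
    qed
    moreover obtain k where "(r - r0) / 2 \<le> real k" using real_arch_simple by blast
    then have "r \<le> r0 + 2 * real k" by simp
    ultimately show thesis using that by blast
  next
    case False
    then have n3: "2 < n" using dim by (simp add: n_def)
    define r1 where "r1 = 2 * (n - \<eta>) / (n - 2)"
    have w: "gn_weight n b q \<eta> r1 = r1"
    proof -
      have "(n - \<eta>) - r1 * (n - b) / q = r1 * ((n - 2) / 2 - (n - b) / q)"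
      proof -
        have "r1 * ((n - 2) / 2) = n - \<eta>" using n3 by (simp add: r1_def)
        then show ?thesis by (simp add: right_diff_distrib)
      qed
      then show ?thesis using d0 by (simp add: gn_weight_def)
    qed
    have "gn_inequality TYPE('a) b q \<eta> r1 r1"
      unfolding gn_inequality_def
    proof (intro exI[of _ "sqrt (sphere_area DIM('a) / (n - 2)) powr (r1 - 2) * (2 * sphere_area DIM('a) / (n - 2))\<^sup>2"] conjI allI impI)
      show "0 < sqrt (sphere_area DIM('a) / (n - 2)) powr (r1 - 2) * (2 * sphere_area DIM('a) / (n - 2))\<^sup>2"
      proof -
        have "0 < sphere_area DIM('a) / (n - 2)" using n3 sphere_area_pos[where 'a = 'a] by (intro divide_pos_pos) auto
        then have f: "0 < sqrt (sphere_area DIM('a) / (n - 2))" "0 < 2 * sphere_area DIM('a) / (n - 2)" by auto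
        show ?thesis
          by (rule mult_pos_pos[OF powr_gt_zero[THEN iffD2, OF less_imp_neq[OF f(1), symmetric]] zero_less_power[OF f(2)]])
      qed
      fix u :: "'a \<Rightarrow> real" and g H D Q
      assume "radial_energy_bound u g H D b q Q" and D: "0 < D" and Q: "0 < Q"
      then interpret radial_energy_bound u g H D b q Q by simp
      show "(\<integral>\<^sup>+x. ennreal (\<bar>u x\<bar> powr r1 * norm x powr (- \<eta>)) \<partial>lborel)
        \<le> ennreal (sqrt (sphere_area DIM('a) / (n - 2)) powr (r1 - 2) * (2 * sphere_area DIM('a) / (n - 2))\<^sup>2 * D powr r1 * Q powr (r1 - r1))"
        using upper_endpoint[of \<eta> r1] n3 \<eta> b D Q by (simp add: n_def r1_def)
    qed
    moreover have "r \<le> r1" using assms(10) False by (simp add: r1_def)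
    ultimately show thesis using that w by metis
  qed
  have r0r: "r0 \<le> r" using assms(9) by (simp add: r0_def)
  show ?thesis
  proof (cases "r0 = r1")
    case True
    then show ?thesis using r1 r0r base by (metis order_antisym)
  next
    case False
    then have lt: "0 < r1 - r0" using r1 r0r by simp
    define l where "l = (r - r0) / (r1 - r0)"
    have l: "0 \<le> l" "l \<le> 1" using lt r1 r0r by (auto simp: l_def)
    have r: "r = (1 - l) * r0 + l * r1" 
    proof -
      have "l * (r1 - r0) = r - r0" using lt by (simp add: l_def)
      then show ?thesis by (simp add: algebra_simps)
    qed
    show ?thesis
      by (rule gn_inequality_interpolate[OF base r1(2) l r]) (subst r, rule gn_weight_affine)
  qed
qed

section \<open>The energy space in terms of moments\<close>

text \<open>An extended number, so that membership in a weighted Lebesgue space and its norm are read off the same quantity.\<close>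
definition moment :: "real \<Rightarrow> real \<Rightarrow> ('a::euclidean_space \<Rightarrow> real) \<Rightarrow> ennreal" where
  "moment \<eta> s f = (\<integral>\<^sup>+x. ennreal (\<bar>f x\<bar> powr s * norm x powr (- \<eta>)) \<partial>lborel)"

lemma moment_cong_AE:
  assumes "AE x in lebesgue. f x = g x"
  shows "moment \<eta> s f = moment \<eta> s g"
  unfolding moment_def
  by (rule nn_integral_cong_AE) (use assms[unfolded AE_completion_iff] in eventually_elim, simp)

lemma lebesgue_norm_powr_measurable: "(\<lambda>x::real^'n. norm x powr a) \<in> borel_measurable lebesgue"
  by (rule measurable_completion) simp

lemma weighted_measurable:
  "f \<in> borel_measurable (weighted_lebesgue \<eta> :: (real^'n) measure) \<longleftrightarrow> f \<in> borel_measurable lebesgue"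
  by (simp add: weighted_lebesgue_def cong: measurable_cong_sets)

lemma moment_integrable:
  fixes f :: "real^'n \<Rightarrow> real"
  assumes [measurable]: "f \<in> borel_measurable lebesgue"
  shows "integrable lebesgue (\<lambda>x. \<bar>f x\<bar> powr s * norm x powr (- \<eta>)) \<longleftrightarrow> moment \<eta> s f < \<infinity>"
    and "(LINT x|lebesgue. \<bar>f x\<bar> powr s * norm x powr (- \<eta>)) = enn2real (moment \<eta> s f)"
proof -
  note lebesgue_norm_powr_measurable[measurable]
  have m: "(\<lambda>x. \<bar>f x\<bar> powr s * norm x powr (- \<eta>)) \<in> borel_measurable lebesgue" by measurable
  have e: "(\<integral>\<^sup>+x. ennreal (\<bar>f x\<bar> powr s * norm x powr (- \<eta>)) \<partial>lebesgue) = moment \<eta> s f"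
    by (simp add: moment_def nn_integral_completion)
  show "integrable lebesgue (\<lambda>x. \<bar>f x\<bar> powr s * norm x powr (- \<eta>)) \<longleftrightarrow> moment \<eta> s f < \<infinity>"
    using m e by (simp add: integrable_iff_bounded)
  show "(LINT x|lebesgue. \<bar>f x\<bar> powr s * norm x powr (- \<eta>)) = enn2real (moment \<eta> s f)"
    unfolding e[symmetric] by (rule integral_eq_nn_integral[OF m]) simp
qed

lemma Lp_space_weighted_iff:
  fixes f :: "real^'n \<Rightarrow> real"
  shows "f \<in> Lp_space (weighted_lebesgue \<eta>) s \<longleftrightarrow> f \<in> borel_measurable lebesgue \<and> moment \<eta> s f < \<infinity>"
proof (cases "f \<in> borel_measurable lebesgue")
  case True
  note lebesgue_norm_powr_measurable[measurable] True[measurable]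
  have "integrable (weighted_lebesgue \<eta>) (\<lambda>x. \<bar>f x\<bar> powr s) \<longleftrightarrow> integrable lebesgue (\<lambda>x. norm x powr (- \<eta>) *\<^sub>R (\<bar>f x\<bar> powr s))"
    unfolding weighted_lebesgue_def by (rule integrable_density) auto
  then show ?thesis using True moment_integrable(1)[OF True, of s \<eta>]
    by (simp add: Lp_space_def weighted_measurable mult.commute)
qed (simp add: Lp_space_def weighted_measurable)

lemma Lp_norm_weighted:
  fixes f :: "real^'n \<Rightarrow> real"
  assumes f[measurable]: "f \<in> borel_measurable lebesgue"
  shows "Lp_norm (weighted_lebesgue \<eta>) s f = enn2real (moment \<eta> s f) powr (1 / s)"
proof -
  note lebesgue_norm_powr_measurable[measurable]
  have "(LINT x|weighted_lebesgue \<eta>. \<bar>f x\<bar> powr s) = (LINT x|lebesgue. norm x powr (- \<eta>) *\<^sub>R (\<bar>f x\<bar> powr s))"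
    unfolding weighted_lebesgue_def by (rule integral_density) auto
  then show ?thesis using moment_integrable(2)[OF f, of s \<eta>] by (simp add: Lp_norm_def mult.commute)
qed

definition gradient_norm :: "(real^'n \<Rightarrow> real) \<Rightarrow> real" where
  "gradient_norm u = sqrt (LINT x|lebesgue. (norm (weak_gradient u x))\<^sup>2)"

definition potential_norm :: "real \<Rightarrow> real \<Rightarrow> (real^'n \<Rightarrow> real) \<Rightarrow> real" where
  "potential_norm b q u = enn2real (moment b q u) powr (1 / q)"

lemma gradient_norm_nonneg: "0 \<le> gradient_norm u"
  by (simp add: gradient_norm_def integral_nonneg_AE)

lemma potential_norm_nonneg: "0 \<le> potential_norm b q u"
  by (simp add: potential_norm_def)

lemma powr_divide_weight: "a / (norm x powr b) = a * norm x powr (- b)"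
  by (simp add: powr_minus divide_inverse)

lemma E_norm_eq:
  fixes u :: "real^'n \<Rightarrow> real"
  assumes "u \<in> borel_measurable lebesgue" "0 < q"
  shows "E_norm b q u = sqrt ((gradient_norm u)\<^sup>2 + (potential_norm b q u)\<^sup>2)"
proof -
  have nn: "0 \<le> (LINT x|lebesgue. (norm (weak_gradient u x))\<^sup>2)" by (rule integral_nonneg_AE) simp
  have "E_norm b q u = ((LINT x|lebesgue. (norm (weak_gradient u x))\<^sup>2) + enn2real (moment b q u) powr (2 / q)) powr (1 / 2)"
    by (simp only: E_norm_def powr_divide_weight moment_integrable(2)[OF assms(1)])
  also have "enn2real (moment b q u) powr (2 / q) = (potential_norm b q u)\<^sup>2"
    unfolding potential_norm_def by (rule power2_powr_eq[symmetric]) simp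
  finally show ?thesis using nn by (simp add: gradient_norm_def powr_half_sqrt)
qed

lemma gradient_norm_le_E_norm:
  assumes "u \<in> borel_measurable lebesgue" "0 < q"
  shows "gradient_norm u \<le> E_norm b q u"
  unfolding E_norm_eq[OF assms] by (rule real_le_rsqrt) simp

lemma potential_norm_le_E_norm:
  assumes "u \<in> borel_measurable lebesgue" "0 < q"
  shows "potential_norm b q u \<le> E_norm b q u"
  unfolding E_norm_eq[OF assms] by (rule real_le_rsqrt) simp

lemma E_rad_weak_gradient:
  assumes "u \<in> E_rad b q"
  shows "has_weak_gradient u (weak_gradient u)"
proof -
  have "\<exists>G. has_weak_gradient u G" using assms unfolding E_rad_def E_space_def by blast
  then show ?thesis unfolding weak_gradient_def by (rule someI_ex)
qed

lemma E_rad_measurable: "u \<in> E_rad b q \<Longrightarrow> u \<in> borel_measurable lebesgue"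
  by (simp add: E_rad_def E_space_def Lp_space_weighted_iff)

lemma E_rad_moment_finite: "u \<in> E_rad b q \<Longrightarrow> moment b q u < \<infinity>"
  by (simp add: E_rad_def E_space_def Lp_space_weighted_iff)

lemma E_rad_gradient_integrable:
  assumes "u \<in> E_rad b q"
  shows "integrable lebesgue (\<lambda>x. (norm (weak_gradient u x))\<^sup>2)"
proof -
  have "integrable lebesgue (\<lambda>x. (weak_gradient u x $ i)\<^sup>2)" for i
  proof -
    have "integrable lebesgue (\<lambda>x. \<bar>weak_gradient u x $ i\<bar> powr 2)"
      using assms unfolding E_rad_def E_space_def Lp_space_def by blast
    then show ?thesis by (simp add: powr_numeral)
  qed
  then have "integrable lebesgue (\<lambda>x. \<Sum>i\<in>UNIV. (weak_gradient u x $ i)\<^sup>2)"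
    by (rule Bochner_Integration.integrable_sum)
  then show ?thesis by (simp add: norm_vec_def L2_set_def sum_nonneg)
qed

text \<open>The gradient is divided by the area of the unit sphere because \<open>radial_profile\<close> contains that factor in \<open>g\<close>.\<close>
lemma E_rad_profile:
  fixes u :: "real^'n \<Rightarrow> real"
  assumes u: "u \<in> E_rad b q" and dim: "2 \<le> CARD('n)" and b: "0 \<le> b" "b < 2" and q: "2 < q"
  obtains u' g H where "radial_energy_bound u' g H (gradient_norm u / sphere_area CARD('n)) b q (potential_norm b q u)"
    "AE x in lebesgue. u x = u' x"
proof -
  let ?\<sigma> = "sphere_area CARD('n)"
  have \<sigma>: "0 < ?\<sigma>" using sphere_area_pos[where 'a = "real^'n"] by simp
  have rad: "radial u" using u by (simp add: E_rad_def)
  obtain u' g H where p: "radial_profile u' g H" and uu': "AE x in lebesgue. u x = u' x"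
    and g: "AE x in lebesgue. g x = norm (weak_gradient u x) / ?\<sigma>"
    by (rule weak_gradient_radial_profile[OF E_rad_weak_gradient[OF u] rad])
  have "(\<integral>\<^sup>+x. ennreal ((g x)\<^sup>2) \<partial>lborel) = (\<integral>\<^sup>+x. ennreal ((norm (weak_gradient u x))\<^sup>2 / ?\<sigma>\<^sup>2) \<partial>lebesgue)"
    unfolding nn_integral_completion
    by (rule nn_integral_cong_AE) (use g[unfolded AE_completion_iff] in eventually_elim, simp add: power_divide)
  also have "\<dots> = ennreal (LINT x|lebesgue. (norm (weak_gradient u x))\<^sup>2 / ?\<sigma>\<^sup>2)"
    by (rule nn_integral_eq_integral[OF integrable_divide[OF E_rad_gradient_integrable[OF u]]]) simp
  also have "(LINT x|lebesgue. (norm (weak_gradient u x))\<^sup>2 / ?\<sigma>\<^sup>2) = (gradient_norm u / ?\<sigma>)\<^sup>2"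
    by (simp add: gradient_norm_def power_divide integral_nonneg_AE)
  finally have g2: "(\<integral>\<^sup>+x. ennreal ((g x)\<^sup>2) \<partial>lborel) = ennreal ((gradient_norm u / ?\<sigma>)\<^sup>2)" .
  have "moment b q u = ennreal (enn2real (moment b q u))"
    using E_rad_moment_finite[OF u] by simp
  also have "enn2real (moment b q u) = potential_norm b q u powr q"
    unfolding potential_norm_def using q by (simp add: powr_powr)
  finally have mq: "moment b q u = ennreal (potential_norm b q u powr q)" .
  have "radial_energy_bound u' g H (gradient_norm u / ?\<sigma>) b q (potential_norm b q u)"
  proof
    show "(\<integral>\<^sup>+x. ennreal (\<bar>u' x\<bar> powr q * norm x powr (- b)) \<partial>lborel) \<le> ennreal (potential_norm b q u powr q)"
      unfolding moment_def[symmetric] moment_cong_AE[OF uu', symmetric] mq by simp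
    show "0 \<le> gradient_norm u / ?\<sigma>" using \<sigma> gradient_norm_nonneg[of u] by (intro divide_nonneg_pos)
  qed (use p dim b q g2 potential_norm_nonneg in auto)
  then show thesis using uu' by (rule that)
qed

lemma E_rad_gn_inequality:
  fixes b q \<eta> r :: real
  defines "n \<equiv> real CARD('n::finite)"
  assumes dim: "2 \<le> CARD('n)" and b: "0 \<le> b" "b < 2" and q: "2 < q"
    and gn: "gn_inequality TYPE(real^'n) b q \<eta> r \<alpha>"
  shows "\<exists>C>0. \<forall>u\<in>(E_rad b q :: (real^'n \<Rightarrow> real) set).
    moment \<eta> r u \<le> ennreal (C * gradient_norm u powr \<alpha> * potential_norm b q u powr (r - \<alpha>))"
proof -
  let ?\<sigma> = "sphere_area CARD('n)"
  have \<sigma>: "0 < ?\<sigma>" using sphere_area_pos[where 'a = "real^'n"] by simp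
  obtain C where C: "0 < C" "\<And>(u :: real^'n \<Rightarrow> real) g H D Q. radial_energy_bound u g H D b q Q \<Longrightarrow> 0 < D \<Longrightarrow> 0 < Q \<Longrightarrow>
       (\<integral>\<^sup>+x. ennreal (\<bar>u x\<bar> powr r * norm x powr (- \<eta>)) \<partial>lborel) \<le> ennreal (C * D powr \<alpha> * Q powr (r - \<alpha>))"
    using gn unfolding gn_inequality_def by blast
  show ?thesis
  proof (intro exI[of _ "C / ?\<sigma> powr \<alpha>"] conjI ballI)
    show "0 < C / ?\<sigma> powr \<alpha>"
      using C(1) powr_gt_zero[THEN iffD2, OF less_imp_neq[OF \<sigma>, symmetric]] by (rule divide_pos_pos)
    fix u :: "real^'n \<Rightarrow> real" assume u: "u \<in> E_rad b q"
    obtain u' g H where r: "radial_energy_bound u' g H (gradient_norm u / ?\<sigma>) b q (potential_norm b q u)"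
      and uu': "AE x in lebesgue. u x = u' x"
      by (rule E_rad_profile[OF u dim b q])
    interpret radial_energy_bound u' g H "gradient_norm u / ?\<sigma>" b q "potential_norm b q u" by (rule r)
    have eq: "moment \<eta> r u = moment \<eta> r u'" by (rule moment_cong_AE[OF uu'])
    show "moment \<eta> r u \<le> ennreal (C / ?\<sigma> powr \<alpha> * gradient_norm u powr \<alpha> * potential_norm b q u powr (r - \<alpha>))"
    proof (cases "gradient_norm u / ?\<sigma> = 0 \<or> potential_norm b q u = 0")
      case True
      then have z: "AE x in lborel. u' x = 0" by (rule u_zero_if_degenerate)
      have "moment \<eta> r u' = (\<integral>\<^sup>+x. 0 \<partial>(lborel :: (real^'n) measure))" unfolding moment_def
        by (rule nn_integral_cong_AE) (use z in eventually_elim, simp)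
      then show ?thesis using eq by simp
    next
      case False
      then have "moment \<eta> r u' \<le> ennreal (C * (gradient_norm u / ?\<sigma>) powr \<alpha> * potential_norm b q u powr (r - \<alpha>))"
        unfolding moment_def using D_nonneg Q_nonneg by (intro C(2)[OF r]) (auto simp only: less_le)
      then show ?thesis using eq by (simp add: powr_divide)
    qed
  qed
qed

text \<open>Both powers in the inequality are nonnegative, so both norms may be replaced by the energy norm.\<close>
lemma gn_weight_bounds:
  fixes n b q \<eta> r :: real
  assumes n: "2 \<le> n" and b: "0 \<le> b" "b < 2" and q: "2 < q" and sub: "q * (n - 2) < 2 * (n - b)"
    and \<eta>: "0 \<le> \<eta>" "\<eta> \<le> b" and r0: "q + (q + 2) * (b - \<eta>) / (2 * n - 2 - b) \<le> r"
    and r1: "n = 2 \<or> r \<le> 2 * (n - \<eta>) / (n - 2)"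
  shows "0 \<le> gn_weight n b q \<eta> r" "gn_weight n b q \<eta> r \<le> r"
proof -
  have d0: "(n - 2) / 2 - (n - b) / q < 0" using gn_weight_denominator[OF q sub] .
  have den: "0 < 2 * n - 2 - b" using n b by linarith
  have rq: "q + (q + 2) * (b - \<eta>) / (2 * n - 2 - b) \<le> r" by (rule r0)
  have "(n - \<eta>) * q \<le> r * (n - b)"
  proof -
    have "(b - \<eta>) * q \<le> ((q + 2) * (b - \<eta>) / (2 * n - 2 - b)) * (n - b)"
    proof -
      have "q * (2 * n - 2 - b) \<le> (q + 2) * (n - b)" using sub by (simp add: algebra_simps)
      then have "(b - \<eta>) * (q * (2 * n - 2 - b)) \<le> (b - \<eta>) * ((q + 2) * (n - b))"
        using \<eta> by (intro mult_left_mono) auto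
      then show ?thesis using den by (simp add: field_simps)
    qed
    moreover have "(q + (q + 2) * (b - \<eta>) / (2 * n - 2 - b)) * (n - b) \<le> r * (n - b)"
      using r0 n b by (intro mult_right_mono) auto
    ultimately show ?thesis by (simp add: algebra_simps)
  qed
  then have "(n - \<eta>) - r * (n - b) / q \<le> 0" using q by (simp add: field_simps)
  then show "0 \<le> gn_weight n b q \<eta> r" unfolding gn_weight_def using d0 by (intro divide_nonpos_neg)
  have "r * (n - 2) \<le> 2 * (n - \<eta>)"
    using r1
  proof
    assume "n = 2"
    then show ?thesis using \<eta> b by simp
  next
    assume "r \<le> 2 * (n - \<eta>) / (n - 2)"
    then show ?thesis using n \<eta> b by (cases "n = 2") (auto simp: field_simps)
  qed
  then have "r * ((n - 2) / 2 - (n - b) / q) \<le> (n - \<eta>) - r * (n - b) / q"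
    by (simp add: right_diff_distrib)
  then show "gn_weight n b q \<eta> r \<le> r" unfolding gn_weight_def using d0 by (simp add: neg_divide_le_eq)
qed

section \<open>Convergence of bounded sequences\<close>

text \<open>A diagonal sequence converges at all rational radii.  The bound for the increments is common to all profiles,
  which carries the convergence over to the remaining radii.\<close>
lemma profile_subsequence:
  fixes u g :: "nat \<Rightarrow> 'a::euclidean_space \<Rightarrow> real"
  assumes rad: "\<And>k. radial_energy_bound (u k) (g k) (H k) D b q Q"
  obtains \<rho> h where "strict_mono \<rho>" "\<And>s. 0 < s \<Longrightarrow> (\<lambda>k. H (\<rho> k) s) \<longlonglongrightarrow> h s"
proof -
  define K where "K s = ((q + 2) / 2 * D * Q powr (q / 2)) powr (2 / (q + 2)) * s powr (- ((2 * real DIM('a) - 2 - b) / (q + 2)))" for s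
  have K: "\<bar>H k s\<bar> \<le> K s" if "0 < s" for k s
    unfolding K_def by (rule radial_energy_bound.radial_bound[OF rad that])
  have K0: "0 \<le> K s" for s by (simp add: K_def)
  define \<omega> where "\<omega> s t = D * (s powr (1 - real DIM('a)) * sqrt (unit_ball_vol (real DIM('a)) * (t ^ DIM('a) - s ^ DIM('a))))" for s t
  have \<omega>: "\<bar>H k t - H k s\<bar> \<le> \<omega> s t" if "0 < s" "s \<le> t" for k s t
    using rad[of k] that unfolding \<omega>_def radial_energy_bound_def by (blast intro: radial_gradient_bound.H_incr_bound)
  have "countable {s \<in> \<rat>. (0::real) < s}" using countable_rat by (rule countable_subset[rotated]) auto
  moreover have "norm (H k s / (K s + 1)) \<le> 1" if "s \<in> {s \<in> \<rat>. (0::real) < s}" for k s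
    using K[of s k] K0[of s] that by (simp add: abs_divide divide_le_eq)
  ultimately obtain \<rho> where \<rho>: "strict_mono \<rho>"
    and conv: "\<And>s. s \<in> {s \<in> \<rat>. (0::real) < s} \<Longrightarrow> \<exists>l. (\<lambda>k. H (\<rho> k) s / (K s + 1)) \<longlonglongrightarrow> l"
    using function_convergent_subsequence[of "{s \<in> \<rat>. (0::real) < s}" "\<lambda>k s. H k s / (K s + 1)" 1] by blast
  have convr: "Cauchy (\<lambda>k. H (\<rho> k) p)" if p: "p \<in> \<rat>" "0 < p" for p :: real
  proof -
    obtain l where "(\<lambda>k. H (\<rho> k) p / (K p + 1)) \<longlonglongrightarrow> l" using conv p by blast
    then have "(\<lambda>k. H (\<rho> k) p / (K p + 1) * (K p + 1)) \<longlonglongrightarrow> l * (K p + 1)" by (intro tendsto_intros)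
    moreover have "K p + 1 \<noteq> 0" using K0[of p] by linarith
    ultimately have "(\<lambda>k. H (\<rho> k) p) \<longlonglongrightarrow> l * (K p + 1)" by simp
    then show ?thesis by (rule LIMSEQ_imp_Cauchy)
  qed
  have "convergent (\<lambda>k. H (\<rho> k) s)" if s: "0 < s" for s
  proof -
    have "Cauchy (\<lambda>k. H (\<rho> k) s)"
    proof (rule metric_CauchyI)
      fix e :: real assume e: "0 < e"
      have "((\<lambda>t. \<omega> s t) \<longlongrightarrow> \<omega> s s) (at_right s)" unfolding \<omega>_def by (intro tendsto_intros)
      then have "((\<lambda>t. \<omega> s t) \<longlongrightarrow> 0) (at_right s)" by (simp add: \<omega>_def)
      then have "eventually (\<lambda>t. \<omega> s t < e / 3) (at_right s)" using e by (intro order_tendstoD(2)) auto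
      then obtain d where d: "s < d" "\<And>t. s < t \<Longrightarrow> t < d \<Longrightarrow> \<omega> s t < e / 3"
        unfolding eventually_at_right_field by blast
      obtain p where p: "p \<in> \<rat>" "s < p" "p < d" using Rats_dense_in_real[OF d(1)] by blast
      have \<omega>p: "\<omega> s p < e / 3" using d(2) p by blast
      have "0 < e / 3" using e by simp
      then obtain N where N: "\<And>m n. N \<le> m \<Longrightarrow> N \<le> n \<Longrightarrow> dist (H (\<rho> m) p) (H (\<rho> n) p) < e / 3"
        using convr[of p] p s unfolding Cauchy_def by (meson order_less_trans)
      show "\<exists>M. \<forall>m\<ge>M. \<forall>n\<ge>M. dist (H (\<rho> m) s) (H (\<rho> n) s) < e"
      proof (intro exI[of _ N] allI impI)
        fix m n assume "N \<le> m" "N \<le> n"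
        from N[OF this] have "\<bar>H (\<rho> m) p - H (\<rho> n) p\<bar> < e / 3" by (simp add: dist_real_def)
        moreover have "\<bar>H (\<rho> m) p - H (\<rho> m) s\<bar> < e / 3" "\<bar>H (\<rho> n) p - H (\<rho> n) s\<bar> < e / 3"
          using \<omega>[of s p] s p \<omega>p by (meson less_imp_le order_le_less_trans)+
        ultimately show "dist (H (\<rho> m) s) (H (\<rho> n) s) < e" unfolding dist_real_def by linarith
      qed
    qed
    then show ?thesis by (simp add: Cauchy_convergent_iff)
  qed
  then have "(\<lambda>k. H (\<rho> k) s) \<longlonglongrightarrow> lim (\<lambda>k. H (\<rho> k) s)" if "0 < s" for s
    using that by (simp add: convergent_LIMSEQ_iff)
  with \<rho> show thesis by (rule that)
qed

lemma nn_integral_le_of_limit: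
  fixes f :: "nat \<Rightarrow> 'a \<Rightarrow> ennreal"
  assumes "\<And>k. f k \<in> borel_measurable M" "AE x in M. (\<lambda>k. f k x) \<longlonglongrightarrow> F x" "\<And>k. integral\<^sup>N M (f k) \<le> C"
  shows "integral\<^sup>N M F \<le> C"
proof -
  have "integral\<^sup>N M F = (\<integral>\<^sup>+x. liminf (\<lambda>k. f k x) \<partial>M)"
    by (rule nn_integral_cong_AE) (use assms(2) in eventually_elim, simp add: lim_imp_Liminf)
  also have "\<dots> \<le> liminf (\<lambda>k. integral\<^sup>N M (f k))" by (rule nn_integral_liminf[OF assms(1)])
  also have "\<dots> \<le> C"
    by (rule order_trans[OF Liminf_le_Limsup Limsup_bounded]) (simp_all add: assms(3))
  finally show ?thesis .
qed

lemma abs_diff_powr_le: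
  fixes a b s :: real
  assumes "0 < s"
  shows "\<bar>a - b\<bar> powr s \<le> 2 powr s * (\<bar>a\<bar> powr s + \<bar>b\<bar> powr s)"
proof -
  have "\<bar>a - b\<bar> powr s \<le> (2 * max \<bar>a\<bar> \<bar>b\<bar>) powr s" using assms by (intro powr_mono2) auto
  also have "\<dots> = 2 powr s * max \<bar>a\<bar> \<bar>b\<bar> powr s" by (rule powr_mult)
  also have "\<dots> \<le> 2 powr s * (\<bar>a\<bar> powr s + \<bar>b\<bar> powr s)" by (intro mult_left_mono) (auto simp: max_def)
  finally show ?thesis .
qed

lemma moment_diff_le:
  fixes f g :: "'a::euclidean_space \<Rightarrow> real"
  assumes [measurable]: "f \<in> borel_measurable lebesgue" "g \<in> borel_measurable lebesgue" and s: "0 < s"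
  shows "moment \<eta> s (\<lambda>x. f x - g x) \<le> ennreal (2 powr s) * (moment \<eta> s f + moment \<eta> s g)"
proof -
  have [measurable]: "(\<lambda>x::'a. norm x powr (- \<eta>)) \<in> borel_measurable lebesgue"
    by (rule measurable_completion) simp
  have "moment \<eta> s (\<lambda>x. f x - g x) \<le> (\<integral>\<^sup>+x. ennreal (2 powr s) * (ennreal (\<bar>f x\<bar> powr s * norm x powr (- \<eta>)) + ennreal (\<bar>g x\<bar> powr s * norm x powr (- \<eta>))) \<partial>lebesgue)"
    unfolding moment_def nn_integral_completion
  proof (rule nn_integral_mono)
    fix x
    have "\<bar>f x - g x\<bar> powr s * norm x powr (- \<eta>) \<le> (2 powr s * (\<bar>f x\<bar> powr s + \<bar>g x\<bar> powr s)) * norm x powr (- \<eta>)"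
      by (intro mult_right_mono abs_diff_powr_le s) simp
    then have "ennreal (\<bar>f x - g x\<bar> powr s * norm x powr (- \<eta>)) \<le> ennreal ((2 powr s * (\<bar>f x\<bar> powr s + \<bar>g x\<bar> powr s)) * norm x powr (- \<eta>))"
      by (rule ennreal_leI)
    also have "(2 powr s * (\<bar>f x\<bar> powr s + \<bar>g x\<bar> powr s)) * norm x powr (- \<eta>)
       = 2 powr s * (\<bar>f x\<bar> powr s * norm x powr (- \<eta>) + \<bar>g x\<bar> powr s * norm x powr (- \<eta>))"
      by (simp add: algebra_simps)
    also have "ennreal \<dots> = ennreal (2 powr s) * (ennreal (\<bar>f x\<bar> powr s * norm x powr (- \<eta>)) + ennreal (\<bar>g x\<bar> powr s * norm x powr (- \<eta>)))"
      by (subst ennreal_mult, simp, simp, subst ennreal_plus) auto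
    finally show "ennreal (\<bar>f x - g x\<bar> powr s * norm x powr (- \<eta>)) \<le> ennreal (2 powr s) * (ennreal (\<bar>f x\<bar> powr s * norm x powr (- \<eta>)) + ennreal (\<bar>g x\<bar> powr s * norm x powr (- \<eta>)))" .
  qed
  also have "\<dots> = ennreal (2 powr s) * (moment \<eta> s f + moment \<eta> s g)"
    unfolding moment_def nn_integral_completion[of lborel, symmetric] by (simp add: nn_integral_cmult nn_integral_add)
  finally show ?thesis .
qed

text \<open>Outside a large ball the decay leaves a small multiple of the moment of order \<open>r0\<close>; where \<open>\<bar>d k\<bar>\<close> exceeds a large
  \<open>M\<close> there remains a small multiple of the moment of order \<open>r1\<close>; on the rest of the ball dominated convergence
  applies, as \<open>norm x powr (- \<eta>)\<close> is integrable near the origin.\<close>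
lemma moment_tendsto_zero:
  fixes d :: "nat \<Rightarrow> 'a::euclidean_space \<Rightarrow> real"
  assumes d[measurable]: "\<And>k. d k \<in> borel_measurable borel"
    and lim: "AE x in lborel. (\<lambda>k. d k x) \<longlonglongrightarrow> 0"
    and K0: "\<And>k. moment \<eta> r0 (d k) \<le> ennreal K0" and K1: "\<And>k. moment \<eta> r1 (d k) \<le> ennreal K1"
    and bd: "\<And>k. AE x in lborel. \<bar>d k x\<bar> \<le> B * norm x powr (- \<kappa>)"
    and pars: "0 < r0" "r0 < r" "r < r1" "\<eta> < real DIM('a)" "0 < \<kappa>" "0 \<le> B" "0 \<le> K0" "0 \<le> K1"
  shows "(\<lambda>k. moment \<eta> r (d k)) \<longlonglongrightarrow> 0"
proof (rule order_tendstoI)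
  fix a :: ennreal assume "a < 0" then show "\<forall>\<^sub>F k in sequentially. a < moment \<eta> r (d k)" by simp
next
  fix a :: ennreal assume "0 < a"
  obtain e where e: "0 < e" "ennreal e < a"
  proof (cases a rule: ennreal_cases)
    case (real z)
    then show thesis using \<open>0 < a\<close> by (intro that[of "z / 2"]) (auto simp: ennreal_less_iff ennreal_less_zero_iff)
  next
    case top
    then show thesis by (intro that[of 1]) auto
  qed
  have l1: "((\<lambda>R::real. (B * R powr (- \<kappa>)) powr (r - r0) * K0) \<longlongrightarrow> 0) at_top"
  proof (rule tendsto_mult_left_zero, rule tendsto_zero_powrI[where b = "r - r0"])
    show "((\<lambda>R::real. B * R powr (- \<kappa>)) \<longlongrightarrow> 0) at_top"
      using pars by (intro tendsto_mult_right_zero tendsto_neg_powr filterlim_ident) auto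
  qed (use pars in auto)
  have "\<forall>\<^sub>F R in at_top. (B * R powr (- \<kappa>)) powr (r - r0) * K0 < e / 3 \<and> 0 < R"
    using e by (intro eventually_conj order_tendstoD(2)[OF l1] eventually_gt_at_top) auto
  then obtain R where R: "(B * R powr (- \<kappa>)) powr (r - r0) * K0 < e / 3" "0 < R"
    using eventually_happens'[OF trivial_limit_at_top_linorder] by blast
  have l2: "((\<lambda>M::real. M powr (r - r1) * K1) \<longlongrightarrow> 0) at_top"
    using pars by (intro tendsto_mult_left_zero tendsto_neg_powr filterlim_ident) auto
  have "\<forall>\<^sub>F M in at_top. M powr (r - r1) * K1 < e / 3 \<and> 0 < M"
    using e by (intro eventually_conj order_tendstoD(2)[OF l2] eventually_gt_at_top) auto
  then obtain M where M: "M powr (r - r1) * K1 < e / 3" "0 < M"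
    using eventually_happens'[OF trivial_limit_at_top_linorder] by blast
  define T where "T k x = ennreal (min \<bar>d k x\<bar> M powr r * norm x powr (- \<eta>)) * indicator {..R} (norm x)" for k and x :: 'a
  have split: "ennreal (\<bar>d k x\<bar> powr r * norm x powr (- \<eta>)) \<le>
      ennreal ((B * R powr (- \<kappa>)) powr (r - r0)) * ennreal (\<bar>d k x\<bar> powr r0 * norm x powr (- \<eta>))
      + (T k x + ennreal (M powr (r - r1)) * ennreal (\<bar>d k x\<bar> powr r1 * norm x powr (- \<eta>)))"
    if x: "\<bar>d k x\<bar> \<le> B * norm x powr (- \<kappa>)" for k x
  proof (cases "R < norm x")
    case True
    have "\<bar>d k x\<bar> \<le> B * R powr (- \<kappa>)"
      using x True R pars by (elim order_trans) (intro mult_left_mono powr_mono2', auto)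
    then have "\<bar>d k x\<bar> powr (r - r0) \<le> (B * R powr (- \<kappa>)) powr (r - r0)"
      using pars by (intro powr_mono2) auto
    then have "\<bar>d k x\<bar> powr (r - r0) * (\<bar>d k x\<bar> powr r0 * norm x powr (- \<eta>)) \<le> (B * R powr (- \<kappa>)) powr (r - r0) * (\<bar>d k x\<bar> powr r0 * norm x powr (- \<eta>))"
      by (intro mult_right_mono) auto
    moreover have "\<bar>d k x\<bar> powr (r - r0) * \<bar>d k x\<bar> powr r0 = \<bar>d k x\<bar> powr r" by (rule powr_mult_eq) simp
    ultimately have "\<bar>d k x\<bar> powr r * norm x powr (- \<eta>) \<le> (B * R powr (- \<kappa>)) powr (r - r0) * (\<bar>d k x\<bar> powr r0 * norm x powr (- \<eta>))"
      by (simp add: mult.assoc[symmetric])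
    then have "ennreal (\<bar>d k x\<bar> powr r * norm x powr (- \<eta>)) \<le> ennreal ((B * R powr (- \<kappa>)) powr (r - r0)) * ennreal (\<bar>d k x\<bar> powr r0 * norm x powr (- \<eta>))"
      by (subst ennreal_mult[symmetric]) (auto intro: ennreal_leI)
    then show ?thesis by (rule order_trans) simp
  next
    case nR: False
    show ?thesis
    proof (cases "\<bar>d k x\<bar> \<le> M")
      case True
      then have "ennreal (\<bar>d k x\<bar> powr r * norm x powr (- \<eta>)) \<le> T k x" using nR by (simp add: T_def)
      then show ?thesis by (rule order_trans) (simp add: add_increasing add_increasing2)
    next
      case False
      have "\<bar>d k x\<bar> powr (r - r1) \<le> M powr (r - r1)" using False M pars by (intro powr_mono2') auto
      then have "\<bar>d k x\<bar> powr (r - r1) * (\<bar>d k x\<bar> powr r1 * norm x powr (- \<eta>)) \<le> M powr (r - r1) * (\<bar>d k x\<bar> powr r1 * norm x powr (- \<eta>))"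
        by (intro mult_right_mono) auto
      moreover have "\<bar>d k x\<bar> powr (r - r1) * \<bar>d k x\<bar> powr r1 = \<bar>d k x\<bar> powr r" by (rule powr_mult_eq) simp
      ultimately have "\<bar>d k x\<bar> powr r * norm x powr (- \<eta>) \<le> M powr (r - r1) * (\<bar>d k x\<bar> powr r1 * norm x powr (- \<eta>))"
        by (simp add: mult.assoc[symmetric])
      then have "ennreal (\<bar>d k x\<bar> powr r * norm x powr (- \<eta>)) \<le> ennreal (M powr (r - r1)) * ennreal (\<bar>d k x\<bar> powr r1 * norm x powr (- \<eta>))"
        by (subst ennreal_mult[symmetric]) (auto intro: ennreal_leI)
      then show ?thesis by (rule order_trans) (simp add: add_increasing add_increasing2)
    qed
  qed
  have [measurable]: "T k \<in> borel_measurable borel" for k unfolding T_def[abs_def] by measurable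
  have "(\<lambda>k. integral\<^sup>N lborel (T k)) \<longlonglongrightarrow> (\<integral>\<^sup>+x. 0 \<partial>(lborel :: 'a measure))"
  proof (rule nn_integral_dominated_convergence[where w = "\<lambda>x. ennreal (M powr r) * (ennreal (norm x powr (- \<eta>)) * indicator {..R} (norm x))"])
    show "AE x in lborel. T k x \<le> ennreal (M powr r) * (ennreal (norm x powr (- \<eta>)) * indicator {..R} (norm x))" for k
    proof (rule AE_I2)
      fix x
      have "min \<bar>d k x\<bar> M powr r * norm x powr (- \<eta>) \<le> M powr r * norm x powr (- \<eta>)"
        using M pars by (intro mult_right_mono powr_mono2) auto
      then show "T k x \<le> ennreal (M powr r) * (ennreal (norm x powr (- \<eta>)) * indicator {..R} (norm x))"
        by (auto simp: T_def ennreal_mult[symmetric] intro: ennreal_leI split: split_indicator)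
    qed
    have "(\<integral>\<^sup>+x. ennreal (M powr r) * (ennreal (norm (x::'a) powr (- \<eta>)) * indicator {..R} (norm x)) \<partial>lborel) = ennreal (M powr r) * ennreal (sphere_area DIM('a) / (real DIM('a) - \<eta>) * R powr (real DIM('a) - \<eta>))"
      using R pars by (subst nn_integral_cmult) (auto simp: nn_integral_norm_powr_inside)
    then show "(\<integral>\<^sup>+x. ennreal (M powr r) * (ennreal (norm (x::'a) powr (- \<eta>)) * indicator {..R} (norm x)) \<partial>lborel) < \<infinity>"
      by (simp add: ennreal_mult_less_top)
    show "AE x in lborel. (\<lambda>k. T k x) \<longlonglongrightarrow> 0"
      using lim
    proof eventually_elim
      case (elim x)
      have "(\<lambda>k. min \<bar>d k x\<bar> M) \<longlonglongrightarrow> min \<bar>0\<bar> M" using elim by (intro tendsto_intros)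
      then have "(\<lambda>k. min \<bar>d k x\<bar> M powr r) \<longlonglongrightarrow> 0"
        using M pars by (intro tendsto_zero_powrI[where b = r]) auto
      then have "(\<lambda>k. ennreal (min \<bar>d k x\<bar> M powr r * norm x powr (- \<eta>))) \<longlonglongrightarrow> ennreal 0"
        by (intro tendsto_ennrealI tendsto_mult_left_zero)
      then show ?case by (cases "norm x \<le> R") (simp_all add: T_def)
    qed
  qed measurable
  then have "\<forall>\<^sub>F k in sequentially. integral\<^sup>N lborel (T k) < ennreal (e / 3)"
    using e by (intro order_tendstoD(2)) (auto simp: ennreal_less_zero_iff)
  then show "\<forall>\<^sub>F k in sequentially. moment \<eta> r (d k) < a"
  proof eventually_elim
    case (elim k)
    have "moment \<eta> r (d k) \<le> (\<integral>\<^sup>+x. ennreal ((B * R powr (- \<kappa>)) powr (r - r0)) * ennreal (\<bar>d k x\<bar> powr r0 * norm x powr (- \<eta>))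
      + (T k x + ennreal (M powr (r - r1)) * ennreal (\<bar>d k x\<bar> powr r1 * norm x powr (- \<eta>))) \<partial>lborel)"
      unfolding moment_def by (rule nn_integral_mono_AE) (use bd[of k] in eventually_elim, rule split)
    also have "\<dots> = ennreal ((B * R powr (- \<kappa>)) powr (r - r0)) * moment \<eta> r0 (d k) + (integral\<^sup>N lborel (T k) + ennreal (M powr (r - r1)) * moment \<eta> r1 (d k))"
      unfolding moment_def by (simp add: nn_integral_add nn_integral_cmult)
    also have "\<dots> \<le> ennreal ((B * R powr (- \<kappa>)) powr (r - r0)) * ennreal K0 + (ennreal (e / 3) + ennreal (M powr (r - r1)) * ennreal K1)"
      using elim by (intro add_mono mult_left_mono K0 K1) auto
    also have "\<dots> = ennreal ((B * R powr (- \<kappa>)) powr (r - r0) * K0 + (e / 3 + M powr (r - r1) * K1))"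
      using e pars by (simp add: ennreal_mult)
    also have "\<dots> \<le> ennreal e" using R M by (intro ennreal_leI) linarith
    also have "\<dots> < a" by (rule e)
    finally show ?case .
  qed
qed

section \<open>Continuous and compact embeddings\<close>

lemma powr_interpolate_bound:
  fixes G P E \<alpha> r :: real
  assumes "0 \<le> G" "0 \<le> P" "G \<le> E" "P \<le> E" "0 \<le> \<alpha>" "\<alpha> \<le> r"
  shows "G powr \<alpha> * P powr (r - \<alpha>) \<le> E powr r"
proof -
  have "G powr \<alpha> * P powr (r - \<alpha>) \<le> E powr \<alpha> * E powr (r - \<alpha>)"
    using assms by (intro mult_mono powr_mono2) auto
  also have "\<dots> = E powr r" by (rule powr_mult_eq) simp
  finally show ?thesis .
qed

lemma E_rad_moment_le_gradient:
  fixes b q \<eta> r :: real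
  assumes dim: "2 \<le> CARD('n::finite)" and b: "0 \<le> b" "b < 2" and q: "2 < q"
    and sub: "q * (real CARD('n) - 2) < 2 * (real CARD('n) - b)" and \<eta>: "0 \<le> \<eta>" "\<eta> \<le> b"
    and r: "q + (q + 2) * (b - \<eta>) / (2 * real CARD('n) - 2 - b) \<le> r"
      "CARD('n) = 2 \<or> r \<le> 2 * (real CARD('n) - \<eta>) / (real CARD('n) - 2)"
  shows "\<exists>C>0. \<forall>u\<in>(E_rad b q :: (real^'n \<Rightarrow> real) set). moment \<eta> r u \<le>
    ennreal (C * gradient_norm u powr (gn_weight (real CARD('n)) b q \<eta> r) * potential_norm b q u powr (r - gn_weight (real CARD('n)) b q \<eta> r))"
proof -
  have "gn_inequality TYPE(real^'n) b q \<eta> r (gn_weight (real DIM(real^'n)) b q \<eta> r)"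
    by (rule gn_inequality_radial) (use assms in simp_all)
  from E_rad_gn_inequality[OF dim b q this] show ?thesis by simp
qed

lemma E_rad_moment_le_E_norm:
  fixes b q \<eta> r :: real
  assumes dim: "2 \<le> CARD('n::finite)" and b: "0 \<le> b" "b < 2" and q: "2 < q"
    and sub: "q * (real CARD('n) - 2) < 2 * (real CARD('n) - b)" and \<eta>: "0 \<le> \<eta>" "\<eta> \<le> b"
    and r: "q + (q + 2) * (b - \<eta>) / (2 * real CARD('n) - 2 - b) \<le> r"
      "CARD('n) = 2 \<or> r \<le> 2 * (real CARD('n) - \<eta>) / (real CARD('n) - 2)"
  shows "\<exists>C>0. \<forall>u\<in>(E_rad b q :: (real^'n \<Rightarrow> real) set). moment \<eta> r u \<le> ennreal (C * E_norm b q u powr r)"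
proof -
  let ?\<alpha> = "gn_weight (real CARD('n)) b q \<eta> r"
  obtain C where C: "0 < C" "\<And>u :: real^'n \<Rightarrow> real. u \<in> E_rad b q \<Longrightarrow> moment \<eta> r u \<le>
    ennreal (C * gradient_norm u powr ?\<alpha> * potential_norm b q u powr (r - ?\<alpha>))"
    using E_rad_moment_le_gradient[OF dim b q sub \<eta> r] by blast
  have "0 \<le> ?\<alpha>" "?\<alpha> \<le> r"
    using gn_weight_bounds[OF _ b q sub \<eta> r(1)] dim r(2) by auto
  then have le: "C * gradient_norm u powr ?\<alpha> * potential_norm b q u powr (r - ?\<alpha>) \<le> C * E_norm b q u powr r"
    if "u \<in> E_rad b q" for u :: "real^'n \<Rightarrow> real"
    using C(1) q gradient_norm_le_E_norm[OF E_rad_measurable[OF that]] potential_norm_le_E_norm[OF E_rad_measurable[OF that]]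
    unfolding mult.assoc
    by (intro mult_left_mono powr_interpolate_bound gradient_norm_nonneg potential_norm_nonneg) auto
  show ?thesis
  proof (intro exI[of _ C] conjI ballI C(1))
    fix u :: "real^'n \<Rightarrow> real" assume "u \<in> E_rad b q"
    then show "moment \<eta> r u \<le> ennreal (C * E_norm b q u powr r)"
      by (intro order_trans[OF C(2) ennreal_leI[OF le]])
  qed
qed

lemma E_norm_nonneg: "0 \<le> E_norm b q u"
  by (simp add: E_norm_def)

lemma radial_exponent_pos:
  fixes n b q \<eta> r :: real
  assumes "2 \<le> n" "b < 2" "2 < q" "\<eta> \<le> b" "q + (q + 2) * (b - \<eta>) / (2 * n - 2 - b) \<le> r"
  shows "0 < r"
proof -
  have "0 \<le> (q + 2) * (b - \<eta>) / (2 * n - 2 - b)"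
    using assms by (intro divide_nonneg_pos mult_nonneg_nonneg) auto
  then show ?thesis using assms by linarith
qed

lemma E_rad_continuous_embedding:
  fixes b q \<eta> r :: real
  assumes dim: "2 \<le> CARD('n::finite)" and b: "0 \<le> b" "b < 2" and q: "2 < q"
    and sub: "q * (real CARD('n) - 2) < 2 * (real CARD('n) - b)" and \<eta>: "0 \<le> \<eta>" "\<eta> \<le> b"
    and r: "q + (q + 2) * (b - \<eta>) / (2 * real CARD('n) - 2 - b) \<le> r"
      "CARD('n) = 2 \<or> r \<le> 2 * (real CARD('n) - \<eta>) / (real CARD('n) - 2)"
  shows "continuous_embedding (E_rad b q :: (real ^ 'n \<Rightarrow> real) set) (E_norm b q)
              (Lp_space (weighted_lebesgue \<eta>) r) (Lp_norm (weighted_lebesgue \<eta>) r)"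
proof -
  obtain C where C: "0 < C" "\<And>u :: real^'n \<Rightarrow> real. u \<in> E_rad b q \<Longrightarrow> moment \<eta> r u \<le> ennreal (C * E_norm b q u powr r)"
    using E_rad_moment_le_E_norm[OF assms] by blast
  have rpos: "0 < r" using dim b q \<eta> r by (intro radial_exponent_pos[of "real CARD('n)"]) auto
  have sub1: "u \<in> Lp_space (weighted_lebesgue \<eta>) r" if u: "u \<in> E_rad b q" for u :: "real^'n \<Rightarrow> real"
    using C(2)[OF u] E_rad_measurable[OF u] by (auto simp: Lp_space_weighted_iff intro: le_less_trans)
  have "Lp_norm (weighted_lebesgue \<eta>) r u \<le> C powr (1 / r) * E_norm b q u" if u: "u \<in> E_rad b q" for u :: "real^'n \<Rightarrow> real"
  proof -
    have "enn2real (moment \<eta> r u) \<le> C * E_norm b q u powr r"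
      using C u by (intro enn2real_leI) auto
    then have "enn2real (moment \<eta> r u) powr (1 / r) \<le> (C * E_norm b q u powr r) powr (1 / r)"
      using rpos by (intro powr_mono2) auto
    also have "\<dots> = C powr (1 / r) * E_norm b q u"
      using rpos E_norm_nonneg[of b q u] by (simp add: powr_mult powr_powr)
    finally show ?thesis by (simp add: Lp_norm_weighted[OF E_rad_measurable[OF u]])
  qed
  then show ?thesis using sub1 unfolding continuous_embedding_def by blast
qed

lemma radial_energy_bound_mono:
  assumes "radial_energy_bound u g H D b q Q" "D \<le> D'" "Q \<le> Q'"
  shows "radial_energy_bound u g H D' b q Q'"
proof -
  interpret radial_energy_bound u g H D b q Q by (rule assms(1))
  show ?thesis
  proof
    show "(\<integral>\<^sup>+x. ennreal ((g x)\<^sup>2) \<partial>lborel) \<le> ennreal (D'\<^sup>2)"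
      using assms D_nonneg by (intro order_trans[OF g2] ennreal_leI power_mono) auto
    show "(\<integral>\<^sup>+x. ennreal (\<bar>u x\<bar> powr q * norm x powr - b) \<partial>lborel) \<le> ennreal (Q' powr q)"
      using assms Q_nonneg q by (intro order_trans[OF uq] ennreal_leI powr_mono2) auto
  qed (use assms D_nonneg Q_nonneg prof dim b q in auto)
qed

text \<open>The moments are bounded at the lower endpoint and at some exponent above \<open>r\<close>, and the profiles share a
  decay estimate, so that pointwise convergence of the profiles implies convergence of moments of the intermediate order \<open>r\<close>.\<close>
lemma E_rad_compact_sequence:
  fixes b q \<eta> r :: real and u :: "nat \<Rightarrow> real^'n \<Rightarrow> real"
  assumes dim: "2 \<le> CARD('n::finite)" and b: "0 \<le> b" "b < 2" and q: "2 < q"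
    and sub: "q * (real CARD('n) - 2) < 2 * (real CARD('n) - b)" and \<eta>: "0 \<le> \<eta>" "\<eta> \<le> b"
    and r: "q + (q + 2) * (b - \<eta>) / (2 * real CARD('n) - 2 - b) < r"
      "CARD('n) = 2 \<or> r < 2 * (real CARD('n) - \<eta>) / (real CARD('n) - 2)"
    and u: "\<And>k. u k \<in> E_rad b q" and bdd: "bdd_above (range (\<lambda>k. E_norm b q (u k)))"
  shows "\<exists>v\<in>Lp_space (weighted_lebesgue \<eta>) r. \<exists>\<sigma>. strict_mono \<sigma> \<and>
    (\<lambda>k. Lp_norm (weighted_lebesgue \<eta>) r (\<lambda>x. u (\<sigma> k) x - v x)) \<longlonglongrightarrow> 0"
proof -
  define n where "n = real CARD('n)"
  have n2: "2 \<le> n" using dim by (simp add: n_def)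
  define r0 where "r0 = q + (q + 2) * (b - \<eta>) / (2 * n - 2 - b)"
  (* An admissible exponent above r. *)
  define r1 where "r1 = (if CARD('n) = 2 then r + 1 else 2 * (n - \<eta>) / (n - 2))"
  have r01: "r0 < r" "r < r1" using r by (auto simp: r0_def r1_def n_def)
  have r1': "CARD('n) = 2 \<or> r1 \<le> 2 * (real CARD('n) - \<eta>) / (real CARD('n) - 2)" by (simp add: r1_def n_def)
  have r0pos: "0 < r0" 
    using radial_exponent_pos[OF n2 b(2) q \<eta>(2), of r0] by (simp add: r0_def)
  obtain M0 where "\<And>k. E_norm b q (u k) \<le> M0" using bdd by (auto simp: bdd_above_def)
  then obtain M where M: "\<And>k. E_norm b q (u k) \<le> M" "0 \<le> M" by (meson E_norm_nonneg order_trans)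
  have bound: "\<exists>K\<ge>0. \<forall>k. moment \<eta> s (u k) \<le> ennreal K"
    if s: "r0 \<le> s" "s \<le> r1" for s
  proof -
    have s2: "CARD('n) = 2 \<or> s \<le> 2 * (real CARD('n) - \<eta>) / (real CARD('n) - 2)"
      using s r1' by auto
    have s1: "q + (q + 2) * (b - \<eta>) / (2 * real CARD('n) - 2 - b) \<le> s" using s by (simp add: r0_def n_def)
    obtain C where C: "0 < C" "\<And>u :: real^'n \<Rightarrow> real. u \<in> E_rad b q \<Longrightarrow> moment \<eta> s u \<le> ennreal (C * E_norm b q u powr s)"
      using E_rad_moment_le_E_norm[OF dim b q sub \<eta> s1 s2] by blast
    have "moment \<eta> s (u k) \<le> ennreal (C * M powr s)" for k
      using C s r0pos M by (intro order_trans[OF C(2)[OF u]] ennreal_leI mult_left_mono powr_mono2 E_norm_nonneg) auto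
    then show ?thesis using C by (intro exI[of _ "C * M powr s"]) auto
  qed
  obtain K0 where K0: "0 \<le> K0" "\<And>k. moment \<eta> r0 (u k) \<le> ennreal K0" using bound[of r0] r01 by auto
  obtain K where K: "0 \<le> K" "\<And>k. moment \<eta> r (u k) \<le> ennreal K" using bound[of r] r01 by auto
  obtain K1 where K1: "0 \<le> K1" "\<And>k. moment \<eta> r1 (u k) \<le> ennreal K1" using bound[of r1] r01 by auto
  let ?D = "M / sphere_area CARD('n)"
  have "\<forall>k. \<exists>p. radial_energy_bound (fst p) (fst (snd p)) (snd (snd p)) ?D b q M \<and> (AE x in lebesgue. u k x = fst p x)"
  proof
    fix k
    obtain u' g H where rad: "radial_energy_bound u' g H (gradient_norm (u k) / sphere_area CARD('n)) b q (potential_norm b q (u k))"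
      and ae: "AE x in lebesgue. u k x = u' x"
      by (rule E_rad_profile[OF u[of k] dim b q])
    have "gradient_norm (u k) / sphere_area CARD('n) \<le> ?D"
      using order_trans[OF gradient_norm_le_E_norm[OF E_rad_measurable[OF u[of k]]] M(1)[of k]] q sphere_area_pos[where 'a = "real^'n"]
      by (intro divide_right_mono) auto
    moreover have "potential_norm b q (u k) \<le> M"
      using order_trans[OF potential_norm_le_E_norm[OF E_rad_measurable[OF u[of k]]] M(1)[of k]] q by simp
    ultimately have "radial_energy_bound u' g H ?D b q M" by (rule radial_energy_bound_mono[OF rad])
    then show "\<exists>p. radial_energy_bound (fst p) (fst (snd p)) (snd (snd p)) ?D b q M \<and> (AE x in lebesgue. u k x = fst p x)"
      using ae by (intro exI[of _ "(u', g, H)"]) simp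
  qed
  from choice[OF this] obtain p where p: "\<forall>k. radial_energy_bound (fst (p k)) (fst (snd (p k))) (snd (snd (p k))) ?D b q M \<and> (AE x in lebesgue. u k x = fst (p k) x)" ..
  define w where "w k = fst (p k)" for k
  define g where "g k = fst (snd (p k))" for k
  define H where "H k = snd (snd (p k))" for k
  have rad: "radial_energy_bound (w k) (g k) (H k) ?D b q M" for k using p by (simp add: w_def g_def H_def)
  have uw: "AE x in lebesgue. u k x = w k x" for k using p by (simp add: w_def)
  have wm[measurable]: "w k \<in> borel_measurable borel" for k
    using rad[of k] unfolding radial_energy_bound_def by (blast intro: radial_gradient_bound.u_meas)
  have wH: "AE x in lborel. w k x = H k (norm x)" for k
    using rad[of k] unfolding radial_energy_bound_def by (blast intro: radial_gradient_bound.u_H)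
  obtain \<rho> h where \<rho>: "strict_mono \<rho>" and h: "\<And>s. 0 < s \<Longrightarrow> (\<lambda>k. H (\<rho> k) s) \<longlonglongrightarrow> h s"
    using profile_subsequence[where u = w and g = g and H = H, OF rad] by metis
  (* The limit is known at positive radii only; the value 0 elsewhere makes it Borel measurable. *)
  define h0 where "h0 s = indicator {0<..} s * h s" for s
  have [measurable]: "h0 \<in> borel_measurable borel"
  proof (rule borel_measurable_LIMSEQ_real)
    show "(\<lambda>s. indicator {0<..} s *\<^sub>R H (\<rho> k) s) \<in> borel_measurable borel" for k
    proof (rule borel_measurable_continuous_on_indicator)
      show "continuous_on {0<..} (H (\<rho> k))"
        using rad[of "\<rho> k"] unfolding radial_energy_bound_def
        by (intro continuous_at_imp_continuous_on ballI) (auto intro: radial_gradient_bound.H_continuous)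
    qed simp
    show "(\<lambda>k. indicator {0<..} s *\<^sub>R H (\<rho> k) s) \<longlonglongrightarrow> h0 s" for s
      using h[of s] by (cases "0 < s") (auto simp: h0_def)
  qed
  define v where "v x = h0 (norm x)" for x :: "real^'n"
  have [measurable]: "v \<in> borel_measurable borel" unfolding v_def[abs_def] by measurable
  have "AE x in lborel. \<forall>k. w k x = H k (norm x)" unfolding AE_all_countable using wH by blast
  moreover have "AE x::real^'n in lborel. x \<noteq> 0" by (rule AE_lborel_singleton)
  ultimately have lim: "AE x in lborel. (\<lambda>k. w (\<rho> k) x) \<longlonglongrightarrow> v x"
  proof eventually_elim
    case (elim x)
    then show ?case using h[of "norm x"] by (simp add: v_def h0_def)
  qed
  define A where "A = ((q + 2) / 2 * ?D * M powr (q / 2)) powr (2 / (q + 2))"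
  define \<kappa> where "\<kappa> = (2 * n - 2 - b) / (q + 2)"
  have \<kappa>: "0 < \<kappa>" using n2 b q by (simp add: \<kappa>_def)
  have A: "0 \<le> A" by (simp add: A_def)
  have HA: "\<bar>H k s\<bar> \<le> A * s powr (- \<kappa>)" if "0 < s" for k s
    using radial_energy_bound.radial_bound[OF rad that, of k] by (simp add: A_def \<kappa>_def n_def)
  have hA: "\<bar>h s\<bar> \<le> A * s powr (- \<kappa>)" if "0 < s" for s
    using h[OF that] HA[OF that] by (intro LIMSEQ_le_const2[OF tendsto_rabs]) auto
  have vmom: "moment \<eta> s v \<le> ennreal L" if s: "0 < s" and L: "\<And>k. moment \<eta> s (u k) \<le> ennreal L" for s L
    unfolding moment_def
  proof (rule nn_integral_le_of_limit[where f = "\<lambda>k x. ennreal (\<bar>w (\<rho> k) x\<bar> powr s * norm x powr (- \<eta>))"])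
    show "AE x in lborel. (\<lambda>k. ennreal (\<bar>w (\<rho> k) x\<bar> powr s * norm x powr (- \<eta>))) \<longlonglongrightarrow> ennreal (\<bar>v x\<bar> powr s * norm x powr (- \<eta>))"
      using lim
    proof eventually_elim
      case (elim x)
      then show ?case using s by (intro tendsto_ennrealI tendsto_mult tendsto_const tendsto_powr' tendsto_rabs) auto
    qed
    show "(\<integral>\<^sup>+x. ennreal (\<bar>w (\<rho> k) x\<bar> powr s * norm x powr (- \<eta>)) \<partial>lborel) \<le> ennreal L" for k
      using L[of "\<rho> k"] unfolding moment_def[symmetric] moment_cong_AE[OF uw[of "\<rho> k"]] .
  qed measurable
  have dmom: "moment \<eta> s (\<lambda>x. w (\<rho> k) x - v x) \<le> ennreal (2 powr s * (L + L))"
    if s: "0 < s" and L: "0 \<le> L" "\<And>k. moment \<eta> s (u k) \<le> ennreal L" for s L k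
  proof -
    have "moment \<eta> s (\<lambda>x. w (\<rho> k) x - v x) \<le> ennreal (2 powr s) * (moment \<eta> s (w (\<rho> k)) + moment \<eta> s v)"
      by (rule moment_diff_le[OF _ _ s]) (rule measurable_completion, simp)+
    also have "\<dots> \<le> ennreal (2 powr s) * (ennreal L + ennreal L)"
      using L(2)[of "\<rho> k"] unfolding moment_cong_AE[OF uw[of "\<rho> k"]]
      by (intro mult_left_mono add_mono vmom s L(2)) auto
    also have "\<dots> = ennreal (2 powr s * (L + L))"
      by (subst ennreal_mult) (use L in \<open>simp_all add: ennreal_plus[symmetric] del: ennreal_plus\<close>)
    finally show ?thesis .
  qed
  have "(\<lambda>k. moment \<eta> r (\<lambda>x. w (\<rho> k) x - v x)) \<longlonglongrightarrow> 0"
  proof (rule moment_tendsto_zero[where B = "2 * A" and \<kappa> = \<kappa>])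
    show "AE x in lborel. (\<lambda>k. w (\<rho> k) x - v x) \<longlonglongrightarrow> 0"
      using lim by eventually_elim (rule LIM_zero)
    show "moment \<eta> r0 (\<lambda>x. w (\<rho> k) x - v x) \<le> ennreal (2 powr r0 * (K0 + K0))" for k
      by (rule dmom[OF r0pos K0])
    show "moment \<eta> r1 (\<lambda>x. w (\<rho> k) x - v x) \<le> ennreal (2 powr r1 * (K1 + K1))" for k
      by (rule dmom[OF _ K1]) (use r0pos r01 in linarith)
    show "AE x in lborel. \<bar>w (\<rho> k) x - v x\<bar> \<le> 2 * A * norm x powr (- \<kappa>)" for k
      using wH[of "\<rho> k"] AE_lborel_singleton[of 0]
    proof eventually_elim
      case (elim x)
      then have "\<bar>w (\<rho> k) x\<bar> \<le> A * norm x powr (- \<kappa>)" "\<bar>v x\<bar> \<le> A * norm x powr (- \<kappa>)"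
        using HA[of "norm x" "\<rho> k"] hA[of "norm x"] by (auto simp: v_def h0_def)
      then show ?case by linarith
    qed
  qed (use r0pos r01 \<kappa> A K0 K1 \<eta> b n2 in \<open>auto simp: n_def\<close>)
  then have "(\<lambda>k. enn2real (moment \<eta> r (\<lambda>x. w (\<rho> k) x - v x))) \<longlonglongrightarrow> 0"
    using tendsto_enn2real[of "\<lambda>k. moment \<eta> r (\<lambda>x. w (\<rho> k) x - v x)" 0] by simp
  then have l: "(\<lambda>k. enn2real (moment \<eta> r (\<lambda>x. w (\<rho> k) x - v x)) powr (1 / r)) \<longlonglongrightarrow> 0"
    using r0pos r01 by (intro tendsto_zero_powrI[where b = "1 / r"]) auto
  have vm: "v \<in> borel_measurable lebesgue" by (rule measurable_completion) simp
  have "Lp_norm (weighted_lebesgue \<eta>) r (\<lambda>x. u (\<rho> k) x - v x) = enn2real (moment \<eta> r (\<lambda>x. w (\<rho> k) x - v x)) powr (1 / r)" for k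
  proof -
    have "moment \<eta> r (\<lambda>x. u (\<rho> k) x - v x) = moment \<eta> r (\<lambda>x. w (\<rho> k) x - v x)"
      by (rule moment_cong_AE) (use uw[of "\<rho> k"] in eventually_elim, simp)
    then show ?thesis
      using E_rad_measurable[OF u] vm by (subst Lp_norm_weighted) auto
  qed
  then have "(\<lambda>k. Lp_norm (weighted_lebesgue \<eta>) r (\<lambda>x. u (\<rho> k) x - v x)) \<longlonglongrightarrow> 0" using l by simp
  moreover have "v \<in> Lp_space (weighted_lebesgue \<eta>) r"
    using vmom[OF _ K(2)] r0pos r01 vm by (auto simp: Lp_space_weighted_iff intro: le_less_trans)
  ultimately show ?thesis using \<rho> by blast
qed

section \<open>Weak gradients of differentiable functions\<close>

text \<open>The difference quotients have integral \<open>0\<close> by translation invariance, and they converge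
  boundedly, on a fixed ball, to the partial derivative.\<close>
lemma integral_partial_derivative_zero:
  fixes f :: "real^'n \<Rightarrow> real"
  assumes f: "has_partials f D" and D: "continuous_on UNIV (D i)"
    and supp: "\<And>x. R < norm x \<Longrightarrow> f x = 0" "\<And>x. R < norm x \<Longrightarrow> D i x = 0"
  shows "(LINT x|lborel. D i x) = 0"
proof -
  obtain B where B: "\<And>x. \<bar>D i x\<bar> \<le> B"
    using continuous_bounded_support[OF D supp(2)] by blast
  have [measurable]: "f \<in> borel_measurable borel" "D i \<in> borel_measurable borel"
    using has_partials_continuous[OF f] D by (auto intro: borel_measurable_continuous_onI)
  have int: "integrable lborel f"
  proof -
    obtain B' where B': "\<And>x. \<bar>f x\<bar> \<le> B'"
      using continuous_bounded_support[OF has_partials_continuous[OF f] supp(1)] by blast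
    show ?thesis
      by (rule integrableI_bounded_set[where A = "cball 0 R" and B = B'])
         (use B' supp(1) emeasure_bounded_finite[OF bounded_cball] in \<open>auto simp: not_le intro!: AE_I2\<close>)
  qed
  define e where "e = (axis i 1 :: real^'n)"
  have ne: "norm e = 1" by (simp add: e_def)
  have line: "((\<lambda>t. f (x + t *\<^sub>R e)) has_real_derivative D i (x + t *\<^sub>R e)) (at t)" for x t
  proof -
    have "((\<lambda>t. x + t *\<^sub>R e) has_derivative (\<lambda>h. h *\<^sub>R e)) (at t)"
      by (auto intro!: derivative_eq_intros)
    from has_derivative_compose[OF this, of f "\<lambda>v. \<Sum>j\<in>UNIV. D j (x + t *\<^sub>R e) * v $ j"] f
    have "((\<lambda>t. f (x + t *\<^sub>R e)) has_derivative (\<lambda>h. \<Sum>j\<in>UNIV. D j (x + t *\<^sub>R e) * (h *\<^sub>R e) $ j)) (at t)"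
      by (simp add: has_partials_def)
    moreover have "(\<Sum>j\<in>UNIV. D j (x + t *\<^sub>R e) * (h *\<^sub>R e) $ j) = D i (x + t *\<^sub>R e) * h" for h
      by (simp add: e_def axis_def if_distrib[of "\<lambda>x. _ * x"] cong: if_cong)
    ultimately show ?thesis by (simp add: has_field_derivative_def)
  qed
  define t where "t k = 1 / real (Suc k)" for k
  have t: "0 < t k" "t k \<le> 1" for k by (auto simp: t_def)
  define F where "F k x = (f (x + t k *\<^sub>R e) - f x) / t k" for k x
  have [measurable]: "F k \<in> borel_measurable borel" for k unfolding F_def[abs_def] by measurable
  have F0: "(LINT x|lborel. F k x) = 0" for k
  proof -
    have tr: "distr lborel borel ((+) (t k *\<^sub>R e)) = (lborel :: (real^'n) measure)" by (rule lborel_distr_plus)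
    have "(LINT x|lborel. f (t k *\<^sub>R e + x)) = integral\<^sup>L (distr lborel borel ((+) (t k *\<^sub>R e))) f"
      by (subst integral_distr) auto
    then have e1: "(LINT x|lborel. f (x + t k *\<^sub>R e)) = integral\<^sup>L lborel f" by (simp add: tr add.commute)
    have "integrable (distr lborel borel ((+) (t k *\<^sub>R e))) f" using int by (simp add: tr)
    then have "integrable lborel (\<lambda>x. f (x + t k *\<^sub>R e))" by (subst (asm) integrable_distr_eq) (auto simp: add.commute)
    then show ?thesis using int e1 unfolding F_def by simp
  qed
  have "(\<lambda>k. LINT x|lborel. F k x) \<longlonglongrightarrow> (LINT x|lborel. D i x)"
  proof (rule integral_dominated_convergence[where w = "\<lambda>x. B * indicator (cball 0 (R + 1)) x"])
    show "integrable lborel (\<lambda>x. B * indicator (cball 0 (R + 1)) x :: real)"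
      using emeasure_bounded_finite[OF bounded_cball] by (intro integrable_mult_right integrable_real_indicator) auto
    show "AE x in lborel. (\<lambda>k. F k x) \<longlonglongrightarrow> D i x"
    proof (rule AE_I2)
      fix x
      have "((\<lambda>h. (f (x + (0 + h) *\<^sub>R e) - f (x + 0 *\<^sub>R e)) / h) \<longlongrightarrow> D i (x + 0 *\<^sub>R e)) (at 0)"
        using line[of x 0] by (simp add: DERIV_def)
      then have l: "((\<lambda>h. (f (x + h *\<^sub>R e) - f x) / h) \<longlongrightarrow> D i x) (at 0)" by simp
      have "filterlim t (at 0) sequentially"
        unfolding t_def[abs_def] by (rule filterlim_atI[OF LIMSEQ_Suc[OF lim_1_over_n]]) simp
      from filterlim_compose[OF l this] show "(\<lambda>k. F k x) \<longlonglongrightarrow> D i x" by (simp add: F_def)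
    qed
    show "AE x in lborel. norm (F k x) \<le> B * indicator (cball 0 (R + 1)) x" for k
    proof (rule AE_I2)
      fix x
      show "norm (F k x) \<le> B * indicator (cball 0 (R + 1)) x"
      proof (cases "x \<in> cball 0 (R + 1)")
        case True
        obtain z where "f (x + t k *\<^sub>R e) - f (x + 0 *\<^sub>R e) = (t k - 0) * D i (x + z *\<^sub>R e)"
          using MVT2[OF t(1)[of k], of "\<lambda>s. f (x + s *\<^sub>R e)" "\<lambda>s. D i (x + s *\<^sub>R e)"] line by blast
        then have "F k x = D i (x + z *\<^sub>R e)" using t(1)[of k] by (simp add: F_def)
        then show ?thesis using True B by simp
      next
        case False
        then have x: "R + 1 < norm x" by simp
        have "norm x \<le> norm (x + t k *\<^sub>R e) + norm (t k *\<^sub>R e)"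
          using norm_triangle_ineq4[of "x + t k *\<^sub>R e" "t k *\<^sub>R e"] by simp
        then have "R < norm (x + t k *\<^sub>R e)" using x t[of k] ne by simp
        then show ?thesis using False supp(1) x by (simp add: F_def)
      qed
    qed
  qed measurable
  then show ?thesis using F0 by (simp add: LIMSEQ_const_iff)
qed

lemma test_function_has_partials:
  assumes "\<phi> \<in> test_functions"
  shows "has_partials \<phi> (\<lambda>i. partial_deriv i \<phi>)" and "continuous_on UNIV (partial_deriv i \<phi>)"
proof -
  have C1: "C_k (Suc 0) \<phi>" using assms unfolding test_functions_def by blast
  then show "continuous_on UNIV (partial_deriv i \<phi>)" by simp
  have diff: "\<phi> differentiable (at x)" for x using C1 by (simp add: differentiable_on_def)
  show "has_partials \<phi> (\<lambda>i. partial_deriv i \<phi>)"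
    unfolding has_partials_def
  proof
    fix x
    have d: "(\<phi> has_derivative frechet_derivative \<phi> (at x)) (at x)"
      using diff frechet_derivative_works by blast
    have lin: "linear (frechet_derivative \<phi> (at x))" using d has_derivative_linear by blast
    have "frechet_derivative \<phi> (at x) v = (\<Sum>i\<in>UNIV. partial_deriv i \<phi> x * v $ i)" for v
    proof -
      have "frechet_derivative \<phi> (at x) v = frechet_derivative \<phi> (at x) (\<Sum>i\<in>UNIV. (v $ i) *\<^sub>R axis i 1)"
        by (simp add: basis_expansion[of v, unfolded scalar_mult_eq_scaleR])
      also have "\<dots> = (\<Sum>i\<in>UNIV. frechet_derivative \<phi> (at x) ((v $ i) *\<^sub>R axis i 1))"
        by (rule linear_sum[OF lin])
      also have "\<dots> = (\<Sum>i\<in>UNIV. partial_deriv i \<phi> x * v $ i)"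
        by (simp add: linear_scale[OF lin] partial_deriv_def mult.commute)
      finally show ?thesis .
    qed
    then have "frechet_derivative \<phi> (at x) = (\<lambda>v. \<Sum>i\<in>UNIV. partial_deriv i \<phi> x * v $ i)" by blast
    then show "(\<phi> has_derivative (\<lambda>v. \<Sum>i\<in>UNIV. partial_deriv i \<phi> x * v $ i)) (at x)" using d by simp
  qed
qed

lemma continuous_locally_integrable:
  fixes f :: "real^'n \<Rightarrow> real"
  assumes "continuous_on UNIV f"
  shows "locally_integrable f"
  unfolding locally_integrable_def set_integrable_def
proof (intro allI impI)
  fix K :: "(real^'n) set" assume "compact K"
  then have i: "integrable lborel (\<lambda>x. indicator K x *\<^sub>R f x)"
    using assms by (intro borel_integrable_compact) (auto intro: continuous_on_subset)
  then have "(\<lambda>x. indicator K x *\<^sub>R f x) \<in> borel_measurable lborel" by (rule borel_measurable_integrable)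
  with i show "integrable lebesgue (\<lambda>x. indicator K x *\<^sub>R f x)"
    by (subst integrable_completion) auto
qed

lemma has_weak_gradient_classical:
  fixes u :: "real^'n \<Rightarrow> real"
  assumes u: "has_partials u D" and D: "\<And>i. continuous_on UNIV (D i)"
    and supp: "\<And>x. R < norm x \<Longrightarrow> u x = 0" "\<And>i x. R < norm x \<Longrightarrow> D i x = 0"
  shows "has_weak_gradient u (\<lambda>x. \<chi> i. D i x)"
  unfolding has_weak_gradient_def
proof (intro conjI allI ballI)
  have uc: "continuous_on UNIV u" by (rule has_partials_continuous[OF u])
  show "locally_integrable u" by (rule continuous_locally_integrable[OF uc])
  show "locally_integrable (\<lambda>x. (\<chi> i. D i x) $ i)" for i
    using continuous_locally_integrable[OF D] by simp
  fix \<phi> :: "real^'n \<Rightarrow> real" and i assume \<phi>: "\<phi> \<in> test_functions"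
  have pc: "continuous_on UNIV \<phi>" by (rule test_function_continuous[OF \<phi>])
  note p\<phi> = test_function_has_partials[OF \<phi>]
  have "(LINT x|lborel. D i x * \<phi> x + u x * partial_deriv i \<phi> x) = 0"
  proof (rule integral_partial_derivative_zero[where i = i and R = R])
    show "has_partials (\<lambda>x. u x * \<phi> x) (\<lambda>i x. D i x * \<phi> x + u x * partial_deriv i \<phi> x)"
      by (rule has_partials_mult[OF u p\<phi>(1)])
    show "continuous_on UNIV (\<lambda>x. D i x * \<phi> x + u x * partial_deriv i \<phi> x)"
      by (intro continuous_intros D uc pc p\<phi>(2))
  qed (simp_all add: supp)
  moreover have "(\<lambda>x. D i x * \<phi> x + u x * partial_deriv i \<phi> x) \<in> borel_measurable borel"
    by (intro borel_measurable_continuous_onI continuous_intros D uc pc p\<phi>(2))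
  ultimately have z: "(LINT x|lebesgue. D i x * \<phi> x + u x * partial_deriv i \<phi> x) = 0"
    by (simp add: integral_completion)
  have i1: "integrable lebesgue (\<lambda>x. \<phi> x * D i x)"
    by (rule locally_integrable_mult_continuous[OF continuous_locally_integrable[OF pc] D supp(2)])
  have i2: "integrable lebesgue (\<lambda>x. partial_deriv i \<phi> x * u x)"
    by (rule locally_integrable_mult_continuous[OF continuous_locally_integrable[OF p\<phi>(2)] uc supp(1)])
  have "(LINT x|lebesgue. D i x * \<phi> x + u x * partial_deriv i \<phi> x) =
     (LINT x|lebesgue. D i x * \<phi> x) + (LINT x|lebesgue. u x * partial_deriv i \<phi> x)"
    using i1 i2 by (intro Bochner_Integration.integral_add) (simp_all add: mult.commute)
  then show "(LINT x|lebesgue. u x * partial_deriv i \<phi> x) = - (LINT x|lebesgue. (\<chi> i. D i x) $ i * \<phi> x)"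
    using z by simp
qed

lemma flat_2_le: "flat 2 t \<le> 2"
proof (cases "0 < t")
  case True
  have "1 + inverse t + (inverse t)\<^sup>2 / 2 \<le> exp (inverse t)" using True by (intro exp_lower_Taylor_quadratic) simp
  then have "(inverse t)\<^sup>2 \<le> 2 * exp (inverse t)" 
  proof -
    assume "1 + inverse t + (inverse t)\<^sup>2 / 2 \<le> exp (inverse t)"
    moreover have "0 \<le> inverse t" using True by simp
    ultimately show ?thesis by linarith
  qed
  then have "(inverse t)\<^sup>2 * exp (- inverse t) \<le> 2 * exp (inverse t) * exp (- inverse t)"
    by (intro mult_right_mono) auto
  also have "\<dots> = 2" by (simp add: exp_minus)
  finally show ?thesis using True by (simp add: flat_def)
qed simp

lemma flat_nonneg: "0 \<le> flat m t"
  by (simp add: flat_def)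

definition unit_bump_deriv :: "real \<Rightarrow> real" where
  "unit_bump_deriv t = flat 2 (t + 1) * flat 0 (1 - t) - flat 0 (t + 1) * flat 2 (1 - t)"

lemma unit_bump_deriv_derivative: "(bump 1 (-1) 1 has_real_derivative unit_bump_deriv t) (at t)"
proof -
  have f0: "(flat 0 has_real_derivative flat 2 t) (at t)" for t
    using flat_has_derivative[of 0 t] by (simp add: numeral_2_eq_2)
  have 1: "((\<lambda>t. flat 0 (t + 1)) has_real_derivative flat 2 (t + 1) * 1) (at t)"
    by (rule DERIV_chain2[OF f0]) (auto intro!: derivative_eq_intros)
  have 2: "((\<lambda>t. flat 0 (1 - t)) has_real_derivative flat 2 (1 - t) * (- 1)) (at t)"
    by (rule DERIV_chain2[OF f0]) (auto intro!: derivative_eq_intros)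
  show ?thesis using DERIV_mult[OF 1 2] by (simp add: bump_def[abs_def] unit_bump_deriv_def mult.commute)
qed

lemma unit_bump_deriv_bound: "\<bar>unit_bump_deriv t\<bar> \<le> 2"
proof -
  have le: "flat 2 s * flat 0 s' \<le> 2 * 1" for s s'
    by (intro mult_mono flat_2_le flat_0_bounds flat_nonneg) auto
  have "0 \<le> flat 2 s * flat 0 s'" for s s' by (intro mult_nonneg_nonneg flat_nonneg)
  from this[of "t + 1" "1 - t"] this[of "1 - t" "t + 1"] le[of "t + 1" "1 - t"] le[of "1 - t" "t + 1"]
  show ?thesis unfolding unit_bump_deriv_def mult.commute[of "flat 0 (t + 1)"] by linarith
qed

lemma unit_bump_deriv_outside: "t \<notin> {-1<..<1} \<Longrightarrow> unit_bump_deriv t = 0"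
  by (auto simp: unit_bump_deriv_def)

lemma bump_ge:
  assumes "\<bar>t\<bar> \<le> 1 / 2"
  shows "exp (-4) \<le> bump 1 (-1) 1 t"
proof -
  have f: "exp (-2) \<le> flat 0 s" if "1 / 2 \<le> s" for s
  proof -
    have "inverse s \<le> 2" using that le_imp_inverse_le[of "1 / 2" s] by simp
    then show ?thesis using that by (simp add: flat_def)
  qed
  have "exp (-2) * exp (-2) \<le> flat 0 (t + 1) * flat 0 (1 - t)"
    using assms by (intro mult_mono f flat_nonneg) auto
  then show ?thesis by (simp add: bump_def exp_add[symmetric])
qed

section \<open>Bumps on annuli\<close>

lemma annulus_power_upper:
  fixes R w :: real
  assumes N: "2 \<le> N" and R: "0 < R" and w: "0 < w" "w \<le> R / 2"
  shows "sqrt (R\<^sup>2 + w * R) ^ N - sqrt (R\<^sup>2 - w * R) ^ N \<le> real N * 2 ^ N * (w * R ^ (N - 1))"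
proof -
  let ?a = "sqrt (R\<^sup>2 + w * R)" and ?b = "sqrt (R\<^sup>2 - w * R)"
  have wR: "0 < w * R" "w * R \<le> R\<^sup>2 / 2" using R w by (auto simp: power2_eq_square)
  have b0: "0 \<le> R\<^sup>2 - w * R" using wR zero_le_power2[of R] by linarith
  have aR: "R \<le> ?a" using wR R by (intro real_le_rsqrt) simp
  have a2R: "?a \<le> 2 * R" using wR R by (intro real_le_lsqrt) (auto simp: power2_eq_square)
  have ba: "?b \<le> ?a" using wR by (intro real_sqrt_le_mono) simp
  have apos: "0 < ?a" using aR R by linarith
  have "(?a - ?b) * (?a + ?b) = 2 * (w * R)"
  proof -
    have "(?a - ?b) * (?a + ?b) = ?a\<^sup>2 - ?b\<^sup>2" by (simp add: power2_eq_square algebra_simps)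
    also have "?a\<^sup>2 = R\<^sup>2 + w * R" using wR b0 by simp
    also have "?b\<^sup>2 = R\<^sup>2 - w * R" using b0 by simp
    finally show ?thesis by simp
  qed
  then have "(?a - ?b) * (?a + ?b) = 2 * w * R" by simp
  moreover have "(?a - ?b) * R \<le> (?a - ?b) * (?a + ?b)"
    using ba aR b0 by (intro mult_left_mono) (auto intro: order_trans[of R ?a])
  ultimately have "(?a - ?b) * R \<le> (2 * w) * R" by simp
  then have ab: "?a - ?b \<le> 2 * w" using R by simp
  have pw: "x powr real N = x ^ N" if "0 \<le> x" for x :: real
    using that N by (cases "x = 0") (auto simp: powr_realpow)
  have "?a ^ N - ?b ^ N = ?a powr real N - ?b powr real N"
    using apos b0 by (simp add: pw)
  also have "\<dots> \<le> real N * ?a powr (real N - 1) * (?a - ?b)"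
    using ba b0 N by (intro powr_diff_le) auto
  also have "?a powr (real N - 1) = ?a ^ (N - 1)"
    using apos N powr_realpow[OF apos, of "N - 1"] by (simp add: of_nat_diff)
  also have "real N * ?a ^ (N - 1) * (?a - ?b) \<le> real N * (2 * R) ^ (N - 1) * (2 * w)"
    using ab a2R apos ba R by (intro mult_mono power_mono) auto
  also have "\<dots> = real N * 2 ^ N * (w * R ^ (N - 1))"
  proof -
    have "(2::real) ^ N = 2 * 2 ^ (N - 1)" using N by (simp add: power_eq_if)
    then show ?thesis by (simp add: power_mult_distrib)
  qed
  finally show ?thesis .
qed

lemma annulus_power_lower:
  fixes R s :: real
  assumes N: "2 \<le> N" and R: "0 < R" and s: "0 < s" "s \<le> R\<^sup>2 / 2"
  shows "R ^ (N - 2) * (2 * s) \<le> sqrt (R\<^sup>2 + s) ^ N - sqrt (R\<^sup>2 - s) ^ N"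
proof -
  let ?a = "sqrt (R\<^sup>2 + s)" and ?b = "sqrt (R\<^sup>2 - s)"
  have b0: "0 \<le> R\<^sup>2 - s" using s zero_le_power2[of R] by linarith
  have aR: "R \<le> ?a" using s by (intro real_le_rsqrt) simp
  have ba: "?b \<le> ?a" using s by (intro real_sqrt_le_mono) simp
  have pN: "x ^ N = x ^ (N - 2) * x\<^sup>2" for x :: real
  proof -
    have "x ^ N = x ^ ((N - 2) + 2)" using N by (simp only: le_add_diff_inverse2)
    then show ?thesis by (simp only: power_add)
  qed
  have sq: "?a\<^sup>2 = R\<^sup>2 + s" "?b\<^sup>2 = R\<^sup>2 - s" using s b0 by auto
  have "?b ^ N \<le> ?a ^ (N - 2) * (R\<^sup>2 - s)"
    unfolding pN[of ?b] sq using ba b0 by (intro mult_right_mono power_mono) auto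
  moreover have "?a ^ N = ?a ^ (N - 2) * (R\<^sup>2 + s)" unfolding pN[of ?a] sq ..
  moreover have "R ^ (N - 2) * (2 * s) \<le> ?a ^ (N - 2) * (2 * s)"
    using aR R s by (intro mult_right_mono power_mono) auto
  ultimately show ?thesis by (simp add: algebra_simps)
qed

text \<open>A bump of height \<open>h\<close> on an annulus of radius \<open>R\<close> whose width is comparable to \<open>w\<close>.  The squared norm keeps it in the
  class \<open>smooth_gen\<close>.\<close>
definition annular_bump :: "real \<Rightarrow> real \<Rightarrow> real \<Rightarrow> real^'n \<Rightarrow> real" where
  "annular_bump R w h x = h * bump 1 (-1) 1 (((norm x)\<^sup>2 - R\<^sup>2) / (w * R))"

context
  fixes R w h :: real
  assumes R: "0 < R" and w: "0 < w" "w \<le> R / 2" and h: "0 < h"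
begin

lemma annular_bump_support:
  fixes x :: "real^'n"
  assumes "((norm x)\<^sup>2 - R\<^sup>2) / (w * R) \<in> {-1<..<1}"
  shows "sqrt (R\<^sup>2 - w * R) < norm x" "norm x \<le> sqrt (R\<^sup>2 + w * R)" "R / 2 < norm x" "norm x < 2 * R"
proof -
  have wR: "0 < w * R" "w * R \<le> R\<^sup>2 / 2" using R w by (auto simp: power2_eq_square)
  have "- (w * R) < (norm x)\<^sup>2 - R\<^sup>2" "(norm x)\<^sup>2 - R\<^sup>2 < w * R"
    using assms wR by (auto simp: less_divide_eq divide_less_eq)
  then have x: "R\<^sup>2 - w * R < (norm x)\<^sup>2" "(norm x)\<^sup>2 < R\<^sup>2 + w * R" by auto
  show "sqrt (R\<^sup>2 - w * R) < norm x" using x by (intro real_less_lsqrt) auto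
  show "norm x \<le> sqrt (R\<^sup>2 + w * R)" using x by (intro real_le_rsqrt) auto
  have R2: "0 < R\<^sup>2" using R by simp
  have "(R / 2)\<^sup>2 < (norm x)\<^sup>2" using x wR R2 by (simp add: power_divide)
  then show "R / 2 < norm x" by (rule power_less_imp_less_base) simp
  have "(norm x)\<^sup>2 < (2 * R)\<^sup>2" using x wR R2 by (simp add: power_mult_distrib)
  then show "norm x < 2 * R" by (rule power_less_imp_less_base) (use R in simp)
qed

lemma annular_bump_nonzero:
  "annular_bump R w h x \<noteq> 0 \<Longrightarrow> ((norm x)\<^sup>2 - R\<^sup>2) / (w * R) \<in> {-1<..<1}"
  unfolding annular_bump_def using bump_outside[of "((norm x)\<^sup>2 - R\<^sup>2) / (w * R)" "-1" 1 1] by (metis mult_zero_right)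

definition annular_gradient :: "'n \<Rightarrow> real^'n \<Rightarrow> real" where
  "annular_gradient i x = h * (unit_bump_deriv (((norm x)\<^sup>2 - R\<^sup>2) / (w * R)) * (1 / (w * R) * (2 * x $ i)))"

lemma annular_bump_partials:
  "has_partials (annular_bump R w h :: real^'n \<Rightarrow> real) annular_gradient"
proof -
  have "has_partials (\<lambda>x::real^'n. 1 / (w * R) * (norm x)\<^sup>2 + (- R\<^sup>2 / (w * R)))
     (\<lambda>i x. (0 * (norm x)\<^sup>2 + 1 / (w * R) * (2 * x $ i)) + 0)"
    by (rule has_partials_add[OF has_partials_mult[OF has_partials_const has_partials_norm_squared] has_partials_const])
  then have p: "has_partials (\<lambda>x::real^'n. ((norm x)\<^sup>2 - R\<^sup>2) / (w * R)) (\<lambda>i x. 1 / (w * R) * (2 * x $ i))"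
    by (simp add: diff_divide_distrib)
  show ?thesis
    using has_partials_mult[OF has_partials_const[of h] has_partials_comp[OF p unit_bump_deriv_derivative]]
    by (simp add: annular_bump_def[abs_def] annular_gradient_def[abs_def])
qed

lemma annular_bump_smooth: "smooth_gen (annular_bump R w h :: real^'n \<Rightarrow> real)"
proof -
  have "smooth_gen (\<lambda>x::real^'n. h * bump 1 (-1) 1 (1 / (w * R) * ((norm x)\<^sup>2 - R\<^sup>2)))"
    by (rule smooth_gen.mult[OF smooth_gen.const smooth_gen_bump[OF smooth_gen.mult[OF smooth_gen.const
          smooth_gen_minus[OF smooth_gen_norm_squared smooth_gen.const]]]])
  then show ?thesis by (simp add: annular_bump_def[abs_def])
qed

lemma annular_bump_weak_gradient:
  "has_weak_gradient (annular_bump R w h :: real^'n \<Rightarrow> real) (\<lambda>x. \<chi> i. annular_gradient i x)"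
proof (rule has_weak_gradient_classical[OF annular_bump_partials, where R = "2 * R"])
  obtain D where D: "has_partials (annular_bump R w h :: real^'n \<Rightarrow> real) D" "\<And>i. smooth_gen (D i)"
    using smooth_gen_has_partials[OF annular_bump_smooth] by blast
  show "continuous_on UNIV (annular_gradient i :: real^'n \<Rightarrow> real)" for i
    using smooth_gen_continuous[OF D(2)[of i]] has_partials_partial_deriv[OF D(1), of i]
      has_partials_partial_deriv[OF annular_bump_partials, of i] by simp
  have out: "((norm x)\<^sup>2 - R\<^sup>2) / (w * R) \<notin> {-1<..<1}" if "2 * R < norm x" for x :: "real^'n"
    using annular_bump_support(4)[of x] that by linarith
  show "annular_bump R w h x = 0" if "2 * R < norm x" for x :: "real^'n"
    using annular_bump_nonzero[of x] out[OF that] by blast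
  show "annular_gradient i x = 0" if "2 * R < norm x" for i and x :: "real^'n"
    using unit_bump_deriv_outside[OF out[OF that]] by (simp add: annular_gradient_def)
qed

text \<open>The annulus has a volume of order \<open>w * R ^ (N - 1)\<close>, on it \<open>norm x\<close> is comparable to \<open>R\<close>, and the gradient is of
  order \<open>h / w\<close>.\<close>
lemma annular_bump_norms:
  fixes b q :: real
  assumes dim: "2 \<le> CARD('n::finite)" and b: "0 \<le> b" and q: "2 < q"
  defines "u \<equiv> annular_bump R w h :: real^'n \<Rightarrow> real"
    and "V \<equiv> unit_ball_vol (real CARD('n)) * (real CARD('n) * 2 ^ CARD('n))"
  shows "u \<in> E_rad b q"
    and "(gradient_norm u)\<^sup>2 \<le> 64 * V * (h\<^sup>2 * R ^ (CARD('n) - 1) / w)"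
    and "moment b q u \<le> ennreal (2 powr b * V * (h powr q * R powr (real CARD('n) - 1 - b) * w))"
proof -
  let ?N = "CARD('n)"
  have wR: "0 < w * R" "w * R \<le> R\<^sup>2 / 2" using R w by (auto simp: power2_eq_square)
  have V: "0 \<le> V" unfolding V_def by (intro mult_nonneg_nonneg unit_ball_vol_nonneg) auto
  let ?a = "sqrt (R\<^sup>2 + w * R)" and ?b = "sqrt (R\<^sup>2 - w * R)"
  have ba: "0 \<le> ?b" "?b \<le> ?a" using wR zero_le_power2[of R] by (auto intro!: real_sqrt_ge_zero)
  define A where "A = {x::real^'n. ?b < norm x \<and> norm x \<le> ?a}"
  have mA[measurable]: "A \<in> sets borel" unfolding A_def by measurable
  have vol: "emeasure lborel A \<le> ennreal (V * (w * R ^ (?N - 1)))"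
  proof -
    have "emeasure lborel A = ennreal (unit_ball_vol (real ?N) * (?a ^ ?N - ?b ^ ?N))"
      using emeasure_annulus[OF ba, where 'a = "real^'n"] by (simp add: A_def)
    also have "\<dots> \<le> ennreal (V * (w * R ^ (?N - 1)))"
    proof (rule ennreal_leI)
      have "unit_ball_vol (real ?N) * (?a ^ ?N - ?b ^ ?N) \<le> unit_ball_vol (real ?N) * (real ?N * 2 ^ ?N * (w * R ^ (?N - 1)))"
        by (rule mult_left_mono[OF annulus_power_upper[OF dim R w] unit_ball_vol_nonneg]) simp
      then show "unit_ball_vol (real ?N) * (?a ^ ?N - ?b ^ ?N) \<le> V * (w * R ^ (?N - 1))"
        by (simp only: V_def mult.assoc)
    qed
    finally show ?thesis .
  qed
  have A1: "x \<in> A" if "((norm x)\<^sup>2 - R\<^sup>2) / (w * R) \<in> {-1<..<1}" for x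
    using annular_bump_support[OF that] by (simp add: A_def)
  have int_le: "(\<integral>\<^sup>+x. ennreal (f x) \<partial>lborel) \<le> ennreal (c * (V * (w * R ^ (?N - 1))))"
    if c: "0 \<le> c" and f: "\<And>x. f x \<le> c * indicator A x" for f :: "real^'n \<Rightarrow> real" and c
  proof -
    have "(\<integral>\<^sup>+x. ennreal (f x) \<partial>lborel) \<le> (\<integral>\<^sup>+x. ennreal c * indicator A x \<partial>lborel)"
      using f by (intro nn_integral_mono) (metis ennreal_indicator ennreal_leI ennreal_mult' mult.commute indicator_pos_le)
    also have "\<dots> = ennreal c * emeasure lborel A" by (rule nn_integral_cmult_indicator) simp
    also have "\<dots> \<le> ennreal c * ennreal (V * (w * R ^ (?N - 1)))" by (intro mult_left_mono vol) simp
    also have "\<dots> = ennreal (c * (V * (w * R ^ (?N - 1))))" using c V w R by (simp add: ennreal_mult)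
    finally show ?thesis .
  qed
  have wg: "has_weak_gradient u (weak_gradient u)"
  proof -
    have "\<exists>G. has_weak_gradient u G" unfolding u_def
      by (rule exI[of _ "\<lambda>x. \<chi> i. annular_gradient i x"]) (rule annular_bump_weak_gradient)
    then show ?thesis unfolding weak_gradient_def by (rule someI_ex)
  qed
  have ae: "AE x in lebesgue. weak_gradient u x = (\<chi> i. annular_gradient i x)"
    by (rule weak_gradient_unique[OF wg]) (unfold u_def, rule annular_bump_weak_gradient)
  have G_le: "(norm (\<chi> i. annular_gradient i x))\<^sup>2 \<le> 64 * h\<^sup>2 / w\<^sup>2 * indicator A x" for x :: "real^'n"
  proof (cases "((norm x)\<^sup>2 - R\<^sup>2) / (w * R) \<in> {-1<..<1}")
    case True
    let ?g = "unit_bump_deriv (((norm x)\<^sup>2 - R\<^sup>2) / (w * R))"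
    have "(\<chi> i. annular_gradient i x) = (h * ?g * 2 / (w * R)) *\<^sub>R x"
      by (simp add: vec_eq_iff annular_gradient_def)
    then have "(norm (\<chi> i. annular_gradient i x))\<^sup>2 = (h * ?g * 2 / (w * R))\<^sup>2 * (norm x)\<^sup>2"
      by (simp only: norm_scaleR power_mult_distrib power2_abs)
    also have "\<dots> \<le> (h * 2 * 2 / (w * R))\<^sup>2 * (2 * R)\<^sup>2"
    proof (rule mult_mono)
      have "\<bar>h * ?g * 2 / (w * R)\<bar> \<le> h * 2 * 2 / (w * R)"
      proof -
        have "\<bar>h * ?g * 2 / (w * R)\<bar> = h * \<bar>?g\<bar> * 2 / (w * R)" using h R w by (simp add: abs_mult)
        also have "\<dots> \<le> h * 2 * 2 / (w * R)"
          using h wR unit_bump_deriv_bound by (intro divide_right_mono mult_right_mono mult_left_mono) auto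
        finally show ?thesis .
      qed
      then show "(h * ?g * 2 / (w * R))\<^sup>2 \<le> (h * 2 * 2 / (w * R))\<^sup>2"
        using abs_le_square_iff[of "h * ?g * 2 / (w * R)" "h * 2 * 2 / (w * R)"] by linarith
      show "(norm x)\<^sup>2 \<le> (2 * R)\<^sup>2" using annular_bump_support(4)[OF True] by (intro power_mono) auto
    qed auto
    also have "\<dots> = 64 * h\<^sup>2 / w\<^sup>2" using R by (simp add: power_divide power_mult_distrib)
    finally show ?thesis using A1[OF True] by simp
  next
    case False
    then have "(\<chi> i. annular_gradient i x) = 0" by (simp add: vec_eq_iff annular_gradient_def unit_bump_deriv_outside)
    then show ?thesis by simp
  qed
  have grad: "(\<integral>\<^sup>+x. ennreal ((norm (weak_gradient u x))\<^sup>2) \<partial>lebesgue) \<le> ennreal (64 * h\<^sup>2 / w\<^sup>2 * (V * (w * R ^ (?N - 1))))"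
  proof -
    have "(\<integral>\<^sup>+x. ennreal ((norm (weak_gradient u x))\<^sup>2) \<partial>lebesgue) = (\<integral>\<^sup>+x. ennreal ((norm (\<chi> i. annular_gradient i (x::real^'n)))\<^sup>2) \<partial>lborel)"
      unfolding nn_integral_completion
      by (rule nn_integral_cong_AE) (use ae[unfolded AE_completion_iff] in eventually_elim, simp)
    also have "\<dots> \<le> ennreal (64 * h\<^sup>2 / w\<^sup>2 * (V * (w * R ^ (?N - 1))))"
      by (rule int_le[OF _ G_le]) simp
    finally show ?thesis .
  qed
  have eq: "64 * h\<^sup>2 / w\<^sup>2 * (V * (w * R ^ (?N - 1))) = 64 * V * (h\<^sup>2 * R ^ (?N - 1) / w)"
    using w by (simp add: power2_eq_square)
  have "(LINT x|lebesgue. (norm (weak_gradient u x))\<^sup>2) \<le> 64 * h\<^sup>2 / w\<^sup>2 * (V * (w * R ^ (?N - 1)))"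
    using V w R by (intro integral_real_bounded grad) auto
  then show "(gradient_norm u)\<^sup>2 \<le> 64 * V * (h\<^sup>2 * R ^ (?N - 1) / w)"
    unfolding eq by (simp add: gradient_norm_def integral_nonneg_AE)
  have u_le: "\<bar>u x\<bar> powr q * norm x powr (- b) \<le> (h powr q * (R / 2) powr (- b)) * indicator A x" for x
  proof (cases "u x = 0")
    case False
    then have p: "((norm x)\<^sup>2 - R\<^sup>2) / (w * R) \<in> {-1<..<1}" unfolding u_def by (rule annular_bump_nonzero)
    have "u x \<le> h * 1" unfolding u_def annular_bump_def using h by (intro mult_left_mono bump_bounds) auto
    moreover have "0 \<le> u x" unfolding u_def annular_bump_def using h by (intro mult_nonneg_nonneg bump_bounds) auto
    ultimately have "\<bar>u x\<bar> powr q \<le> h powr q" using q by (intro powr_mono2) auto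
    moreover have "norm x powr (- b) \<le> (R / 2) powr (- b)"
      using annular_bump_support(3)[OF p] R b by (intro powr_mono2') auto
    ultimately have "\<bar>u x\<bar> powr q * norm x powr (- b) \<le> h powr q * (R / 2) powr (- b)" by (intro mult_mono) auto
    then show ?thesis using A1[OF p] by simp
  qed simp
  have "moment b q u \<le> ennreal (h powr q * (R / 2) powr (- b) * (V * (w * R ^ (?N - 1))))"
    unfolding moment_def by (rule int_le[OF _ u_le]) simp
  also have "h powr q * (R / 2) powr (- b) * (V * (w * R ^ (?N - 1))) = 2 powr b * V * (h powr q * R powr (real ?N - 1 - b) * w)"
  proof -
    have "(R / 2) powr (- b) = 2 powr b * R powr (- b)" using R by (simp add: powr_divide powr_minus field_simps)
    moreover have "R ^ (?N - 1) = R powr (real ?N - 1)" using R dim by (simp add: powr_realpow[symmetric] of_nat_diff)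
    moreover have "R powr (- b) * R powr (real ?N - 1) = R powr (real ?N - 1 - b)" by (rule powr_mult_eq) simp
    ultimately show ?thesis by (simp add: mult_ac)
  qed
  finally show mom: "moment b q u \<le> ennreal (2 powr b * V * (h powr q * R powr (real ?N - 1 - b) * w))" .
  have ub: "u \<in> borel_measurable borel"
    unfolding u_def by (rule borel_measurable_continuous_onI[OF smooth_gen_continuous[OF annular_bump_smooth]])
  then have um: "u \<in> borel_measurable lebesgue" by (intro measurable_completion) simp
  have "(\<lambda>x. weak_gradient u x $ i) \<in> Lp_space lebesgue 2" for i
  proof -
    have m: "(\<lambda>x. weak_gradient u x $ i) \<in> borel_measurable lebesgue"
      using wg by (intro locally_integrable_measurable) (simp add: has_weak_gradient_def)
    have "(\<integral>\<^sup>+x. ennreal (norm (\<bar>weak_gradient u x $ i\<bar> powr 2)) \<partial>lebesgue) \<le> (\<integral>\<^sup>+x. ennreal ((norm (weak_gradient u x))\<^sup>2) \<partial>lebesgue)"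
    proof (intro nn_integral_mono ennreal_leI)
      fix x
      have "\<bar>weak_gradient u x $ i\<bar>\<^sup>2 \<le> (norm (weak_gradient u x))\<^sup>2"
        by (intro power_mono component_le_norm_cart) auto
      then show "norm (\<bar>weak_gradient u x $ i\<bar> powr 2) \<le> (norm (weak_gradient u x))\<^sup>2" by simp
    qed
    also have "\<dots> < \<infinity>" using grad by (auto intro: le_less_trans)
    finally have "integrable lebesgue (\<lambda>x. \<bar>weak_gradient u x $ i\<bar> powr 2)"
      using m by (intro integrableI_bounded) auto
    then show ?thesis using m by (simp add: Lp_space_def)
  qed
  moreover have "radial u"
    unfolding radial_def u_def annular_bump_def by (intro exI[of _ "\<lambda>s. h * bump 1 (-1) 1 ((s\<^sup>2 - R\<^sup>2) / (w * R))"]) simp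
  moreover have "moment b q u < \<infinity>" using mom by (auto intro: le_less_trans)
  ultimately show "u \<in> E_rad b q"
    using wg um by (auto simp: E_rad_def E_space_def Lp_space_weighted_iff)
qed

text \<open>On the annulus of half the width the bump is at least \<open>exp (- 4) * h\<close>.\<close>
lemma annular_bump_moment_lower:
  fixes \<eta> r :: real
  assumes dim: "2 \<le> CARD('n::finite)" and \<eta>: "0 \<le> \<eta>" and r: "0 < r"
  shows "ennreal (exp (-4) powr r * 2 powr (- \<eta>) * unit_ball_vol (real CARD('n)) * (h powr r * R powr (real CARD('n) - 1 - \<eta>) * w))
    \<le> moment \<eta> r (annular_bump R w h :: real^'n \<Rightarrow> real)"
proof -
  let ?N = "CARD('n)"
  define s where "s = w * R / 2"
  have wR: "0 < w * R" "w * R \<le> R\<^sup>2 / 2" using R w by (auto simp: power2_eq_square)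
  have R2: "0 < R\<^sup>2" using R by simp
  have s: "0 < s" "s \<le> R\<^sup>2 / 2" using wR by (auto simp: s_def)
  let ?a = "sqrt (R\<^sup>2 + s)" and ?b = "sqrt (R\<^sup>2 - s)"
  have b0: "0 \<le> R\<^sup>2 - s" using s R2 by linarith
  have ba: "0 \<le> ?b" "?b \<le> ?a" using s b0 by auto
  define A where "A = {x::real^'n. ?b < norm x \<and> norm x \<le> ?a}"
  have mA[measurable]: "A \<in> sets borel" unfolding A_def by measurable
  let ?c = "(h * exp (-4)) powr r * (2 * R) powr (- \<eta>)"
  have vol: "ennreal (unit_ball_vol (real ?N) * (w * R ^ (?N - 1))) \<le> emeasure lborel A"
  proof -
    have "R ^ (?N - 1) = R ^ (?N - 2) * R" using dim by (simp add: power_Suc2[symmetric] Suc_diff_Suc numeral_2_eq_2 del: power_Suc2)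
    then have "w * R ^ (?N - 1) = R ^ (?N - 2) * (2 * s)" by (simp add: s_def)
    also have "\<dots> \<le> ?a ^ ?N - ?b ^ ?N" by (rule annulus_power_lower[OF dim R s])
    finally have "ennreal (unit_ball_vol (real ?N) * (w * R ^ (?N - 1))) \<le> ennreal (unit_ball_vol (real ?N) * (?a ^ ?N - ?b ^ ?N))"
      by (intro ennreal_leI mult_left_mono unit_ball_vol_nonneg) auto
    also have "\<dots> = emeasure lborel A"
      using emeasure_annulus[OF ba, where 'a = "real^'n"] by (simp add: A_def)
    finally show ?thesis .
  qed
  have pt: "?c * indicator A x \<le> \<bar>annular_bump R w h x\<bar> powr r * norm x powr (- \<eta>)" for x
  proof (cases "x \<in> A")
    case True
    then have x: "?b < norm x" "norm x \<le> ?a" by (auto simp: A_def)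
    have "?b\<^sup>2 < (norm x)\<^sup>2" using x ba by (intro power_strict_mono) auto
    then have x1: "R\<^sup>2 - s < (norm x)\<^sup>2" using b0 by simp
    have "(norm x)\<^sup>2 \<le> ?a\<^sup>2" using x by (intro power_mono) auto
    then have x2: "(norm x)\<^sup>2 \<le> R\<^sup>2 + s" using s by simp
    have p: "\<bar>((norm x)\<^sup>2 - R\<^sup>2) / (w * R)\<bar> \<le> 1 / 2"
    proof -
      have "\<bar>(norm x)\<^sup>2 - R\<^sup>2\<bar> \<le> w * R / 2" using x1 x2 unfolding s_def by linarith
      moreover have "\<bar>((norm x)\<^sup>2 - R\<^sup>2) / (w * R)\<bar> = \<bar>(norm x)\<^sup>2 - R\<^sup>2\<bar> / (w * R)"
        using wR(1) by (simp only: abs_divide abs_of_pos)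
      ultimately show ?thesis using wR(1) by (simp add: divide_le_eq)
    qed
    have "h * exp (-4) \<le> annular_bump R w h x"
      unfolding annular_bump_def using h bump_ge[OF p] by (intro mult_left_mono) auto
    then have "(h * exp (-4)) powr r \<le> \<bar>annular_bump R w h x\<bar> powr r" using h r by (intro powr_mono2) auto
    moreover have "norm x < 2 * R"
    proof -
      have "(norm x)\<^sup>2 < (2 * R)\<^sup>2" using x2 s R2 by (simp add: power_mult_distrib)
      then show ?thesis by (rule power_less_imp_less_base) (use R in simp)
    qed
    then have "(2 * R) powr (- \<eta>) \<le> norm x powr (- \<eta>)"
      using x ba \<eta> by (intro powr_mono2') auto
    ultimately show ?thesis using True by (simp add: mult_mono)
  qed simp
  have "?c * (unit_ball_vol (real ?N) * (w * R ^ (?N - 1))) = exp (-4) powr r * 2 powr (- \<eta>) * unit_ball_vol (real ?N) * (h powr r * R powr (real ?N - 1 - \<eta>) * w)"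
  proof -
    have "R ^ (?N - 1) = R powr (real ?N - 1)" using R dim by (simp add: powr_realpow[symmetric] of_nat_diff)
    moreover have f: "R powr (real ?N - 1 - \<eta>) = R powr (- \<eta>) * R powr (real ?N - 1)" by (rule powr_mult_eq[symmetric]) simp
    ultimately show ?thesis by (simp only: powr_mult mult_ac)
  qed
  then have "ennreal (exp (-4) powr r * 2 powr (- \<eta>) * unit_ball_vol (real ?N) * (h powr r * R powr (real ?N - 1 - \<eta>) * w))
    = ennreal ?c * ennreal (unit_ball_vol (real ?N) * (w * R ^ (?N - 1)))"
    by (subst ennreal_mult[symmetric]) (use w R unit_ball_vol_nonneg[of "real ?N"] in \<open>auto intro!: mult_nonneg_nonneg\<close>)
  also have "\<dots> \<le> ennreal ?c * emeasure lborel A" by (intro mult_left_mono vol) simp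
  also have "\<dots> = (\<integral>\<^sup>+x. ennreal ?c * indicator A x \<partial>lborel)" by (rule nn_integral_cmult_indicator[symmetric]) simp
  also have "\<dots> \<le> moment \<eta> r (annular_bump R w h :: real^'n \<Rightarrow> real)"
    unfolding moment_def
  proof (rule nn_integral_mono)
    fix x :: "real^'n"
    show "ennreal ?c * indicator A x \<le> ennreal (\<bar>annular_bump R w h x\<bar> powr r * norm x powr (- \<eta>))"
      using ennreal_leI[OF pt[of x]] by (cases "x \<in> A") simp_all
  qed
  finally show ?thesis .
qed

end

section \<open>Failure of compactness at the endpoints\<close>

text \<open>Because of the disjoint supports the difference of two members of the sequence is at least as large as either of
  them, which excludes convergent subsequences.\<close>
lemma not_compact_embedding_if_disjoint:
  fixes u :: "nat \<Rightarrow> real^'n \<Rightarrow> real"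
  assumes u: "\<And>k. u k \<in> X" and bdd: "bdd_above (range (\<lambda>k. normX (u k)))"
    and meas: "\<And>k. u k \<in> borel_measurable lebesgue" and r: "0 < r"
    and disj: "\<And>k l x. k \<noteq> l \<Longrightarrow> u k x \<noteq> 0 \<Longrightarrow> u l x = 0"
    and c: "0 < c" "\<And>k. ennreal c \<le> moment \<eta> r (u k)"
  shows "\<not> compact_embedding X normX (Lp_space (weighted_lebesgue \<eta>) r) (Lp_norm (weighted_lebesgue \<eta>) r)"
proof
  assume comp: "compact_embedding X normX (Lp_space (weighted_lebesgue \<eta>) r) (Lp_norm (weighted_lebesgue \<eta>) r)"
  then have sub: "X \<subseteq> Lp_space (weighted_lebesgue \<eta>) r" by (simp add: compact_embedding_def continuous_embedding_def)
  obtain v \<sigma> where v: "v \<in> Lp_space (weighted_lebesgue \<eta>) r" and \<sigma>: "strict_mono \<sigma>"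
    and lim: "(\<lambda>n. Lp_norm (weighted_lebesgue \<eta>) r (\<lambda>x. u (\<sigma> n) x - v x)) \<longlonglongrightarrow> 0"
    using comp u bdd unfolding compact_embedding_def by blast
  have vm: "v \<in> borel_measurable lebesgue" "moment \<eta> r v < \<infinity>" using v by (simp_all add: Lp_space_weighted_iff)
  define m where "m k = moment \<eta> r (\<lambda>x. u (\<sigma> k) x - v x)" for k
  have mfin: "m k < \<infinity>" for k
  proof -
    have "moment \<eta> r (u (\<sigma> k)) < \<infinity>" using u sub Lp_space_weighted_iff by blast
    then have "ennreal (2 powr r) * (moment \<eta> r (u (\<sigma> k)) + moment \<eta> r v) < \<infinity>" using vm by (simp add: ennreal_mult_less_top)
    then show ?thesis unfolding m_def using moment_diff_le[OF meas vm(1) r] by (rule le_less_trans[rotated])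
  qed
  have "Lp_norm (weighted_lebesgue \<eta>) r (\<lambda>x. u (\<sigma> k) x - v x) = enn2real (m k) powr (1 / r)" for k
    unfolding m_def using meas vm(1) by (intro Lp_norm_weighted borel_measurable_diff)
  then have "(\<lambda>k. enn2real (m k) powr (1 / r)) \<longlonglongrightarrow> 0" using lim by simp
  then have "(\<lambda>k. (enn2real (m k) powr (1 / r)) powr r) \<longlonglongrightarrow> 0"
    using tendsto_zero_powrI[of "\<lambda>k. enn2real (m k) powr (1 / r)" sequentially "\<lambda>_. r" r] r by simp
  then have m0: "(\<lambda>k. enn2real (m k)) \<longlonglongrightarrow> 0" using r by (simp add: powr_powr)
  (* If the r-th moments of two differences from v are below e, then that of the difference of the two terms is at most 2 powr r * (e + e) = c / 2. *)
  define e where "e = c / (4 * 2 powr r)"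
  have e: "0 < e" using c by (simp add: e_def)
  have "\<forall>\<^sub>F k in sequentially. enn2real (m k) < e" using m0 e by (rule order_tendstoD(2))
  then obtain K where K: "\<And>k. K \<le> k \<Longrightarrow> enn2real (m k) < e" unfolding eventually_sequentially by blast
  have me: "m k \<le> ennreal e" if "K \<le> k" for k
    using K[OF that] mfin[of k] by (metis ennreal_enn2real ennreal_leI infinity_ennreal_def less_imp_le)
  let ?a = "\<sigma> K" and ?b = "\<sigma> (Suc K)"
  have ne: "?a \<noteq> ?b" using \<sigma> by (metis n_not_Suc_n strict_mono_eq)
  have "ennreal c \<le> moment \<eta> r (u ?a)" by (rule c)
  also have "\<dots> \<le> moment \<eta> r (\<lambda>x. (u ?a x - v x) - (u ?b x - v x))"
    unfolding moment_def
  proof (intro nn_integral_mono ennreal_leI mult_right_mono)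
    fix x
    show "\<bar>u ?a x\<bar> powr r \<le> \<bar>(u ?a x - v x) - (u ?b x - v x)\<bar> powr r"
      using disj[OF ne, of x] r by (cases "u ?a x = 0") auto
  qed simp
  also have "\<dots> \<le> ennreal (2 powr r) * (m K + m (Suc K))"
    unfolding m_def using meas vm(1) r by (intro moment_diff_le borel_measurable_diff)
  also have "\<dots> \<le> ennreal (2 powr r) * (ennreal e + ennreal e)"
    by (intro mult_left_mono add_mono me) auto
  also have "\<dots> = ennreal (c / 2)"
  proof -
    have "2 powr r * (e + e) = c / 2" by (simp add: e_def)
    then show ?thesis using e by (subst ennreal_plus[symmetric], simp, simp, subst ennreal_mult[symmetric]) auto
  qed
  finally show False using c by (simp add: ennreal_le_iff)
qed

lemma not_compact_embedding_if_bumps: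
  fixes b q \<eta> r M m :: real and R w h :: "nat \<Rightarrow> real"
  assumes dim: "2 \<le> CARD('n::finite)" and b: "0 \<le> b" and q: "2 < q" and \<eta>: "0 \<le> \<eta>" and r: "0 < r"
    and pos: "\<And>k. 0 < R k" "\<And>k. 0 < w k" "\<And>k. w k \<le> R k / 2" "\<And>k. 0 < h k"
    and sep: "\<And>k l. k \<noteq> l \<Longrightarrow> 4 * R k \<le> R l \<or> 4 * R l \<le> R k"
    and grad: "\<And>k. (h k)\<^sup>2 * R k ^ (CARD('n) - 1) / w k \<le> M"
    and pot: "\<And>k. h k powr q * R k powr (real CARD('n) - 1 - b) * w k \<le> M"
    and low: "0 < m" "\<And>k. m \<le> h k powr r * R k powr (real CARD('n) - 1 - \<eta>) * w k"
  shows "\<not> compact_embedding (E_rad b q :: (real ^ 'n \<Rightarrow> real) set) (E_norm b q)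
              (Lp_space (weighted_lebesgue \<eta>) r) (Lp_norm (weighted_lebesgue \<eta>) r)"
proof -
  let ?N = "CARD('n)"
  define u :: "nat \<Rightarrow> real^'n \<Rightarrow> real" where "u k = annular_bump (R k) (w k) (h k)" for k
  define V where "V = unit_ball_vol (real ?N) * (real ?N * 2 ^ ?N)"
  have V: "0 \<le> V" unfolding V_def by (intro mult_nonneg_nonneg unit_ball_vol_nonneg) auto
  have uE: "u k \<in> E_rad b q" for k
    unfolding u_def by (rule annular_bump_norms(1)[OF pos dim b q])
  have g: "(gradient_norm (u k))\<^sup>2 \<le> 64 * V * M" for k
  proof -
    have "(gradient_norm (u k))\<^sup>2 \<le> 64 * V * ((h k)\<^sup>2 * R k ^ (?N - 1) / w k)"
      unfolding u_def V_def by (rule annular_bump_norms(2)[OF pos dim b q])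
    also have "\<dots> \<le> 64 * V * M" using V by (intro mult_left_mono grad) auto
    finally show ?thesis .
  qed
  have M: "0 \<le> M"
    using order_trans[OF _ pot[of 0], of 0] pos(2)[of 0] by simp
  define Mp where "Mp = 2 powr b * V * M"
  have mb: "moment b q (u k) \<le> ennreal Mp" for k
  proof -
    have "moment b q (u k) \<le> ennreal (2 powr b * V * (h k powr q * R k powr (real ?N - 1 - b) * w k))"
      unfolding u_def V_def by (rule annular_bump_norms(3)[OF pos dim b q])
    also have "\<dots> \<le> ennreal Mp" unfolding Mp_def using V by (intro ennreal_leI mult_left_mono pot) auto
    finally show ?thesis .
  qed
  have p: "potential_norm b q (u k) \<le> Mp powr (1 / q)" for k
    unfolding potential_norm_def using mb[of k] q V M
    by (intro powr_mono2 enn2real_leI) (auto simp: Mp_def)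
  have "E_norm b q (u k) \<le> sqrt (64 * V * M + (Mp powr (1 / q))\<^sup>2)" for k
    unfolding E_norm_eq[OF E_rad_measurable[OF uE], of q b k, OF less_trans[OF zero_less_numeral q]]
    by (intro real_sqrt_le_mono add_mono g power_mono p potential_norm_nonneg)
  then have bdd: "bdd_above (range (\<lambda>k. E_norm b q (u k)))" by (intro bdd_aboveI2)
  define c where "c = exp (-4) powr r * 2 powr (- \<eta>) * unit_ball_vol (real ?N)"
  have c: "0 < c" unfolding c_def by (intro mult_pos_pos unit_ball_vol_pos) auto
  have lowm: "ennreal (c * m) \<le> moment \<eta> r (u k)" for k
  proof -
    have "ennreal (c * m) \<le> ennreal (c * (h k powr r * R k powr (real ?N - 1 - \<eta>) * w k))"
      using c by (intro ennreal_leI mult_left_mono low) auto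
    also have "\<dots> \<le> moment \<eta> r (u k)"
      unfolding c_def u_def by (rule annular_bump_moment_lower[OF pos dim \<eta> r])
    finally show ?thesis .
  qed
  have range: "R k / 2 < norm x" "norm x < 2 * R k" if "u k x \<noteq> 0" for k x
    using annular_bump_support(3,4)[OF pos(1-4) annular_bump_nonzero[OF pos(1-4) that[unfolded u_def]]] by auto
  have disj: "u l x = 0" if "k \<noteq> l" "u k x \<noteq> 0" for k l x
  proof (rule ccontr)
    assume "u l x \<noteq> 0"
    from range[OF this] range[OF that(2)] sep[OF that(1)] show False by linarith
  qed
  show ?thesis
    by (rule not_compact_embedding_if_disjoint[OF uE bdd E_rad_measurable[OF uE] r disj mult_pos_pos[OF c low(1)] lowm])
qed

lemma powr4_separated:
  assumes "k \<noteq> l"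
  shows "4 * (4::real) ^ k \<le> 4 ^ l \<or> 4 * (4::real) ^ l \<le> 4 ^ k"
proof -
  have "4 * (4::real) ^ i \<le> 4 ^ j" if "i < j" for i j
    using power_increasing[of "Suc i" j "4::real"] that by simp
  then show ?thesis using assms by (meson linorder_neqE_nat)
qed

text \<open>The height and the width are powers of the radius \<open>R\<close>, chosen so that none of the three quantities of
  \<open>not_compact_embedding_if_bumps\<close> depends on \<open>R\<close>; the radii tend to infinity.  The width does not exceed the radius because \<open>q\<close>
  is subcritical.\<close>
lemma not_compact_lower_endpoint:
  fixes b q \<eta> r :: real
  assumes dim: "2 \<le> CARD('n::finite)" and b: "0 \<le> b" "b < 2" and q: "2 < q"
    and sub: "q * (real CARD('n) - 2) < 2 * (real CARD('n) - b)" and \<eta>: "0 \<le> \<eta>" "\<eta> \<le> b"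
    and r: "r = q + (q + 2) * (b - \<eta>) / (2 * real CARD('n) - 2 - b)"
  shows "\<not> compact_embedding (E_rad b q :: (real ^ 'n \<Rightarrow> real) set) (E_norm b q)
              (Lp_space (weighted_lebesgue \<eta>) r) (Lp_norm (weighted_lebesgue \<eta>) r)"
proof -
  define n where "n = real CARD('n)"
  have n2: "2 \<le> n" using dim by (simp add: n_def)
  have den: "0 < 2 * n - 2 - b" using n2 b by linarith
  define \<kappa> where "\<kappa> = (2 * n - 2 - b) / (q + 2)"
  (* The height R powr (- \<kappa>) and the width R powr e / 2 balance the gradient norm and the q-th moment. *)
  define e where "e = n - 1 - 2 * \<kappa>"
  have \<kappa>: "\<kappa> * (q + 2) = 2 * n - 2 - b" using q by (simp add: \<kappa>_def)
  have "n - 2 \<le> 2 * \<kappa>"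
  proof -
    have "(n - 2) * (q + 2) \<le> (2 * \<kappa>) * (q + 2)" using sub \<kappa> by (simp add: n_def[symmetric] algebra_simps)
    then show ?thesis using q by simp
  qed
  then have e1: "e \<le> 1" by (simp add: e_def)
  have \<kappa>r: "\<kappa> * (r + 2) = 2 * n - 2 - \<eta>"
  proof -
    have "r + 2 = (q + 2) * (1 + (b - \<eta>) / (2 * n - 2 - b))" by (simp add: r n_def algebra_simps)
    then have "\<kappa> * (r + 2) = (2 * n - 2 - b) * (1 + (b - \<eta>) / (2 * n - 2 - b))" by (simp add: \<kappa>[symmetric] mult.assoc)
    also have "\<dots> = 2 * n - 2 - \<eta>" using den by (simp add: distrib_left)
    finally show ?thesis .
  qed
  have rpos: "0 < r" 
    using radial_exponent_pos[of n b q \<eta> r] n2 b q \<eta> r by (simp add: n_def)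
  define R where "R k = (4::real) ^ k" for k :: nat
  have R: "0 < R k" "1 \<le> R k" for k by (simp_all add: R_def)
  have RN: "R k ^ (CARD('n) - 1) = R k powr (n - 1)" for k
    using R[of k] dim by (simp add: powr_realpow[symmetric] of_nat_diff n_def)
  have comb: "R k powr \<alpha>1 * R k powr \<alpha>2 * (R k powr e / 2) = 1 / 2" if "\<alpha>1 + \<alpha>2 + e = 0" for k \<alpha>1 \<alpha>2
    using that R(1)[of k] by (simp add: powr_add[symmetric])
  show ?thesis
  proof (rule not_compact_embedding_if_bumps[where R = R and w = "\<lambda>k. R k powr e / 2" and h = "\<lambda>k. R k powr (- \<kappa>)" and M = 2 and m = "1 / 2"])
    show "R k powr e / 2 \<le> R k / 2" for k
      using powr_mono[OF e1 R(2)[of k]] R(1)[of k] by simp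
    show "4 * R k \<le> R l \<or> 4 * R l \<le> R k" if "k \<noteq> l" for k l
      unfolding R_def by (rule powr4_separated[OF that])
    show "(R k powr (- \<kappa>))\<^sup>2 * R k ^ (CARD('n) - 1) / (R k powr e / 2) \<le> 2" for k
    proof -
      have "(R k powr (- \<kappa>))\<^sup>2 * R k powr (n - 1) = R k powr e"
        unfolding power2_powr_eq[of "- \<kappa>" "- 2 * \<kappa>", simplified] by (rule powr_mult_eq) (simp add: e_def)
      then show ?thesis unfolding RN using R(1)[of k] by simp
    qed
    show "(R k powr (- \<kappa>)) powr q * R k powr (real CARD('n) - 1 - b) * (R k powr e / 2) \<le> 2" for k
    proof -
      have "(R k powr (- \<kappa>)) powr q * R k powr (real CARD('n) - 1 - b) * (R k powr e / 2) = 1 / 2"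
        unfolding powr_powr by (rule comb) (use \<kappa> in \<open>simp add: e_def n_def algebra_simps\<close>)
      then show ?thesis by simp
    qed
    show "1 / 2 \<le> (R k powr (- \<kappa>)) powr r * R k powr (real CARD('n) - 1 - \<eta>) * (R k powr e / 2)" for k
    proof -
      have "(R k powr (- \<kappa>)) powr r * R k powr (real CARD('n) - 1 - \<eta>) * (R k powr e / 2) = 1 / 2"
        unfolding powr_powr by (rule comb) (use \<kappa>r in \<open>simp add: e_def n_def algebra_simps\<close>)
      then show ?thesis by simp
    qed
  qed (use R dim b q \<eta> rpos in \<open>auto simp: less_imp_neq[symmetric] less_imp_neq[OF R(1), symmetric]\<close>)
qed

text \<open>The width is comparable to the radius and the radii tend to \<open>0\<close>.  The height keeps the gradient norm and the
  critical moment constant, while the weighted \<open>q\<close>-th moment stays bounded because \<open>q\<close> is subcritical.\<close>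
lemma not_compact_upper_endpoint:
  fixes b q \<eta> r :: real
  assumes dim: "2 < CARD('n::finite)" and b: "0 \<le> b" "b < 2" and q: "2 < q"
    and sub: "q * (real CARD('n) - 2) < 2 * (real CARD('n) - b)" and \<eta>: "0 \<le> \<eta>" "\<eta> \<le> b"
    and r: "r = 2 * (real CARD('n) - \<eta>) / (real CARD('n) - 2)"
  shows "\<not> compact_embedding (E_rad b q :: (real ^ 'n \<Rightarrow> real) set) (E_norm b q)
              (Lp_space (weighted_lebesgue \<eta>) r) (Lp_norm (weighted_lebesgue \<eta>) r)"
proof -
  define n where "n = real CARD('n)"
  have n3: "2 < n" using dim by (simp add: n_def)
  define \<kappa> where "\<kappa> = (n - 2) / 2"
  have \<kappa>r: "\<kappa> * r = n - \<eta>" 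
  proof -
    have e: "r * (n - 2) = 2 * (n - \<eta>)" using n3 by (simp add: r n_def[symmetric])
    have "\<kappa> * r = (r * (n - 2)) / 2" by (simp add: \<kappa>_def mult.commute)
    then show ?thesis unfolding e by simp
  qed
  have rpos: "0 < r" using n3 \<eta> b unfolding r n_def[symmetric] by (intro divide_pos_pos) auto
  define R where "R k = 1 / (4::real) ^ k" for k :: nat
  have R: "0 < R k" "R k \<le> 1" for k by (simp_all add: R_def)
  have RN: "R k ^ (CARD('n) - 1) = R k powr (n - 1)" for k
    using R[of k] dim by (simp add: powr_realpow[symmetric] of_nat_diff n_def)
  have comb: "R k powr \<alpha>1 * R k powr \<alpha>2 * (R k / 2) = R k powr \<beta> / 2" if "\<alpha>1 + \<alpha>2 + 1 = \<beta>" for k \<alpha>1 \<alpha>2 \<beta>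
    using R(1)[of k] unfolding that[symmetric] powr_add by simp
  show ?thesis
  proof (rule not_compact_embedding_if_bumps[where R = R and w = "\<lambda>k. R k / 2" and h = "\<lambda>k. R k powr (- \<kappa>)" and M = 2 and m = "1 / 2"])
    show "4 * R k \<le> R l \<or> 4 * R l \<le> R k" if "k \<noteq> l" for k l
      using powr4_separated[OF that] by (auto simp: R_def field_simps)
    show "(R k powr (- \<kappa>))\<^sup>2 * R k ^ (CARD('n) - 1) / (R k / 2) \<le> 2" for k
    proof -
      have "(R k powr (- \<kappa>))\<^sup>2 * R k powr (n - 1) = R k powr 1"
        unfolding power2_powr_eq[of "- \<kappa>" "- 2 * \<kappa>", simplified] by (rule powr_mult_eq) (simp add: \<kappa>_def field_simps)
      then show ?thesis unfolding RN using R(1)[of k] by simp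
    qed
    show "(R k powr (- \<kappa>)) powr q * R k powr (real CARD('n) - 1 - b) * (R k / 2) \<le> 2" for k
    proof -
      have "(R k powr (- \<kappa>)) powr q * R k powr (real CARD('n) - 1 - b) * (R k / 2) = R k powr (n - b - \<kappa> * q) / 2"
        unfolding powr_powr by (rule comb) (simp add: n_def)
      moreover have "0 \<le> n - b - \<kappa> * q" using sub by (simp add: \<kappa>_def n_def field_simps)
      then have "R k powr (n - b - \<kappa> * q) \<le> 1 powr (n - b - \<kappa> * q)"
        using R[of k] by (intro powr_mono2) auto
      ultimately show ?thesis by simp
    qed
    show "1 / 2 \<le> (R k powr (- \<kappa>)) powr r * R k powr (real CARD('n) - 1 - \<eta>) * (R k / 2)" for k
    proof -
      have "(R k powr (- \<kappa>)) powr r * R k powr (real CARD('n) - 1 - \<eta>) * (R k / 2) = R k powr 0 / 2"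
        unfolding powr_powr by (rule comb) (use \<kappa>r in \<open>simp add: n_def\<close>)
      then show ?thesis using R(1)[of k] by simp
    qed
  qed (use R dim b q \<eta> rpos in \<open>auto simp: less_imp_neq[OF R(1), symmetric]\<close>)
qed

section \<open>The embedding theorem\<close>

lemma rad_exp_eq:
  fixes b q \<eta> :: real
  assumes "2 \<le> n" "b < 2" "\<eta> \<le> b"
  shows "rad_exp n b q \<eta> = q + (q + 2) * (b - \<eta>) / (2 * real n - 2 - b)"
proof -
  have den: "2 * real n - 2 - b \<noteq> 0" "real n - b \<noteq> 0" using assms by linarith+
  have "(q * (2 * real n - 2 - \<eta>) + 2 * (b - \<eta>)) = q * (2 * real n - 2 - b) + (q + 2) * (b - \<eta>)"
    by (simp add: algebra_simps)
  then show ?thesis using assms den by (auto simp: rad_exp_def add_divide_distrib)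
qed

lemma crit_exp_le_iff:
  assumes "2 \<le> n"
  shows "ereal r \<le> crit_exp n \<eta> \<longleftrightarrow> n = 2 \<or> r \<le> 2 * (real n - \<eta>) / (real n - 2)"
  by (auto simp: crit_exp_def)

lemma crit_exp_neq_iff:
  "ereal r \<noteq> crit_exp n \<eta> \<longleftrightarrow> n = 2 \<or> r \<noteq> 2 * (real n - \<eta>) / (real n - 2)"
  by (auto simp: crit_exp_def)

lemma subcritical_iff:
  assumes "2 \<le> n" "b < 2" "ereal q < crit_exp n b"
  shows "q * (real n - 2) < 2 * (real n - b)"
  using assms by (cases "n = 2") (auto simp: crit_exp_def less_divide_eq)

lemma Lp_norm_gradient:
  "Lp_norm lebesgue 2 (\<lambda>x. norm (weak_gradient u x)) = gradient_norm u"
  by (simp add: Lp_norm_def gradient_norm_def powr_half_sqrt integral_nonneg_AE)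

lemma Lp_norm_potential:
  fixes u :: "real^'n \<Rightarrow> real"
  assumes "u \<in> borel_measurable lebesgue" "0 < q"
  shows "Lp_norm lebesgue q (\<lambda>x. norm x powr (- b / q) * u x) = potential_norm b q u"
proof -
  have "\<bar>norm x powr (- b / q) * u x\<bar> powr q = \<bar>u x\<bar> powr q * norm x powr (- b)" for x
    using assms(2) powr_powr_eq[of "- b / q" q "- b" "norm x"] by (simp add: abs_mult powr_mult mult.commute)
  then show ?thesis
    using moment_integrable(2)[OF assms(1), of q b] by (simp add: Lp_norm_def potential_norm_def)
qed

theorem lemma5p1:
  fixes b q \<eta> :: real
  assumes "CARD('n::finite) \<ge> 2"
    and "0 \<le> b" and "b < 2" and "2 < q" and "ereal q < crit_exp CARD('n) b"
    and "0 \<le> \<eta>" and "\<eta> \<le> b"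
  shows "(\<forall>r\<in>embedding_range CARD('n) b q \<eta>.
            continuous_embedding (E_rad b q :: (real ^ 'n \<Rightarrow> real) set) (E_norm b q)
              (Lp_space (weighted_lebesgue \<eta>) r) (Lp_norm (weighted_lebesgue \<eta>) r))
       \<and> (\<forall>r\<in>embedding_range CARD('n) b q \<eta>. \<forall>\<theta>\<in>{0..1}.
            1 / r = \<theta> * ((real CARD('n) - 2) / (2 * (real CARD('n) - \<eta>)))
                    + (1 - \<theta>) * ((real CARD('n) - b) / (q * (real CARD('n) - \<eta>)))
            \<longrightarrow> (\<exists>C>0. \<forall>u\<in>(E_rad b q :: (real ^ 'n \<Rightarrow> real) set).
                  (LINT x|lebesgue. \<bar>u x\<bar> powr r / norm x powr \<eta>) powr (1 / r)
                  \<le> C * Lp_norm lebesgue 2 (\<lambda>x. norm (weak_gradient u x)) powr \<theta>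
                      * Lp_norm lebesgue q (\<lambda>x. norm x powr (- b / q) * u x) powr (1 - \<theta>)))
       \<and> (\<forall>r\<in>embedding_range CARD('n) b q \<eta>.
            compact_embedding (E_rad b q :: (real ^ 'n \<Rightarrow> real) set) (E_norm b q)
              (Lp_space (weighted_lebesgue \<eta>) r) (Lp_norm (weighted_lebesgue \<eta>) r)
            \<longleftrightarrow> r \<noteq> rad_exp CARD('n) b q \<eta> \<and> ereal r \<noteq> crit_exp CARD('n) \<eta>)"
proof -
  define n where "n = real CARD('n)"
  note dim = assms(1) and b = assms(2,3) and q = assms(4) and \<eta> = assms(6,7)
  have sub: "q * (real CARD('n) - 2) < 2 * (real CARD('n) - b)"
    by (rule subcritical_iff[OF dim b(2) assms(5)])
  have n2: "2 \<le> n" using dim by (simp add: n_def)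
  have rad: "rad_exp CARD('n) b q \<eta> = q + (q + 2) * (b - \<eta>) / (2 * real CARD('n) - 2 - b)"
    by (rule rad_exp_eq[OF dim b(2) \<eta>(2)])
  have range: "q + (q + 2) * (b - \<eta>) / (2 * real CARD('n) - 2 - b) \<le> r"
      "CARD('n) = 2 \<or> r \<le> 2 * (real CARD('n) - \<eta>) / (real CARD('n) - 2)"
    if "r \<in> embedding_range CARD('n) b q \<eta>" for r
    using that dim by (auto simp: embedding_range_def rad crit_exp_le_iff)
  have cont: "continuous_embedding (E_rad b q :: (real ^ 'n \<Rightarrow> real) set) (E_norm b q)
      (Lp_space (weighted_lebesgue \<eta>) r) (Lp_norm (weighted_lebesgue \<eta>) r)"
    if "r \<in> embedding_range CARD('n) b q \<eta>" for r
    by (rule E_rad_continuous_embedding[OF dim b q sub \<eta> range[OF that]])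
  have gn: "\<exists>C>0. \<forall>u\<in>(E_rad b q :: (real ^ 'n \<Rightarrow> real) set).
      (LINT x|lebesgue. \<bar>u x\<bar> powr r / norm x powr \<eta>) powr (1 / r)
      \<le> C * Lp_norm lebesgue 2 (\<lambda>x. norm (weak_gradient u x)) powr \<theta>
          * Lp_norm lebesgue q (\<lambda>x. norm x powr (- b / q) * u x) powr (1 - \<theta>)"
    if r: "r \<in> embedding_range CARD('n) b q \<eta>"
      and \<theta>: "1 / r = \<theta> * ((real CARD('n) - 2) / (2 * (real CARD('n) - \<eta>)))
                    + (1 - \<theta>) * ((real CARD('n) - b) / (q * (real CARD('n) - \<eta>)))" for r \<theta>
  proof -
    have rpos: "0 < r" using radial_exponent_pos[OF n2 b(2) q \<eta>(2), of r] range(1)[OF r] by (simp add: n_def)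
    have n\<eta>: "0 < n - \<eta>" using n2 b \<eta> by linarith
    define \<alpha> where "\<alpha> = gn_weight n b q \<eta> r"
    have \<alpha>: "\<alpha> = \<theta> * r"
    proof -
      have "(n - 2) / 2 - (n - b) / q < 0" using gn_weight_denominator[OF q sub] by (simp add: n_def)
      moreover have "(n - \<eta>) - r * (n - b) / q = (\<theta> * r) * ((n - 2) / 2 - (n - b) / q)"
      proof -
        have cancel: "(y / (2 * d)) * d = y / 2" if "d \<noteq> 0" for y d :: real
          using that by simp
        have alg: "y - r * B = (\<theta> * r) * (A - B)" if "y = r * (\<theta> * A + (1 - \<theta>) * B)" for y A B
          unfolding that by (simp add: algebra_simps)
        have "(1 / r) * (r * (n - \<eta>)) = (\<theta> * ((n - 2) / (2 * (n - \<eta>))) + (1 - \<theta>) * ((n - b) / (q * (n - \<eta>)))) * (r * (n - \<eta>))"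
          using \<theta> by (simp add: n_def)
        also have "\<dots> = r * (\<theta> * (((n - 2) / (2 * (n - \<eta>))) * (n - \<eta>)) + (1 - \<theta>) * (((n - b) / (q * (n - \<eta>))) * (n - \<eta>)))"
          by (simp only: distrib_left distrib_right mult_ac)
        also have "((n - 2) / (2 * (n - \<eta>))) * (n - \<eta>) = (n - 2) / 2"
          by (rule cancel) (use n\<eta> in simp)
        also have "((n - b) / (q * (n - \<eta>))) * (n - \<eta>) = (n - b) / q" using n\<eta> by simp
        finally have "n - \<eta> = r * (\<theta> * ((n - 2) / 2) + (1 - \<theta>) * ((n - b) / q))" using rpos by simp
        then show ?thesis unfolding times_divide_eq_right[symmetric] by (rule alg)
      qed
      ultimately show ?thesis unfolding \<alpha>_def gn_weight_def by simp
    qed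
    obtain C where C: "0 < C" "\<And>u :: real^'n \<Rightarrow> real. u \<in> E_rad b q \<Longrightarrow> moment \<eta> r u \<le>
        ennreal (C * gradient_norm u powr \<alpha> * potential_norm b q u powr (r - \<alpha>))"
      using E_rad_moment_le_gradient[OF dim b q sub \<eta> range[OF r]] unfolding \<alpha>_def n_def by blast
    show ?thesis
    proof (intro exI[of _ "C powr (1 / r)"] conjI ballI)
      show "0 < C powr (1 / r)" using C by simp
      fix u :: "real^'n \<Rightarrow> real" assume u: "u \<in> E_rad b q"
      have um: "u \<in> borel_measurable lebesgue" by (rule E_rad_measurable[OF u])
      have "(LINT x|lebesgue. \<bar>u x\<bar> powr r / norm x powr \<eta>) = enn2real (moment \<eta> r u)"
        by (simp only: powr_divide_weight moment_integrable(2)[OF um])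
      also have "\<dots> \<le> C * gradient_norm u powr \<alpha> * potential_norm b q u powr (r - \<alpha>)"
        using C by (intro enn2real_leI C(2) u) auto
      finally have "(LINT x|lebesgue. \<bar>u x\<bar> powr r / norm x powr \<eta>) powr (1 / r)
          \<le> (C * gradient_norm u powr \<alpha> * potential_norm b q u powr (r - \<alpha>)) powr (1 / r)"
        using rpos by (intro powr_mono2 integral_nonneg_AE AE_I2) auto
      also have "\<dots> = C powr (1 / r) * gradient_norm u powr (\<alpha> * (1 / r)) * potential_norm b q u powr ((r - \<alpha>) * (1 / r))"
        by (simp only: powr_mult powr_powr)
      also have "\<alpha> * (1 / r) = \<theta>" using rpos by (simp add: \<alpha>)
      also have "(r - \<alpha>) * (1 / r) = 1 - \<theta>" using rpos by (simp add: \<alpha> diff_divide_distrib)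
      finally show "(LINT x|lebesgue. \<bar>u x\<bar> powr r / norm x powr \<eta>) powr (1 / r)
        \<le> C powr (1 / r) * Lp_norm lebesgue 2 (\<lambda>x. norm (weak_gradient u x)) powr \<theta>
            * Lp_norm lebesgue q (\<lambda>x. norm x powr (- b / q) * u x) powr (1 - \<theta>)"
        using q by (simp only: Lp_norm_gradient Lp_norm_potential[OF um less_trans[OF zero_less_numeral q]])
    qed
  qed
  have comp: "compact_embedding (E_rad b q :: (real ^ 'n \<Rightarrow> real) set) (E_norm b q)
      (Lp_space (weighted_lebesgue \<eta>) r) (Lp_norm (weighted_lebesgue \<eta>) r)
      \<longleftrightarrow> r \<noteq> rad_exp CARD('n) b q \<eta> \<and> ereal r \<noteq> crit_exp CARD('n) \<eta>"
    if r: "r \<in> embedding_range CARD('n) b q \<eta>" for r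
  proof (cases "r = rad_exp CARD('n) b q \<eta>")
    case True
    then show ?thesis using not_compact_lower_endpoint[OF dim b q sub \<eta>, of r] by (simp add: rad)
  next
    case False
    then have r0: "q + (q + 2) * (b - \<eta>) / (2 * real CARD('n) - 2 - b) < r"
      using range(1)[OF r] by (simp add: rad)
    show ?thesis
    proof (cases "ereal r = crit_exp CARD('n) \<eta>")
      case True
      then have "CARD('n) \<noteq> 2" "r = 2 * (real CARD('n) - \<eta>) / (real CARD('n) - 2)"
        using crit_exp_neq_iff[of r "CARD('n)" \<eta>] by auto
      moreover have "2 < CARD('n)" using calculation(1) dim by linarith
      ultimately show ?thesis using not_compact_upper_endpoint[OF _ b q sub \<eta>, of r] True by blast
    next
      case neq: False
      then have "CARD('n) = 2 \<or> r < 2 * (real CARD('n) - \<eta>) / (real CARD('n) - 2)"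
        using crit_exp_neq_iff[of r "CARD('n)" \<eta>] range(2)[OF r] by auto
      then have "compact_embedding (E_rad b q :: (real ^ 'n \<Rightarrow> real) set) (E_norm b q)
          (Lp_space (weighted_lebesgue \<eta>) r) (Lp_norm (weighted_lebesgue \<eta>) r)"
        unfolding compact_embedding_def using cont[OF r] E_rad_compact_sequence[OF dim b q sub \<eta> r0] by blast
      then show ?thesis using False neq by simp
    qed
  qed
  show ?thesis using cont gn comp by blast
qed

end
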